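(* Suppose $\lambda,\mu,\theta,\sigma$ are suitable, $\sigma>\aleph_0$ is supercompact, and $\mathfrak{B}=\mathfrak{B}^1_{2^\lambda,\mu,\theta}$. Then: (1) there exists a $(\lambda,\mu,\theta,\sigma)$-optimal ultrafilter $\mathcal{D}_*$ on $\mathfrak{B}$; (2) if $\mathcal{D}^*_0$ is a $\sigma$-complete filter on $\mathfrak{B}$ which is generated by fewer than $2^\lambda$ elements, or more generally is generated by a set of elements all supported by $\mathfrak{B}\upharpoonright\mathcal{V}$ for some $\mathcal{V}\subseteq 2^\lambda$ with $|\mathcal{V}|<2^\lambda$, then there exists a $(\lambda,\mu,\theta,\sigma)$-optimal ultrafilter $\mathcal{D}_*$ on $\mathfrak{B}$ extending $\mathcal{D}^*_0$.
   Context: Suitable: $\sigma\le\theta\le\mu<\lambda$ infinite cardinals, $\theta$ regular, $\mu=\mu^{<\theta}$, $\lambda=\lambda^{<\theta}$, and $2^{|\alpha|}<\mu$ for all $\alpha<\theta$. For an ordinal $\alpha$, $\mathrm{FI}_{\mu,\theta}(\alpha)$ is the set of functions $h$ with $\mathrm{Dom}(h)\subseteq\alpha$, $|\mathrm{Dom}(h)|<\theta$, $\mathrm{Range}(h)\subseteq\mu$. $\mathfrak{B}^1_{\alpha,\mu,\theta}$ is the completion of the Boolean algebra generated by elements $\mathbf{x}_f$, $f\in\mathrm{FI}_{\mu,\theta}(\alpha)$, freely subject to: $\mathbf{x}_{f_2}\le\mathbf{x}_{f_1}$ when $f_1\subseteq f_2$, and $\mathbf{x}_f\cap\mathbf{x}_{f'}=0$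 when $f,f'$ are incompatible functions (so $\mathbf{x}_{f\cup g}=\mathbf{x}_f\cap\mathbf{x}_g$ for compatible $f,g$). For $\mathcal{V}\subseteq 2^\lambda$, $\mathfrak{B}\upharpoonright\mathcal{V}$ is the subalgebra generated by $\{\mathbf{x}_f:f\in\mathrm{FI}_{\mu,\theta}(\mathcal{V})\}$; an element $\mathbf{a}$ is supported by $\mathfrak{B}\upharpoonright\mathcal{V}$ if there is a maximal antichain of $\mathfrak{B}$ consisting of elements $\mathbf{x}_f$, $f\in\mathrm{FI}_{\mu,\theta}(\mathcal{V})$, each $\le\mathbf{a}$ or $\le 1-\mathbf{a}$. A sequence $\bar{\mathbf{b}}=\langle\mathbf{b}_u:u\in[\lambda]^{<\sigma}\rangle$ of nonzero elements is continuous if $u\subseteq v\Rightarrow\mathbf{b}_v\le\mathbf{b}_u$ and $\mathbf{b}_u=\bigcap\{\mathbf{b}_v:v\subseteq u\text{ finite}\}$ for infinite $u$. A support of $\bar{\mathbf{b}}$ is a set $X$ of generators $\mathbf{x}_f$ such that for each finite $u$ there is a maximal antichain of $\mathfrak{B}$ of elements of $X$ each $\le\mathbf{b}_u$ or $\le1-\mathbf{b}_u$; $\bar{\mathbf{b}}$ is supported by $\mathfrak{B}\upharpoonright\mathcal{V}$ if some support consists of $\mathbf{x}_f$ with $f\in\mathrm{FI}_{\mu,\theta}(\mathcal{V})$. A continuous $\bar{\mathbf{b}}$ has the $(\lambda,\mu,\theta,\sigma)$-Key Property if there exist $\mathcal{V}\subseteq2^\lambda$ with $|\mathcal{V}|\le\lambda$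 such that $\bar{\mathbf{b}}$ is supported by $\mathfrak{B}\upharpoonright\mathcal{V}$, and a closed unbounded $\Omega_*\subseteq[\lambda]^{<\sigma}$ (cofinal if $\sigma=\aleph_0$), such that for every $\alpha<2^\lambda$ with $\mathcal{V}\subseteq\alpha$ there is a sequence $\langle\mathbf{b}'_{\{i\}}:i<\lambda\rangle$ of nonzero elements such that, setting $\mathbf{b}'_u=\bigcap_{i\in u}\mathbf{b}'_{\{i\}}$, we have $\mathbf{b}'_u\le\mathbf{b}_u$ (and $\mathbf{b}'_u\ne0$) for all $u\in[\lambda]^{<\sigma}$, and for every $f\in\mathrm{FI}_{\mu,\theta}(\alpha)$ and $u\in\Omega_*$ with $\mathbf{x}_f\le\mathbf{b}_u$ there is $f'\supseteq f$, $f'\in\mathrm{FI}_{\mu,\theta}(2^\lambda)$, with $\mathbf{x}_{f'}\le\mathbf{b}'_u$. An ultrafilter $\mathcal{D}_*$ on $\mathfrak{B}=\mathfrak{B}^1_{2^\lambda,\mu,\theta}$ is $(\lambda,\mu,\theta,\sigma)$-optimal if it is $\sigma$-complete and every continuous sequence $\bar{\mathbf{b}}$ of elements of $\mathcal{D}_*$ with the Key Property has a multiplicative refinement in $\mathcal{D}_*$, i.e. $\langle\mathbf{b}'_u:u\in[\lambda]^{<\sigma}\rangle$ with $\mathbf{b}'_u\in\mathcal{D}_*$, $\mathbf{b}'_u\le\mathbf{b}_u$, $\mathbf{b}'_{u_1}\cap\mathbf{b}'_{u_2}=\mathbf{b}'_{u_1\cup u_2}$. *)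

theory Defs
  imports Main
begin

unbundle cardinal_syntax

text \<open>
  Cardinals are card orders in the sense of \<^const>\<open>Card_order\<close>, and ordinals below a cardinal \<open>r\<close>
  are the initial segments \<^term>\<open>underS r a\<close>, \<^prop>\<open>a \<in> Field r\<close>.
\<close>

section \<open>Cardinal parameters\<close>

text \<open>\<open>less_cexp r s\<close> is \<open>r\<close> to the power \<open><s\<close>: the number of sequences in \<open>r\<close> whose length is an
  ordinal below \<open>s\<close>.\<close>

definition less_cexp :: "'a rel \<Rightarrow> 'b rel \<Rightarrow> ('b \<rightharpoonup> 'a) rel" where
  "less_cexp r s = |{h. ran h \<subseteq> Field r \<and> (\<exists>a\<in>Field s. dom h = underS s a)}|"

definition suitable :: "'l rel \<Rightarrow> 'm rel \<Rightarrow> 't rel \<Rightarrow> 's rel \<Rightarrow> bool" where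
  "suitable lam mu theta sigma \<longleftrightarrow>
     Cinfinite lam \<and> Cinfinite mu \<and> Cinfinite theta \<and> Cinfinite sigma \<and>
     sigma \<le>o theta \<and> theta \<le>o mu \<and> mu <o lam \<and>
     regularCard theta \<and>
     mu =o less_cexp mu theta \<and>
     lam =o less_cexp lam theta \<and>
     (\<forall>a\<in>Field theta. |Pow (underS theta a)| <o mu)"

text \<open>\<open>[A]\<^bsup><\<sigma>\<^esup>\<close>\<close>

definition small_subsets :: "'s rel \<Rightarrow> 'a set \<Rightarrow> 'a set set" where
  "small_subsets sigma A = {u. u \<subseteq> A \<and> |u| <o sigma}"

definition unbounded_in :: "'s rel \<Rightarrow> 'a set \<Rightarrow> 'a set set \<Rightarrow> bool" where
  "unbounded_in sigma A Om \<longleftrightarrow>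
     Om \<subseteq> small_subsets sigma A \<and> (\<forall>u\<in>small_subsets sigma A. \<exists>v\<in>Om. u \<subseteq> v)"

definition club_in :: "'s rel \<Rightarrow> 'a set \<Rightarrow> 'a set set \<Rightarrow> bool" where
  "club_in sigma A Om \<longleftrightarrow>
     unbounded_in sigma A Om \<and>
     (\<forall>C. C \<subseteq> Om \<and> C \<noteq> {} \<and> chain_subset C \<and> |C| <o sigma \<longrightarrow> \<Union>C \<in> Om)"

section \<open>Supercompactness\<close>

definition complete_ultrafilter_on :: "'s rel \<Rightarrow> 'a set \<Rightarrow> 'a set set \<Rightarrow> bool" where
  "complete_ultrafilter_on sigma S U \<longleftrightarrow>
     U \<subseteq> Pow S \<and> S \<in> U \<and> {} \<notin> U \<and>
     (\<forall>X\<in>U. \<forall>Y. X \<subseteq> Y \<and> Y \<subseteq> S \<longrightarrow> Y \<in> U) \<and>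
     (\<forall>X. X \<subseteq> S \<longrightarrow> X \<in> U \<or> S - X \<in> U) \<and>
     (\<forall>C. C \<subseteq> U \<and> C \<noteq> {} \<and> |C| <o sigma \<longrightarrow> \<Inter>C \<in> U)"

definition fine_on :: "'s rel \<Rightarrow> 'a set \<Rightarrow> 'a set set set \<Rightarrow> bool" where
  "fine_on sigma K U \<longleftrightarrow> (\<forall>x\<in>K. {u \<in> small_subsets sigma K. x \<in> u} \<in> U)"

definition normal_on :: "'s rel \<Rightarrow> 'a set \<Rightarrow> 'a set set set \<Rightarrow> bool" where
  "normal_on sigma K U \<longleftrightarrow>
     (\<forall>f. {u \<in> small_subsets sigma K. f u \<in> u} \<in> U \<longrightarrow>
        (\<exists>x\<in>K. {u \<in> small_subsets sigma K. f u = x} \<in> U))"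

text \<open>HOL cannot quantify over all cardinals; the cardinals \<open>\<kappa> \<ge> \<sigma>\<close> in the definition of a
  supercompact cardinal range over the sizes of the subsets of the type \<^typ>\<open>'u\<close>, which plays the
  role of the universe.\<close>

definition supercompact :: "'u itself \<Rightarrow> 's rel \<Rightarrow> bool" where
  "supercompact _ sigma \<longleftrightarrow>
     natLeq <o sigma \<and> Card_order sigma \<and>
     (\<forall>K :: 'u set. sigma \<le>o |K| \<longrightarrow>
        (\<exists>U. complete_ultrafilter_on sigma (small_subsets sigma K) U \<and>
             fine_on sigma K U \<and> normal_on sigma K U))"

section \<open>Boolean algebras given by generators and relations\<close>

datatype 'g bterm =
    Gen 'g
  | Zero
  | One
  | Meet "'g bterm" "'g bterm"
  | Join "'g bterm" "'g bterm"
  | Compl "'g bterm"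

text \<open>The least congruence containing the relations \<open>R\<close> and the axioms of Boolean algebras.\<close>

inductive ba_eq :: "('g bterm \<Rightarrow> 'g bterm \<Rightarrow> bool) \<Rightarrow> 'g bterm \<Rightarrow> 'g bterm \<Rightarrow> bool"
  for R :: "'g bterm \<Rightarrow> 'g bterm \<Rightarrow> bool" where
  rel: "R s t \<Longrightarrow> ba_eq R s t"
| refl: "ba_eq R s s"
| sym: "ba_eq R s t \<Longrightarrow> ba_eq R t s"
| trans: "ba_eq R s t \<Longrightarrow> ba_eq R t r \<Longrightarrow> ba_eq R s r"
| cong_Meet: "ba_eq R s s' \<Longrightarrow> ba_eq R t t' \<Longrightarrow> ba_eq R (Meet s t) (Meet s' t')"
| cong_Join: "ba_eq R s s' \<Longrightarrow> ba_eq R t t' \<Longrightarrow> ba_eq R (Join s t) (Join s' t')"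
| cong_Compl: "ba_eq R s s' \<Longrightarrow> ba_eq R (Compl s) (Compl s')"
| Meet_comm: "ba_eq R (Meet s t) (Meet t s)"
| Join_comm: "ba_eq R (Join s t) (Join t s)"
| Meet_assoc: "ba_eq R (Meet (Meet s t) r) (Meet s (Meet t r))"
| Join_assoc: "ba_eq R (Join (Join s t) r) (Join s (Join t r))"
| Meet_absorb: "ba_eq R (Meet s (Join s t)) s"
| Join_absorb: "ba_eq R (Join s (Meet s t)) s"
| Join_distrib: "ba_eq R (Join s (Meet t r)) (Meet (Join s t) (Join s r))"
| Meet_Zero: "ba_eq R (Meet Zero s) Zero"
| Join_One: "ba_eq R (Join One s) One"
| Meet_Compl: "ba_eq R (Meet s (Compl s)) Zero"
| Join_Compl: "ba_eq R (Join s (Compl s)) One"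

section \<open>The completion of a Boolean algebra\<close>

text \<open>The Dedekind--MacNeille completion: the elements are the cuts, i.e. the sets of lower bounds
  of the set of their upper bounds, ordered by inclusion.\<close>

definition upper_bounds :: "'a::order set \<Rightarrow> 'a set" where
  "upper_bounds A = {b. \<forall>a\<in>A. a \<le> b}"

definition lower_bounds :: "'a::order set \<Rightarrow> 'a set" where
  "lower_bounds A = {b. \<forall>a\<in>A. b \<le> a}"

definition cut_closure :: "'a::order set \<Rightarrow> 'a set" where
  "cut_closure A = lower_bounds (upper_bounds A)"

lemma cut_closure_extensive: "A \<subseteq> cut_closure A"
  by (auto simp: cut_closure_def lower_bounds_def upper_bounds_def)

lemma cut_closureI: "(\<And>c. (\<And>b. b \<in> A \<Longrightarrow> b \<le> c) \<Longrightarrow> a \<le> c) \<Longrightarrow> a \<in> cut_closure A"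
  by (simp add: cut_closure_def lower_bounds_def upper_bounds_def)

lemma cut_closureD: "a \<in> cut_closure A \<Longrightarrow> (\<And>b. b \<in> A \<Longrightarrow> b \<le> c) \<Longrightarrow> a \<le> c"
  by (simp add: cut_closure_def lower_bounds_def upper_bounds_def)

lemma cut_closure_mono: "A \<subseteq> B \<Longrightarrow> cut_closure A \<subseteq> cut_closure B"
  by (auto simp: cut_closure_def lower_bounds_def upper_bounds_def)

lemma cut_closure_idem [simp]: "cut_closure (cut_closure A) = cut_closure A"
  by (auto simp: cut_closure_def lower_bounds_def upper_bounds_def)

lemma cut_closure_least: "A \<subseteq> B \<Longrightarrow> cut_closure B = B \<Longrightarrow> cut_closure A \<subseteq> B"
  using cut_closure_mono by blast

lemma cut_closure_Inter: "(\<And>I. I \<in> S \<Longrightarrow> cut_closure I = I) \<Longrightarrow> cut_closure (\<Inter>S) = \<Inter>S"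
  using cut_closure_extensive cut_closure_mono
  by (metis Inter_greatest Inter_lower subset_antisym)

lemma cut_closure_Int:
  "cut_closure I = I \<Longrightarrow> cut_closure J = J \<Longrightarrow> cut_closure (I \<inter> J) = I \<inter> J"
  using cut_closure_Inter[of "{I, J}"] by auto

lemma cut_closure_atMost: "cut_closure {..a} = {..a}"
  by (auto simp: cut_closure_def lower_bounds_def upper_bounds_def)

typedef (overloaded) ('a::boolean_algebra) completion = "{I :: 'a set. cut_closure I = I}"
  by (rule exI[of _ UNIV]) (use cut_closure_extensive in blast)

setup_lifting type_definition_completion

lemma cut_downward:
  assumes "cut_closure I = I" "a \<in> I" "b \<le> a"
  shows "b \<in> I"
proof -
  have "b \<in> cut_closure I"
    using assms(2,3) by (auto simp: cut_closure_def lower_bounds_def upper_bounds_def intro: order_trans)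
  then show ?thesis using assms(1) by simp
qed

instantiation completion :: (boolean_algebra) complete_lattice
begin

lift_definition less_eq_completion :: "'a completion \<Rightarrow> 'a completion \<Rightarrow> bool"
  is "\<lambda>I J. I \<subseteq> J" .

lift_definition less_completion :: "'a completion \<Rightarrow> 'a completion \<Rightarrow> bool"
  is "\<lambda>I J. I \<subset> J" .

lift_definition Inf_completion :: "'a completion set \<Rightarrow> 'a completion"
  is "\<lambda>S. \<Inter>S" by (rule cut_closure_Inter) blast

lift_definition Sup_completion :: "'a completion set \<Rightarrow> 'a completion"
  is "\<lambda>S. cut_closure (\<Union>S)" by simp

lift_definition inf_completion :: "'a completion \<Rightarrow> 'a completion \<Rightarrow> 'a completion"
  is "\<lambda>I J. I \<inter> J"
  using cut_closure_Int by blast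

lift_definition sup_completion :: "'a completion \<Rightarrow> 'a completion \<Rightarrow> 'a completion"
  is "\<lambda>I J. cut_closure (I \<union> J)" by simp

lift_definition bot_completion :: "'a completion" is "cut_closure {}" by simp

lift_definition top_completion :: "'a completion" is "UNIV"
  using cut_closure_extensive by blast

instance
proof
  fix x y z :: "'a completion" and A :: "'a completion set"
  show "(x < y) = (x \<le> y \<and> \<not> y \<le> x)" by transfer auto
  show "x \<le> x" by transfer simp
  show "x \<le> y \<Longrightarrow> y \<le> z \<Longrightarrow> x \<le> z" by transfer blast
  show "x \<le> y \<Longrightarrow> y \<le> x \<Longrightarrow> x = y" by transfer blast
  show "inf x y \<le> x" by transfer blast
  show "inf x y \<le> y" by transfer blast
  show "x \<le> y \<Longrightarrow> x \<le> z \<Longrightarrow> x \<le> inf y z" by transfer blast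
  show "x \<le> sup x y" by transfer (use cut_closure_extensive in blast)
  show "y \<le> sup x y" by transfer (use cut_closure_extensive in blast)
  show "y \<le> x \<Longrightarrow> z \<le> x \<Longrightarrow> sup y z \<le> x"
    by transfer (rule cut_closure_least, auto)
  show "x \<in> A \<Longrightarrow> Inf A \<le> x" by transfer blast
  show "(\<And>x. x \<in> A \<Longrightarrow> z \<le> x) \<Longrightarrow> z \<le> Inf A" by transfer blast
  show "x \<in> A \<Longrightarrow> x \<le> Sup A"
    by transfer (rule order_trans[OF Union_upper cut_closure_extensive])
  show "(\<And>x. x \<in> A \<Longrightarrow> x \<le> z) \<Longrightarrow> Sup A \<le> z"
    by transfer (rule cut_closure_least, auto)
  show "Inf {} = (top :: 'a completion)" by transfer simp
  show "Sup {} = (bot :: 'a completion)" by transfer simp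
qed

end

lemma cut_compl: "cut_closure {a. \<forall>b\<in>I. inf a b = bot} = {a. \<forall>b\<in>I. inf a b = bot}"
  for I :: "'a::boolean_algebra set"
proof -
  have "{a. \<forall>b\<in>I. inf a b = bot} = \<Inter>((\<lambda>b. {..- b}) ` I)"
    by (auto simp: inf_shunt)
  moreover have "cut_closure (\<Inter>((\<lambda>b. {..- b}) ` I)) = \<Inter>((\<lambda>b. {..- b}) ` I)"
    by (rule cut_closure_Inter) (auto simp: cut_closure_atMost)
  ultimately show ?thesis by simp
qed

instantiation completion :: (boolean_algebra) boolean_algebra
begin

lift_definition uminus_completion :: "'a completion \<Rightarrow> 'a completion"
  is "\<lambda>I. {a. \<forall>b\<in>I. inf a b = bot}" by (rule cut_compl)

definition minus_completion :: "'a completion \<Rightarrow> 'a completion \<Rightarrow> 'a completion" where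
  "minus_completion x y = inf x (- y)"

instance
proof
  fix x y z :: "'a completion"
  show "x - y = inf x (- y)" by (fact minus_completion_def)
  show "inf x (- x) = bot"
  proof transfer
    fix I :: "'a set" assume I: "cut_closure I = I"
    have "cut_closure {} = {bot :: 'a}"
      by (auto simp: cut_closure_def lower_bounds_def upper_bounds_def intro: bot.extremum_uniqueI)
    moreover have "bot \<in> I" using I cut_closureI[of I bot] by simp
    moreover have "a = bot" if "a \<in> I" "\<forall>b\<in>I. inf a b = bot" for a
      using that(2)[rule_format, OF that(1)] by simp
    ultimately show "I \<inter> {a. \<forall>b\<in>I. inf a b = bot} = cut_closure {}"
      by auto
  qed
  show "sup x (- x) = top"
  proof transfer
    fix I :: "'a set" assume I: "cut_closure I = I"
    have "c = top" if c: "\<And>a. a \<in> I \<union> {a. \<forall>b\<in>I. inf a b = bot} \<Longrightarrow> a \<le> c" for c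
    proof -
      have "inf (- c) b = bot" if "b \<in> I" for b
        using c[of b] that by (simp add: inf_shunt)
      then have "- c \<le> c" using c by blast
      then show ?thesis by (metis compl_sup_top sup.absorb2)
    qed
    then have "upper_bounds (I \<union> {a. \<forall>b\<in>I. inf a b = bot}) \<subseteq> {top}"
      unfolding upper_bounds_def by blast
    then have "lower_bounds {top} \<subseteq> cut_closure (I \<union> {a. \<forall>b\<in>I. inf a b = bot})"
      unfolding cut_closure_def lower_bounds_def by blast
    then show "cut_closure (I \<union> {a. \<forall>b\<in>I. inf a b = bot}) = UNIV"
      by (auto simp: lower_bounds_def)
  qed
  have "inf x (sup y z) \<le> sup (inf x y) (inf x z)" for x y z :: "'a completion"
  proof transfer
    fix I J K :: "'a set"
    assume I: "cut_closure I = I" and J: "cut_closure J = J" and K: "cut_closure K = K"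
    show "I \<inter> cut_closure (J \<union> K) \<subseteq> cut_closure (I \<inter> J \<union> I \<inter> K)"
    proof
      fix a assume a: "a \<in> I \<inter> cut_closure (J \<union> K)"
      have "a \<le> c" if c: "\<And>d. d \<in> I \<inter> J \<union> I \<inter> K \<Longrightarrow> d \<le> c" for c
      proof -
        have "b \<le> sup (- a) c" if b: "b \<in> J \<union> K" for b
        proof -
          have "inf a b \<in> I \<inter> J \<union> I \<inter> K"
            using a b cut_downward[OF I _ inf_le1] cut_downward[OF J _ inf_le2]
              cut_downward[OF K _ inf_le2] by auto
          then have "inf a b \<le> c" by (rule c)
          then have "inf b a \<le> c" by (subst inf.commute)
          then show ?thesis by (simp only: shunt1)
        qed
        then have "a \<le> sup (- a) c"
          using a cut_closureD[of a "J \<union> K"] by simp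
        then have "inf a a \<le> c" by (simp only: shunt1)
        then show ?thesis by simp
      qed
      then show "a \<in> cut_closure (I \<inter> J \<union> I \<inter> K)"
        by (rule cut_closureI)
    qed
  qed
  then have *: "inf x (sup y z) = sup (inf x y) (inf x z)" for x y z :: "'a completion"
    by (rule order.antisym) (rule distrib_inf_le)
  show "sup x (inf y z) = inf (sup x y) (sup x z)"
    by (rule distrib_imp1) (rule *)
qed

end

lift_definition embed :: "'a::boolean_algebra \<Rightarrow> 'a completion" is "\<lambda>a. {..a}"
  by (rule cut_closure_atMost)

section \<open>The Boolean algebra of partial functions\<close>

text \<open>The cardinals \<open>\<mu>\<close> and \<open>\<theta>\<close> are the cardinalities of the types \<^typ>\<open>'m\<close> and \<^typ>\<open>'t\<close>, and
  \<^typ>\<open>'i\<close> is the index set (an ordinal \<open>\<alpha>\<close> in FI(\<open>\<alpha>\<close>)).\<close>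

typedef ('i, 'm, 't) FI = "{h :: 'i \<rightharpoonup> 'm. |dom h| <o |UNIV :: 't set|}"
proof (rule exI[of _ Map.empty])
  have "\<not> |UNIV :: 't set| \<le>o |{} :: 'i set|"
    using card_of_empty3 by fastforce
  then show "Map.empty \<in> {h :: 'i \<rightharpoonup> 'm. |dom h| <o |UNIV :: 't set|}"
    using not_ordLeq_iff_ordLess[OF card_of_Well_order card_of_Well_order] by auto
qed

definition FI_le :: "('i, 'm, 't) FI \<Rightarrow> ('i, 'm, 't) FI \<Rightarrow> bool" where
  "FI_le f g \<longleftrightarrow> Rep_FI f \<subseteq>\<^sub>m Rep_FI g"

definition incompatible :: "('i, 'm, 't) FI \<Rightarrow> ('i, 'm, 't) FI \<Rightarrow> bool" where
  "incompatible f g \<longleftrightarrow> (\<exists>i \<in> dom (Rep_FI f) \<inter> dom (Rep_FI g). Rep_FI f i \<noteq> Rep_FI g i)"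

definition FI_on :: "'i set \<Rightarrow> ('i, 'm, 't) FI set" where
  "FI_on V = {f. dom (Rep_FI f) \<subseteq> V}"

text \<open>The last two relations express \<open>x\<^bsub>f \<union> g\<^esub> = x\<^bsub>f\<^esub> \<inter> x\<^bsub>g\<^esub>\<close> for compatible \<open>f\<close>, \<open>g\<close> and its nullary
  case. They do not follow from the first two, and without them the \<open>x\<^bsub>f\<^esub>\<close> would not be dense:
  for instance the complement of \<open>x\<^bsub>\<emptyset>\<^esub>\<close> would be a nonzero element disjoint from every \<open>x\<^bsub>f\<^esub>\<close>.\<close>

inductive FI_rel :: "('i, 'm, 't) FI bterm \<Rightarrow> ('i, 'm, 't) FI bterm \<Rightarrow> bool" where
  mono: "FI_le f g \<Longrightarrow> FI_rel (Meet (Gen g) (Gen f)) (Gen g)"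
| incompat: "incompatible f g \<Longrightarrow> FI_rel (Meet (Gen f) (Gen g)) Zero"
| union: "\<not> incompatible f g \<Longrightarrow> Rep_FI h = Rep_FI f ++ Rep_FI g \<Longrightarrow>
    FI_rel (Meet (Gen f) (Gen g)) (Gen h)"
| empty: "Rep_FI f = Map.empty \<Longrightarrow> FI_rel (Gen f) One"

quotient_type ('i, 'm, 't) B0 = "('i, 'm, 't) FI bterm" / "ba_eq FI_rel"
  by (rule equivpI) (auto simp: reflp_def symp_def transp_def intro: ba_eq.refl ba_eq.sym ba_eq.trans)

instantiation B0 :: (type, type, type) boolean_algebra
begin

lift_definition inf_B0 :: "('a, 'b, 'c) B0 \<Rightarrow> ('a, 'b, 'c) B0 \<Rightarrow> ('a, 'b, 'c) B0" is Meet
  by (rule ba_eq.cong_Meet)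

lift_definition sup_B0 :: "('a, 'b, 'c) B0 \<Rightarrow> ('a, 'b, 'c) B0 \<Rightarrow> ('a, 'b, 'c) B0" is Join
  by (rule ba_eq.cong_Join)

lift_definition uminus_B0 :: "('a, 'b, 'c) B0 \<Rightarrow> ('a, 'b, 'c) B0" is Compl
  by (rule ba_eq.cong_Compl)

lift_definition bot_B0 :: "('a, 'b, 'c) B0" is Zero .

lift_definition top_B0 :: "('a, 'b, 'c) B0" is One .

definition minus_B0 :: "('a, 'b, 'c) B0 \<Rightarrow> ('a, 'b, 'c) B0 \<Rightarrow> ('a, 'b, 'c) B0" where
  "minus_B0 x y = inf x (- y)"

definition less_eq_B0 :: "('a, 'b, 'c) B0 \<Rightarrow> ('a, 'b, 'c) B0 \<Rightarrow> bool" where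
  "less_eq_B0 x y \<longleftrightarrow> inf x y = x"

definition less_B0 :: "('a, 'b, 'c) B0 \<Rightarrow> ('a, 'b, 'c) B0 \<Rightarrow> bool" where
  "less_B0 x y \<longleftrightarrow> inf x y = x \<and> x \<noteq> y"

instance
proof
  fix x y z :: "('a, 'b, 'c) B0"
  have mc: "inf a b = inf b a" for a b :: "('a, 'b, 'c) B0" by transfer (rule ba_eq.Meet_comm)
  have jc: "sup a b = sup b a" for a b :: "('a, 'b, 'c) B0" by transfer (rule ba_eq.Join_comm)
  have ma: "inf (inf a b) c = inf a (inf b c)" for a b c :: "('a, 'b, 'c) B0"
    by transfer (rule ba_eq.Meet_assoc)
  have ja: "sup (sup a b) c = sup a (sup b c)" for a b c :: "('a, 'b, 'c) B0"
    by transfer (rule ba_eq.Join_assoc)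
  have m_abs: "inf a (sup a b) = a" for a b :: "('a, 'b, 'c) B0"
    by transfer (rule ba_eq.Meet_absorb)
  have j_abs: "sup a (inf a b) = a" for a b :: "('a, 'b, 'c) B0"
    by transfer (rule ba_eq.Join_absorb)
  have mi: "inf a a = a" for a :: "('a, 'b, 'c) B0" by (metis m_abs j_abs)
  have le_sup: "inf a b = a \<longleftrightarrow> sup a b = b" for a b :: "('a, 'b, 'c) B0"
    by (metis m_abs j_abs mc jc)
  show "(x < y) = (x \<le> y \<and> \<not> y \<le> x)"
    unfolding less_B0_def less_eq_B0_def by (metis mc mi)
  show "x \<le> x" unfolding less_eq_B0_def by (rule mi)
  show "x \<le> y \<Longrightarrow> y \<le> z \<Longrightarrow> x \<le> z" unfolding less_eq_B0_def by (metis ma)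
  show "x \<le> y \<Longrightarrow> y \<le> x \<Longrightarrow> x = y" unfolding less_eq_B0_def by (metis mc)
  show "inf x y \<le> x" unfolding less_eq_B0_def by (metis ma mc mi)
  show "inf x y \<le> y" unfolding less_eq_B0_def by (metis ma mi)
  show "x \<le> y \<Longrightarrow> x \<le> z \<Longrightarrow> x \<le> inf y z" unfolding less_eq_B0_def by (metis ma)
  show "x \<le> sup x y" unfolding less_eq_B0_def by (rule m_abs)
  show "y \<le> sup x y" unfolding less_eq_B0_def by (metis m_abs jc)
  show "y \<le> x \<Longrightarrow> z \<le> x \<Longrightarrow> sup y z \<le> x"
    unfolding less_eq_B0_def le_sup by (metis ja)
  show "bot \<le> x" unfolding less_eq_B0_def by transfer (rule ba_eq.Meet_Zero)
  have "sup top x = top" by transfer (rule ba_eq.Join_One)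
  then show "x \<le> top" unfolding less_eq_B0_def le_sup by (metis jc)
  show "sup x (inf y z) = inf (sup x y) (sup x z)" by transfer (rule ba_eq.Join_distrib)
  show "inf x (- x) = bot" by transfer (rule ba_eq.Meet_Compl)
  show "sup x (- x) = top" by transfer (rule ba_eq.Join_Compl)
  show "x - y = inf x (- y)" by (fact minus_B0_def)
qed

end

lift_definition gen :: "('i, 'm, 't) FI \<Rightarrow> ('i, 'm, 't) B0" is Gen .

type_synonym ('i, 'm, 't) B1 = "('i, 'm, 't) B0 completion"

definition xgen :: "('i, 'm, 't) FI \<Rightarrow> ('i, 'm, 't) B1" where
  "xgen f = embed (gen f)"

section \<open>Antichains, filters and ultrafilters\<close>

definition antichain :: "'b::boolean_algebra set \<Rightarrow> bool" where
  "antichain A \<longleftrightarrow> bot \<notin> A \<and> (\<forall>a\<in>A. \<forall>b\<in>A. a \<noteq> b \<longrightarrow> inf a b = bot)"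

definition maximal_antichain :: "'b::boolean_algebra set \<Rightarrow> bool" where
  "maximal_antichain A \<longleftrightarrow> antichain A \<and> (\<forall>A'. antichain A' \<and> A \<subseteq> A' \<longrightarrow> A' = A)"

definition ba_filter :: "'b::boolean_algebra set \<Rightarrow> bool" where
  "ba_filter D \<longleftrightarrow>
     top \<in> D \<and> bot \<notin> D \<and> (\<forall>a\<in>D. \<forall>b. a \<le> b \<longrightarrow> b \<in> D) \<and> (\<forall>a\<in>D. \<forall>b\<in>D. inf a b \<in> D)"

definition ba_ultrafilter :: "'b::boolean_algebra set \<Rightarrow> bool" where
  "ba_ultrafilter D \<longleftrightarrow> ba_filter D \<and> (\<forall>a. a \<in> D \<or> - a \<in> D)"

definition complete_filter :: "'s rel \<Rightarrow> 'b::{boolean_algebra, complete_lattice} set \<Rightarrow> bool" where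
  "complete_filter sigma D \<longleftrightarrow> ba_filter D \<and> (\<forall>C. C \<subseteq> D \<and> |C| <o sigma \<longrightarrow> Inf C \<in> D)"

text \<open>\<open>D\<close> is the least \<open>\<sigma>\<close>-complete filter containing \<open>G\<close>. If the ordinary filter generated by \<open>G\<close>
  happens to be \<open>\<sigma>\<close>-complete, it is generated by \<open>G\<close> in this sense too.\<close>

definition generates_filter ::
    "'s rel \<Rightarrow> 'b::{boolean_algebra, complete_lattice} set \<Rightarrow> 'b set \<Rightarrow> bool" where
  "generates_filter sigma G D \<longleftrightarrow>
     complete_filter sigma D \<and> G \<subseteq> D \<and>
     (\<forall>F. complete_filter sigma F \<and> G \<subseteq> F \<longrightarrow> D \<subseteq> F)"

definition supported :: "'i set \<Rightarrow> ('i, 'm, 't) B1 \<Rightarrow> bool" where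
  "supported V a \<longleftrightarrow>
     (\<exists>A. maximal_antichain A \<and> A \<subseteq> xgen ` FI_on V \<and> (\<forall>c\<in>A. c \<le> a \<or> c \<le> - a))"

section \<open>Continuous sequences, the Key Property and optimality\<close>

text \<open>From here on \<open>\<lambda>\<close> is the cardinality of the type \<^typ>\<open>'l\<close> and the index type of the algebra is
  \<^typ>\<open>'l set\<close>, well-ordered in type \<open>2\<^bsup>\<lambda>\<^esup>\<close> by the card order \<^term>\<open>|UNIV :: 'l set set|\<close>. A sequence
  indexed by \<open>[\<lambda>]\<^bsup><\<sigma>\<^esup>\<close> is a function on \<^typ>\<open>'l set\<close> whose values outside
  \<^term>\<open>small_subsets sigma (UNIV :: 'l set)\<close> are irrelevant.\<close>

definition continuous_seq ::
    "'s rel \<Rightarrow> ('l set \<Rightarrow> 'b::{boolean_algebra, complete_lattice}) \<Rightarrow> bool" where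
  "continuous_seq sigma b \<longleftrightarrow>
     (\<forall>u\<in>small_subsets sigma UNIV. b u \<noteq> bot) \<and>
     (\<forall>u\<in>small_subsets sigma UNIV. \<forall>v\<in>small_subsets sigma UNIV. u \<subseteq> v \<longrightarrow> b v \<le> b u) \<and>
     (\<forall>u\<in>small_subsets sigma UNIV. infinite u \<longrightarrow> b u = Inf (b ` {v. v \<subseteq> u \<and> finite v}))"

definition is_support :: "('i, 'm, 't) B1 set \<Rightarrow> ('l set \<Rightarrow> ('i, 'm, 't) B1) \<Rightarrow> bool" where
  "is_support X b \<longleftrightarrow>
     X \<subseteq> range xgen \<and>
     (\<forall>u. finite u \<longrightarrow>
        (\<exists>A. maximal_antichain A \<and> A \<subseteq> X \<and> (\<forall>c\<in>A. c \<le> b u \<or> c \<le> - b u)))"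

definition seq_supported :: "'i set \<Rightarrow> ('l set \<Rightarrow> ('i, 'm, 't) B1) \<Rightarrow> bool" where
  "seq_supported V b \<longleftrightarrow> (\<exists>X. is_support X b \<and> X \<subseteq> xgen ` FI_on V)"

definition key_property :: "'s rel \<Rightarrow> ('l set \<Rightarrow> ('l set, 'm, 't) B1) \<Rightarrow> bool" where
  "key_property sigma b \<longleftrightarrow>
     continuous_seq sigma b \<and>
     (\<exists>(V :: 'l set set) Om.
        |V| \<le>o |UNIV :: 'l set| \<and> seq_supported V b \<and>
        (if sigma =o natLeq then unbounded_in sigma UNIV Om else club_in sigma UNIV Om) \<and>
        (\<forall>a. V \<subseteq> underS |UNIV :: 'l set set| a \<longrightarrow>
           (\<exists>b' :: 'l \<Rightarrow> ('l set, 'm, 't) B1.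
              (\<forall>i. b' i \<noteq> bot) \<and>
              (\<forall>u\<in>small_subsets sigma UNIV. Inf (b' ` u) \<le> b u \<and> Inf (b' ` u) \<noteq> bot) \<and>
              (\<forall>f\<in>FI_on (underS |UNIV :: 'l set set| a). \<forall>u\<in>Om. xgen f \<le> b u \<longrightarrow>
                 (\<exists>f'. FI_le f f' \<and> xgen f' \<le> Inf (b' ` u))))))"

definition multiplicative_refinement ::
    "'s rel \<Rightarrow> 'b::boolean_algebra set \<Rightarrow> ('l set \<Rightarrow> 'b) \<Rightarrow> ('l set \<Rightarrow> 'b) \<Rightarrow> bool" where
  "multiplicative_refinement sigma D b b' \<longleftrightarrow>
     (\<forall>u\<in>small_subsets sigma UNIV. b' u \<in> D \<and> b' u \<le> b u) \<and>
     (\<forall>u\<in>small_subsets sigma UNIV. \<forall>v\<in>small_subsets sigma UNIV. inf (b' u) (b' v) = b' (u \<union> v))"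

definition optimal :: "'s rel \<Rightarrow> ('l set, 'm, 't) B1 set \<Rightarrow> bool" where
  "optimal sigma D \<longleftrightarrow>
     ba_ultrafilter D \<and> complete_filter sigma D \<and>
     (\<forall>b. (\<forall>u\<in>small_subsets sigma UNIV. b u \<in> D) \<and> continuous_seq sigma b \<and> key_property sigma b \<longrightarrow>
        (\<exists>b'. multiplicative_refinement sigma D b b'))"

end

theory Submission
  imports Defs
begin

text \<open>
  The ultrafilter is read off from a normal fine ultrafilter \<open>U\<close> on the small subsets \<open>w\<close> of \<open>2\<^bsup>\<lambda>\<^esup>\<close>: each \<open>w\<close>
  gets a condition \<open>f\<^sub>w\<close>, and \<open>a \<in> D\<close> iff \<open>xgen f\<^sub>w \<le> a\<close> for \<open>U\<close>-almost all \<open>w\<close>. The condition \<open>f\<^sub>w\<close> is built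
  below the meet of the elements of \<open>G\<close> listed in \<open>w\<close> by a recursion along the fewer than \<open>\<sigma>\<close> stages
  \<open>\<alpha> \<in> w\<close>, so limits are harmless because the conditions are closed under unions of chains shorter
  than \<open>\<theta>\<close>. Stage \<open>\<alpha>\<close> decides the \<open>\<alpha>\<close>-th element of the algebra; moreover, if \<open>b\<close> is the
  \<open>\<alpha>\<close>-th sequence with the Key Property and \<open>u = w \<inter> \<lambda>\<close>, it enters \<open>- b v\<close> for a finite \<open>v \<subseteq> u\<close> or else,
  if \<open>u\<close> is in the club of \<open>b\<close>, the meet of the \<open>b' i\<close> with \<open>i \<in> u\<close>. If all \<open>b v\<close> are in \<open>D\<close>, the first
  alternative is \<open>U\<close>-rare, since by normality \<open>v\<close> would be constant on a set in \<open>U\<close>; as \<open>U\<close> contains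
  the clubs, all \<open>b' i\<close> are in \<open>D\<close>. The refinement \<open>b'\<close> must not depend on \<open>w\<close>, so the coordinates used
  before stage \<open>\<alpha>\<close> are bounded in advance by a set of size less than \<open>2\<^bsup>\<lambda>\<^esup>\<close>, which works because every
  element is determined by at most \<open>\<lambda>\<close> coordinates.
\<close>

section \<open>The generators are dense\<close>

text \<open>Reads a term in the powerset algebra of total functions, a generator becoming the cone
  of its total extensions. The relations hold in this model, so it can refute equations in the
  quotient.\<close>

primrec bterm_model :: "('i, 'm, 't) FI bterm \<Rightarrow> ('i \<Rightarrow> 'm) set" where
  "bterm_model (Gen f) = {F. Rep_FI f \<subseteq>\<^sub>m (Some \<circ> F)}"
| "bterm_model Zero = {}"
| "bterm_model One = UNIV"
| "bterm_model (Meet s t) = bterm_model s \<inter> bterm_model t"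
| "bterm_model (Join s t) = bterm_model s \<union> bterm_model t"
| "bterm_model (Compl s) = - bterm_model s"

lemma map_le_add_left:
  assumes "\<And>i. i \<in> dom f \<Longrightarrow> i \<in> dom g \<Longrightarrow> f i = g i"
  shows "f \<subseteq>\<^sub>m f ++ g"
  unfolding map_le_def
proof
  fix i assume "i \<in> dom f"
  then show "f i = (f ++ g) i"
    using assms[of i] by (cases "i \<in> dom g") (simp_all add: map_add_dom_app_simps)
qed

lemma FI_rel_model: "FI_rel s t \<Longrightarrow> bterm_model s = bterm_model t"
proof (induction rule: FI_rel.induct)
  case (mono f g)
  then show ?case using map_le_trans by (fastforce simp: FI_le_def)
next
  case (incompat f g)
  then show ?case
    by (auto simp: incompatible_def map_le_def dom_def)
next
  case (union f g h)
  show ?case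
  proof (intro set_eqI)
    fix F
    have "Rep_FI h \<subseteq>\<^sub>m Some \<circ> F" if "Rep_FI f \<subseteq>\<^sub>m Some \<circ> F" "Rep_FI g \<subseteq>\<^sub>m Some \<circ> F"
      using that union(2) by (simp add: map_add_le_mapI)
    moreover have "Rep_FI f \<subseteq>\<^sub>m Rep_FI h"
      unfolding union(2) using union(1) by (intro map_le_add_left) (auto simp: incompatible_def)
    moreover have "Rep_FI g \<subseteq>\<^sub>m Rep_FI h"
      using union(2) by simp
    ultimately show "F \<in> bterm_model (Meet (Gen f) (Gen g)) \<longleftrightarrow> F \<in> bterm_model (Gen h)"
      using map_le_trans by fastforce
  qed
next
  case (empty f)
  then show ?case by (simp add: map_le_def)
qed

lemma ba_eq_model: "ba_eq FI_rel s t \<Longrightarrow> bterm_model s = bterm_model t"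
  by (induction rule: ba_eq.induct) (auto dest: FI_rel_model)

lemma gen_neq_bot: "gen f \<noteq> bot"
proof
  assume "gen f = bot"
  then have "ba_eq FI_rel (Gen f) Zero" by transfer
  then have "bterm_model (Gen f) = {}" using ba_eq_model by fastforce
  \<comment> \<open>Outside the domain of \<open>f\<close> the function takes the unspecified value
    \<open>the None\<close>; any value would do.\<close>
  moreover have "(\<lambda>i. the (Rep_FI f i)) \<in> bterm_model (Gen f)"
    by (auto simp: map_le_def)
  ultimately show False by blast
qed

lemma gen_mono: "FI_le f g \<Longrightarrow> gen g \<le> gen f"
  unfolding less_eq_B0_def by transfer (auto intro: ba_eq.rel FI_rel.mono)

lemma gen_incompatible: "incompatible f g \<Longrightarrow> inf (gen f) (gen g) = bot"
  by transfer (auto intro: ba_eq.rel FI_rel.incompat)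

lemma gen_union:
  "\<not> incompatible f g \<Longrightarrow> Rep_FI h = Rep_FI f ++ Rep_FI g \<Longrightarrow> inf (gen f) (gen g) = gen h"
  by transfer (auto intro: ba_eq.rel FI_rel.union)

lemma gen_empty: "Rep_FI f = Map.empty \<Longrightarrow> gen f = top"
  by transfer (auto intro: ba_eq.rel FI_rel.empty)

lemma FI_le_refl [simp]: "FI_le f f"
  by (simp add: FI_le_def)

lemma FI_le_trans: "FI_le f g \<Longrightarrow> FI_le g h \<Longrightarrow> FI_le f h"
  unfolding FI_le_def by (rule map_le_trans)

lemma FI_leI: "\<not> incompatible f h \<Longrightarrow> dom (Rep_FI h) \<subseteq> dom (Rep_FI f) \<Longrightarrow> FI_le h f"
  unfolding FI_le_def map_le_def incompatible_def by (metis IntI subsetD)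

definition decides :: "'b::boolean_algebra \<Rightarrow> 'b \<Rightarrow> bool" where
  "decides p a \<longleftrightarrow> p \<le> a \<or> p \<le> - a"

lemma decides_anti: "q \<le> p \<Longrightarrow> decides p a \<Longrightarrow> decides q a"
  unfolding decides_def by (meson order_trans)

text \<open>The elements of \<open>H\<close> are treated one at a time: a nonzero element meets
  \<open>h\<close> or \<open>- h\<close>.\<close>

lemma finite_decides:
  fixes b :: "'b::boolean_algebra"
  assumes "finite H" "b \<noteq> bot"
  shows "\<exists>b'. b' \<noteq> bot \<and> b' \<le> b \<and> (\<forall>h\<in>H. decides b' h)"
  using assms(1)
proof induction
  case empty
  then show ?case using assms(2) by auto
next
  case (insert h H)
  then obtain b' where b': "b' \<noteq> bot" "b' \<le> b" "\<forall>h\<in>H. decides b' h" by auto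
  have "inf b' h \<noteq> bot \<or> inf b' (- h) \<noteq> bot"
    using b'(1) by (metis inf_shunt double_compl le_iff_inf)
  then obtain c where c: "c \<noteq> bot" "c \<le> b'" "decides c h"
    by (metis decides_def inf_le1 inf_le2)
  then show ?case using b' decides_anti by (intro exI[of _ c]) (auto intro: order_trans)
qed

locale FI_algebra =
  fixes types :: "('i \<times> 'm \<times> 't) itself"
  assumes infinite_m: "infinite (UNIV :: 'm set)"
    and infinite_t: "infinite (UNIV :: 't set)"
begin

lemma small_Un:
  "|A| <o |UNIV :: 't set| \<Longrightarrow> |B| <o |UNIV :: 't set| \<Longrightarrow> |A \<union> B| <o |UNIV :: 't set|"
  using infinite_t by (rule card_of_Un_ordLess_infinite)

lemma small_finite: "finite A \<Longrightarrow> |A| <o |UNIV :: 't set|"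
  using infinite_t finite_ordLess_infinite[OF card_of_Well_order[of A] card_of_Well_order[of "UNIV :: 't set"]] by (simp add: Field_card_of)

lemma dom_Rep_FI: "|dom (Rep_FI (f :: ('i, 'm, 't) FI))| <o |UNIV :: 't set|"
  using Rep_FI[of f] by simp

definition FI_union :: "('i, 'm, 't) FI \<Rightarrow> ('i, 'm, 't) FI \<Rightarrow> ('i, 'm, 't) FI" where
  "FI_union f g = Abs_FI (Rep_FI f ++ Rep_FI g)"

lemma Rep_FI_union: "Rep_FI (FI_union f g) = Rep_FI f ++ Rep_FI g"
  unfolding FI_union_def
  by (subst Abs_FI_inverse) (use small_Un[OF dom_Rep_FI dom_Rep_FI] in \<open>auto simp: Un_commute\<close>)

lemma FI_le_union:
  assumes "\<not> incompatible f g"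
  shows "FI_le f (FI_union f g)" "FI_le g (FI_union f g)"
  unfolding FI_le_def Rep_FI_union
  using assms by (intro map_le_add_left, auto simp: incompatible_def)

lemma gen_inf: "\<not> incompatible f g \<Longrightarrow> inf (gen f) (gen g) = gen (FI_union f g)"
  by (rule gen_union) (auto simp: Rep_FI_union)

text \<open>An \<open>h\<close> compatible with \<open>f\<close> but not above it has a coordinate
  outside the domain of \<open>f\<close>. As \<open>'m\<close> is infinite, that coordinate can
  receive a value that contradicts \<open>h\<close>; finitely many new coordinates keep the domain
  small.\<close>

lemma ex_finite_incompatible:
  fixes f :: "('i, 'm, 't) FI"
  assumes "finite H" "\<And>h. h \<in> H \<Longrightarrow> \<not> gen f \<le> gen h"
  shows "\<exists>g. FI_le f g \<and> (\<forall>h\<in>H. incompatible g h)"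
proof -
  \<comment> \<open>\<open>J h\<close> holds one coordinate of \<open>h\<close> that is free in
    \<open>f\<close>, and is empty if \<open>h\<close> already contradicts \<open>f\<close>.\<close>
  define J where "J h = (if incompatible f h then {} else {SOME i. i \<in> dom (Rep_FI h) - dom (Rep_FI f)})" for h
  define D where "D = (\<Union>h\<in>H. J h)"
  have finD: "finite D" unfolding D_def J_def using assms(1) by auto
  have Dd: "i \<notin> dom (Rep_FI f)" if "i \<in> D" for i
  proof -
    obtain h where h: "h \<in> H" "\<not> incompatible f h" "i = (SOME i. i \<in> dom (Rep_FI h) - dom (Rep_FI f))"
      using \<open>i \<in> D\<close> unfolding D_def J_def by (auto split: if_splits)
    show ?thesis
    proof (cases "dom (Rep_FI h) - dom (Rep_FI f) = {}")
      case True
      then have "FI_le h f" using h(2) by (simp add: FI_leI)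
      then show ?thesis using gen_mono assms(2)[OF h(1)] by blast
    next
      case False
      then show ?thesis using h(3) someI_ex[of "\<lambda>i. i \<in> dom (Rep_FI h) - dom (Rep_FI f)"] by blast
    qed
  qed
  have DJ: "\<exists>i. i \<in> D \<and> i \<in> dom (Rep_FI h)" if "h \<in> H" "\<not> incompatible f h" for h
  proof -
    have "dom (Rep_FI h) - dom (Rep_FI f) \<noteq> {}"
    proof
      assume "dom (Rep_FI h) - dom (Rep_FI f) = {}"
      then have "FI_le h f" using that(2) by (simp add: FI_leI)
      then show False using gen_mono assms(2)[OF that(1)] by blast
    qed
    then have "(SOME i. i \<in> dom (Rep_FI h) - dom (Rep_FI f)) \<in> dom (Rep_FI h)"
      using someI_ex[of "\<lambda>i. i \<in> dom (Rep_FI h) - dom (Rep_FI f)"] by blast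
    moreover have "(SOME i. i \<in> dom (Rep_FI h) - dom (Rep_FI f)) \<in> D"
      unfolding D_def J_def using that by auto
    ultimately show ?thesis by blast
  qed
  have "\<exists>m. m \<notin> (\<lambda>h. the (Rep_FI h i)) ` H" for i
    using assms(1) infinite_m by (meson ex_new_if_finite finite_imageI)
  \<comment> \<open>The value \<open>v i\<close> avoids the values of all members of
    \<open>H\<close> at \<open>i\<close> together, so several of them may share a
    coordinate.\<close>
  then obtain v where v: "\<And>i. v i \<notin> (\<lambda>h. the (Rep_FI h i)) ` H" by metis
  define k where "k = (\<lambda>i. if i \<in> D then Some (v i) else None)"
  have domk: "dom k = D" by (auto simp: k_def split: if_splits)
  define g where "g = (Abs_FI (Rep_FI f ++ k) :: ('i, 'm, 't) FI)"
  have Rg: "Rep_FI g = Rep_FI f ++ k"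
    unfolding g_def
    by (subst Abs_FI_inverse) (use small_Un[OF small_finite[OF finD] dom_Rep_FI[of f]] domk in auto)
  have "FI_le f g"
    unfolding FI_le_def Rg using Dd domk by (intro map_le_add_left) blast
  moreover have "incompatible g h" if "h \<in> H" for h
  proof (cases "incompatible f h")
    case True
    then obtain i where i: "i \<in> dom (Rep_FI f)" "i \<in> dom (Rep_FI h)" "Rep_FI f i \<noteq> Rep_FI h i"
      unfolding incompatible_def by blast
    then have "Rep_FI g i = Rep_FI f i" using \<open>FI_le f g\<close> by (auto simp: FI_le_def map_le_def)
    then show ?thesis using i unfolding incompatible_def by (intro bexI[of _ i]) (auto simp: dom_def)
  next
    case False
    then obtain i where i: "i \<in> D" "i \<in> dom (Rep_FI h)" using DJ \<open>h \<in> H\<close> by blast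
    then have "Rep_FI g i = Some (v i)" by (simp add: Rg map_add_def k_def)
    moreover have "v i \<noteq> the (Rep_FI h i)" using v \<open>h \<in> H\<close> by blast
    ultimately show ?thesis using i unfolding incompatible_def by (intro bexI[of _ i]) auto
  qed
  ultimately show ?thesis by blast
qed

end

lift_definition bterm_class :: "('i, 'm, 't) FI bterm \<Rightarrow> ('i, 'm, 't) B0" is "\<lambda>t. t" .

lemma bterm_class_simps:
  "bterm_class (Gen f) = gen f"
  "bterm_class Zero = bot"
  "bterm_class One = top"
  "bterm_class (Meet s t) = inf (bterm_class s) (bterm_class t)"
  "bterm_class (Join s t) = sup (bterm_class s) (bterm_class t)"
  "bterm_class (Compl s) = - bterm_class s"
  by (transfer, rule ba_eq.refl)+

lemma bterm_class_surj: "\<exists>t. b = bterm_class t"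
  by transfer (auto intro: ba_eq.refl)

text \<open>The truth value of a term depends only on those of its generators, not on the element
  forcing them. This lets a generator take over the role of an abstract element
  \<open>p\<close>.\<close>

lemma agree_on_gens:
  assumes "p \<noteq> bot"
    and "\<And>h. h \<in> set_bterm t \<Longrightarrow> p \<le> gen h \<and> q \<le> gen h \<or> p \<le> - gen h \<and> q \<le> - gen h"
  shows "p \<le> bterm_class t \<and> q \<le> bterm_class t \<or> p \<le> - bterm_class t \<and> q \<le> - bterm_class t"
  using assms(2)
proof (induction t)
  case (Meet s t)
  then show ?case by (auto simp: bterm_class_simps intro: le_supI1 le_supI2)
next
  case (Join s t)
  then show ?case by (auto simp: bterm_class_simps intro: le_supI1 le_supI2)
qed (auto simp: bterm_class_simps)

lemma not_le_and_le_compl: "p \<noteq> bot \<Longrightarrow> p \<le> a \<Longrightarrow> \<not> p \<le> - (a :: 'b::boolean_algebra)"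
  by (metis inf.absorb_iff1 inf_shunt)

context FI_algebra
begin

text \<open>Take a nonzero \<open>p\<close> below \<open>b\<close> deciding every generator of a
  term for \<open>b\<close>. The finitely many generators above \<open>p\<close> amalgamate to one
  condition \<open>f\<close>, and an extension \<open>g\<close> of \<open>f\<close> contradicts the
  rest; \<open>gen g\<close> and \<open>p\<close> then agree on the term.\<close>

lemma gen_dense:
  fixes b :: "('i, 'm, 't) B0"
  assumes "b \<noteq> bot"
  shows "\<exists>f. gen f \<le> b"
proof -
  obtain t where t: "b = bterm_class t" using bterm_class_surj by blast
  obtain p where p: "p \<noteq> bot" "p \<le> b" "\<forall>h\<in>gen ` set_bterm t. decides p h"
    using finite_decides[OF _ assms, of "gen ` set_bterm t"] by (auto simp: bterm.set_finite)
  define S where "S = {h \<in> set_bterm t. p \<le> gen h}"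
  have "finite (set_bterm t)"
    by (induction t) auto
  then have "finite S" "finite (set_bterm t - S)" by (auto simp: S_def)
  have "\<exists>f. p \<le> gen f \<and> (\<forall>h\<in>S. FI_le h f)"
  proof -
    have "\<exists>f. p \<le> gen f \<and> (\<forall>h\<in>T. FI_le h f)" if "finite T" "T \<subseteq> S" for T
      using that
    proof (induction T)
      case empty
      have "gen (Abs_FI Map.empty :: ('i, 'm, 't) FI) = top"
        by (rule gen_empty, subst Abs_FI_inverse) (use small_finite in auto)
      then show ?case by (metis top_greatest empty_iff)
    next
      case (insert h T)
      then obtain f where f: "p \<le> gen f" "\<forall>h\<in>T. FI_le h f" by auto
      have ph: "p \<le> gen h" using insert by (auto simp: S_def)
      have "\<not> incompatible f h"
      proof
        assume "incompatible f h"
        then have "p \<le> bot" using f(1) ph gen_incompatible by (metis le_inf_iff)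
        then show False using p(1) by (simp add: bot_unique)
      qed
      then have "p \<le> gen (FI_union f h)" "FI_le f (FI_union f h)" "FI_le h (FI_union f h)"
        using f ph gen_inf[of f h] FI_le_union[of f h] le_infI[of p "gen f" "gen h"] by auto
      then show ?case using f(2) FI_le_trans by (metis insert_iff)
    qed
    then show ?thesis using \<open>finite S\<close> by blast
  qed
  then obtain f where f: "p \<le> gen f" "\<forall>h\<in>S. FI_le h f" by blast
  \<comment> \<open>If \<open>gen f\<close> were below \<open>gen h\<close>, so would be
    \<open>p\<close>, and \<open>h\<close> would lie in \<open>S\<close>.\<close>
  have "\<not> gen f \<le> gen h" if "h \<in> set_bterm t - S" for h
    using that f(1) unfolding S_def by (auto intro: order_trans)
  from ex_finite_incompatible[OF \<open>finite (set_bterm t - S)\<close> this]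
  obtain g where g: "FI_le f g" "\<forall>h\<in>set_bterm t - S. incompatible g h" by blast
  have "p \<le> gen h \<and> gen g \<le> gen h \<or> p \<le> - gen h \<and> gen g \<le> - gen h" if h: "h \<in> set_bterm t" for h
  proof (cases "h \<in> S")
    case True
    then have "gen g \<le> gen h" using f(2) g(1) gen_mono FI_le_trans by blast
    then show ?thesis using True S_def by blast
  next
    case False
    then have "gen g \<le> - gen h" using g(2) h gen_incompatible[of g h] by (simp add: inf_shunt)
    moreover have "p \<le> - gen h" using False h p(3) by (auto simp: S_def decides_def)
    ultimately show ?thesis by blast
  qed
  from agree_on_gens[OF p(1) this] p(1,2) t not_le_and_le_compl
  show ?thesis by blast
qed

end

section \<open>Density of the generators in the completion\<close>

lemma embed_le_iff: "embed a \<le> embed b \<longleftrightarrow> a \<le> b"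
  by transfer auto

lemma embed_inf: "embed (inf a b) = inf (embed a) (embed b)"
  by transfer auto

lemma embed_bot: "embed bot = bot"
  by transfer (auto simp: cut_closure_def lower_bounds_def upper_bounds_def dest: bot.extremum_uniqueI)

text \<open>A cut other than the least cut \<open>{bot}\<close> has a nonzero member and is closed
  downwards.\<close>

lemma embed_dense:
  assumes "(a :: 'a::boolean_algebra completion) \<noteq> bot"
  shows "\<exists>b. b \<noteq> bot \<and> embed b \<le> a"
  using assms
proof transfer
  fix I :: "'a set"
  assume I: "cut_closure I = I" "I \<noteq> cut_closure {}"
  have c: "cut_closure {} = {bot :: 'a}"
    by (auto simp: cut_closure_def lower_bounds_def upper_bounds_def intro: bot.extremum_uniqueI)
  have "cut_closure {} \<subseteq> I" using I(1) cut_closure_mono[of "{}" I] by simp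
  then obtain b where "b \<in> I" "b \<noteq> bot" using I(2) c by blast
  then show "\<exists>b. b \<noteq> bot \<and> {..b} \<subseteq> I" using cut_downward[OF I(1)] by auto
qed

lemma xgen_neq_bot [simp]: "xgen f \<noteq> bot"
  unfolding xgen_def using gen_neq_bot embed_le_iff embed_bot by (metis order_antisym_conv order_refl)

lemma xgen_mono: "FI_le f g \<Longrightarrow> xgen g \<le> xgen f"
  unfolding xgen_def by (simp add: embed_le_iff gen_mono)

lemma xgen_incompatible: "incompatible f g \<Longrightarrow> inf (xgen f) (xgen g) = bot"
  unfolding xgen_def by (metis embed_inf gen_incompatible embed_bot)

context FI_algebra
begin

lemma xgen_inf: "\<not> incompatible f g \<Longrightarrow> inf (xgen f) (xgen g) = xgen (FI_union f g)"
  unfolding xgen_def by (metis embed_inf gen_inf)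

lemma xgen_dense:
  fixes a :: "('i, 'm, 't) B1"
  assumes "a \<noteq> bot"
  shows "\<exists>f. xgen f \<le> a"
proof -
  obtain b :: "('i, 'm, 't) B0" where "b \<noteq> bot" "embed b \<le> a" using embed_dense[OF assms] by blast
  moreover then obtain f where "gen f \<le> b" using gen_dense by blast
  ultimately show ?thesis unfolding xgen_def by (metis embed_le_iff order_trans)
qed

lemma xgen_inf_neq_bot_iff:
  fixes f g :: "('i, 'm, 't) FI"
  shows "inf (xgen f) (xgen g) \<noteq> bot \<longleftrightarrow> \<not> incompatible f g"
  by (metis xgen_incompatible xgen_inf xgen_neq_bot)

text \<open>The basic forcing step: \<open>xgen f\<close> meets \<open>- a\<close>, a generator
  below the meet is compatible with \<open>f\<close>, and the union of the two conditions is as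
  required.\<close>

lemma not_xgen_le:
  assumes "\<not> xgen f \<le> (a :: ('i, 'm, 't) B1)"
  shows "\<exists>g. FI_le f g \<and> xgen g \<le> - a"
proof -
  have "inf (xgen f) (- a) \<noteq> bot" using assms by (simp add: inf_shunt)
  then obtain h where h: "xgen h \<le> inf (xgen f) (- a)" using xgen_dense by blast
  then have "\<not> incompatible f h"
    by (metis xgen_inf_neq_bot_iff inf.absorb_iff2 inf.bounded_iff xgen_neq_bot)
  then show ?thesis using FI_le_union[of f h] h xgen_mono by (meson le_inf_iff order_trans)
qed

lemma ex_decides: "\<exists>g. FI_le f g \<and> decides (xgen g) (a :: ('i, 'm, 't) B1)"
  using not_xgen_le[of f a] by (auto simp: decides_def intro: FI_le_refl)

text \<open>By density, elements can be compared through the conditions below them.\<close>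

lemma xgen_le_cong:
  fixes a b :: "('i, 'm, 't) B1"
  assumes "\<And>f. xgen f \<le> a \<Longrightarrow> xgen f \<le> b"
  shows "a \<le> b"
proof (rule ccontr)
  assume "\<not> a \<le> b"
  then have "inf a (- b) \<noteq> bot" by (simp add: inf_shunt)
  then obtain f where "xgen f \<le> inf a (- b)" using xgen_dense by blast
  then show False using assms not_le_and_le_compl[OF xgen_neq_bot] by (meson le_inf_iff)
qed

end

section \<open>Chains of partial functions and supports\<close>

context FI_algebra
begin

definition FI_restrict :: "'i set \<Rightarrow> ('i, 'm, 't) FI \<Rightarrow> ('i, 'm, 't) FI" where
  "FI_restrict V f = Abs_FI (Rep_FI f |` V)"

lemma Rep_FI_restrict: "Rep_FI (FI_restrict V f) = Rep_FI f |` V"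
proof -
  have "|dom (Rep_FI f |` V)| <o |UNIV :: 't set|"
    by (rule ordLeq_ordLess_trans[OF card_of_mono1 dom_Rep_FI[of f]]) auto
  then show ?thesis unfolding FI_restrict_def by (simp add: Abs_FI_inverse)
qed

lemma FI_restrict_on: "FI_restrict V f \<in> FI_on V"
  by (auto simp: FI_on_def Rep_FI_restrict)

lemma FI_restrict_le: "FI_le (FI_restrict V f) f"
  by (simp add: FI_le_def Rep_FI_restrict map_le_def)

lemma le_FI_restrict: "f \<in> FI_on V \<Longrightarrow> FI_le f g \<Longrightarrow> FI_le f (FI_restrict V g)"
  unfolding FI_le_def Rep_FI_restrict FI_on_def map_le_def by (auto simp: restrict_map_def subset_iff)

lemma FI_restrict_mono: "V \<subseteq> W \<Longrightarrow> FI_le (FI_restrict V f) (FI_restrict W f)"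
  by (auto simp: FI_le_def Rep_FI_restrict map_le_def restrict_map_def)

text \<open>The amalgamation behind all support arguments: a common coordinate must lie in
  \<open>V\<close>, where \<open>g\<close> already extends \<open>f\<close>.\<close>

lemma FI_restrict_compatible:
  assumes "g \<in> FI_on V" "FI_le (FI_restrict V f) g"
  shows "\<not> incompatible f g"
proof
  assume "incompatible f g"
  then obtain i where i: "i \<in> dom (Rep_FI f)" "i \<in> dom (Rep_FI g)" "Rep_FI f i \<noteq> Rep_FI g i"
    unfolding incompatible_def by blast
  then have "i \<in> V" using assms(1) by (auto simp: FI_on_def)
  moreover from this have "i \<in> dom (Rep_FI (FI_restrict V f))" using i(1) by (simp add: Rep_FI_restrict)
  ultimately show False using i(3) assms(2)
    by (metis FI_le_def map_le_def Rep_FI_restrict restrict_in)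
qed

lemma FI_on_mono: "V \<subseteq> W \<Longrightarrow> FI_on V \<subseteq> FI_on W"
  by (auto simp: FI_on_def)

text \<open>A forcing form of support without antichains: only the part of a condition inside
  \<open>V\<close> matters for lying below \<open>a\<close>. It is stable under complements and
  arbitrary infima.\<close>

definition supp :: "'i set \<Rightarrow> ('i, 'm, 't) B1 \<Rightarrow> bool" where
  "supp V a \<longleftrightarrow> (\<forall>f. xgen f \<le> a \<longrightarrow> xgen (FI_restrict V f) \<le> a)"

lemma suppD: "supp V a \<Longrightarrow> xgen f \<le> a \<Longrightarrow> xgen (FI_restrict V f) \<le> a"
  by (simp add: supp_def)

lemma supp_mono: "supp V a \<Longrightarrow> V \<subseteq> W \<Longrightarrow> supp W a"
  unfolding supp_def by (meson FI_restrict_mono xgen_mono order_trans)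

lemma incompatible_sym: "incompatible f g \<Longrightarrow> incompatible g f"
  unfolding incompatible_def by (metis Int_commute)

lemma incompatible_of_le_compl:
  fixes a :: "('i, 'm, 't) B1"
  assumes "xgen f \<le> a" "xgen g \<le> - a"
  shows "incompatible f g"
proof -
  have "inf (xgen f) (xgen g) \<le> inf a (- a)" using assms by (rule inf_mono)
  then have "inf (xgen f) (xgen g) = bot" by (simp add: bot_unique)
  then show ?thesis using xgen_inf_neq_bot_iff by blast
qed

text \<open>A failure of \<open>supp\<close> has a concrete witness, an extension of the restricted
  condition below \<open>- a\<close>; supports are established by refuting it.\<close>

lemma supp_iff_no_restricted_witness:
  "supp V a \<longleftrightarrow> (\<forall>f g. xgen f \<le> a \<longrightarrow> FI_le (FI_restrict V f) g \<longrightarrow> \<not> xgen g \<le> - a)"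
proof
  assume "supp V a"
  then show "\<forall>f g. xgen f \<le> a \<longrightarrow> FI_le (FI_restrict V f) g \<longrightarrow> \<not> xgen g \<le> - a"
    by (meson suppD xgen_mono order_trans not_le_and_le_compl xgen_neq_bot)
next
  assume "\<forall>f g. xgen f \<le> a \<longrightarrow> FI_le (FI_restrict V f) g \<longrightarrow> \<not> xgen g \<le> - a"
  then show "supp V a" unfolding supp_def using not_xgen_le by blast
qed

text \<open>A witness \<open>g\<close> against the claim lies below \<open>a\<close>, hence so does
  its restriction to \<open>V\<close>. That restriction still extends the one of \<open>f\<close>,
  so it is compatible with \<open>f\<close>, which lies below \<open>- a\<close>.\<close>

lemma supp_compl:
  assumes "supp V a"
  shows "supp V (- a)"
  unfolding supp_iff_no_restricted_witness
proof (intro allI impI notI)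
  fix f g
  assume f: "xgen f \<le> - a" and g: "FI_le (FI_restrict V f) g" "xgen g \<le> - (- a)"
  have "xgen (FI_restrict V g) \<le> a" using assms g(2) by (simp add: suppD)
  then have "incompatible (FI_restrict V g) f" using f by (rule incompatible_of_le_compl)
  moreover have "\<not> incompatible f (FI_restrict V g)"
    by (rule FI_restrict_compatible[OF FI_restrict_on le_FI_restrict[OF FI_restrict_on g(1)]])
  ultimately show False using incompatible_sym by blast
qed

lemma supp_Inf: "(\<And>a. a \<in> A \<Longrightarrow> supp V a) \<Longrightarrow> supp V (Inf A)"
  by (auto simp: supp_def le_Inf_iff)

lemma maximal_antichain_meets:
  assumes "maximal_antichain A" "a \<noteq> bot"
  shows "\<exists>c\<in>A. inf a c \<noteq> bot"
proof (rule ccontr)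
  assume *: "\<not> ?thesis"
  then have "antichain (insert a A)"
    using assms unfolding maximal_antichain_def antichain_def by (auto simp: inf_commute)
  then have "a \<in> A" using assms(1) unfolding maximal_antichain_def by blast
  then show False using * assms(2) by auto
qed

text \<open>If a witness \<open>h\<close> lies below \<open>- a\<close>, so does any member of the
  antichain compatible with \<open>h\<close>. Such a member lives on \<open>V\<close>, which moves
  the contradiction into \<open>V\<close>.\<close>

lemma supported_imp_supp:
  fixes a :: "('i, 'm, 't) B1"
  assumes "supported V a"
  shows "supp V a"
  unfolding supp_iff_no_restricted_witness
proof (intro allI impI notI)
  fix f h
  assume f: "xgen f \<le> a" and h: "FI_le (FI_restrict V f) h" "xgen h \<le> - a"
  obtain A where A: "maximal_antichain A" "A \<subseteq> xgen ` FI_on V" "\<forall>c\<in>A. c \<le> a \<or> c \<le> - a"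
    using assms unfolding supported_def by blast
  obtain c where c: "c \<in> A" "inf (xgen h) c \<noteq> bot"
    using maximal_antichain_meets[OF A(1) xgen_neq_bot] by blast
  obtain g where g: "g \<in> FI_on V" "c = xgen g" using c(1) A(2) by blast
  have hg: "\<not> incompatible h g" using c(2) g(2) xgen_inf_neq_bot_iff by blast
  then have "\<not> xgen g \<le> a" using incompatible_of_le_compl[OF _ h(2)] incompatible_sym by blast
  then have ga: "xgen g \<le> - a" using A(3) c(1) g(2) by blast
  \<comment> \<open>\<open>k\<close> combines all of \<open>g\<close> with the part of
    \<open>h\<close> in \<open>V\<close>: the first puts it below \<open>- a\<close>, the second
    makes it compatible with \<open>f\<close>.\<close>
  define k where "k = FI_restrict V (FI_union h g)"
  have "FI_le (FI_restrict V f) k"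
    unfolding k_def using le_FI_restrict[OF FI_restrict_on] FI_le_trans[OF h(1) FI_le_union(1)[OF hg]] by blast
  then have "\<not> incompatible f k" unfolding k_def by (rule FI_restrict_compatible[OF FI_restrict_on])
  moreover have "FI_le g k" unfolding k_def using le_FI_restrict[OF g(1)] FI_le_union(2)[OF hg] by blast
  then have "xgen k \<le> - a" using ga xgen_mono order_trans by blast
  ultimately show False using incompatible_of_le_compl[OF f] by blast
qed

lemma supp_dense: "supp V a \<Longrightarrow> a \<noteq> bot \<Longrightarrow> \<exists>f\<in>FI_on V. xgen f \<le> a"
  using xgen_dense suppD FI_restrict_on by blast

text \<open>A deciding extension can be cut back to \<open>V\<close> because \<open>V\<close>
  supports both \<open>a\<close> and \<open>- a\<close>.\<close>

lemma supp_decides: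
  assumes "supp V a" "f \<in> FI_on V"
  shows "\<exists>g\<in>FI_on V. FI_le f g \<and> decides (xgen g) a"
proof -
  obtain g where g: "FI_le f g" "decides (xgen g) a" using ex_decides by blast
  have "decides (xgen (FI_restrict V g)) a"
    using g(2) suppD[OF assms(1)] suppD[OF supp_compl[OF assms(1)]] unfolding decides_def by blast
  then show ?thesis using le_FI_restrict[OF assms(2) g(1)] FI_restrict_on by blast
qed

end

locale FI_regular = FI_algebra types for types :: "('i \<times> 'm \<times> 't) itself" +
  assumes regular_t: "regularCard |UNIV :: 't set|"
begin

text \<open>Comparability makes the union of the graphs a function, and regularity of
  \<open>\<theta>\<close> keeps its domain smaller than \<open>\<theta>\<close>.\<close>

lemma chain_upper_bound:
  fixes F :: "('i, 'm, 't) FI set"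
  assumes "|F| <o |UNIV :: 't set|" "F \<subseteq> FI_on V"
    and chain: "\<And>f g. f \<in> F \<Longrightarrow> g \<in> F \<Longrightarrow> FI_le f g \<or> FI_le g f"
  shows "\<exists>h\<in>FI_on V. \<forall>f\<in>F. FI_le f h"
proof -
  define G where "G = (\<Union>f\<in>F. Map.graph (Rep_FI f))"
  have single: "y = z" if yz: "(i, y) \<in> G" "(i, z) \<in> G" for i y z
  proof -
    obtain f g where fg: "f \<in> F" "g \<in> F" "Rep_FI f i = Some y" "Rep_FI g i = Some z"
      using yz unfolding G_def by (auto simp: Map.graph_def)
    then show ?thesis using chain[OF fg(1,2)]
      unfolding FI_le_def map_le_def by (metis domI option.inject)
  qed
  define k where "k i = (if \<exists>y. (i, y) \<in> G then Some (THE y. (i, y) \<in> G) else None)" for i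
  have k: "k i = Some y" if "(i, y) \<in> G" for i y
    unfolding k_def using that single by (auto intro!: the_equality)
  have domk: "dom k = (\<Union>f\<in>F. dom (Rep_FI f))"
    by (auto simp: k_def dom_def G_def Map.graph_def)
  have "Cinfinite |UNIV :: 't set|"
    using infinite_t by (simp add: cinfinite_def Field_card_of card_of_card_order_on)
  then have "|dom k| <o |UNIV :: 't set|"
    unfolding domk
    by (intro card_of_UNION_ordLess_infinite_Field_regularCard[OF regular_t _ assms(1)])
      (simp_all add: dom_Rep_FI)
  define h :: "('i, 'm, 't) FI" where "h = Abs_FI k"
  have Rk: "Rep_FI h = k"
    unfolding h_def using \<open>|dom k| <o |UNIV :: 't set|\<close> by (simp add: Abs_FI_inverse)
  have "FI_le f h" if "f \<in> F" for f
    unfolding FI_le_def Rk map_le_def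
  proof
    fix i assume "i \<in> dom (Rep_FI f)"
    then obtain y where y: "Rep_FI f i = Some y" by blast
    then have "(i, y) \<in> G" using that by (auto simp: G_def Map.graph_def)
    then show "Rep_FI f i = k i" using k y by simp
  qed
  moreover have "h \<in> FI_on V"
    using assms(2) unfolding FI_on_def Rk mem_Collect_eq domk by blast
  ultimately show ?thesis by blast
qed

text \<open>The levels \<open>V \<alpha>\<close> and \<open>V' \<alpha>\<close> bound the supports before and after stage \<open>\<alpha>\<close>.\<close>

lemma meet_dense_sets:
  fixes r :: "'k rel" and f0 :: "('i, 'm, 't) FI"
  assumes w: "|w| <o |UNIV :: 't set|" and r: "Well_order r" "w \<subseteq> Field r"
    and step: "\<And>\<alpha> f. \<alpha> \<in> w \<Longrightarrow> f \<in> FI_on (V \<alpha>) \<Longrightarrow> \<exists>g\<in>FI_on (V' \<alpha>). FI_le f g \<and> P \<alpha> g"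
    and V': "\<And>\<alpha> \<beta>. \<alpha> \<in> underS r \<beta> \<Longrightarrow> V' \<alpha> \<subseteq> V \<beta>"
    and f0: "\<And>\<alpha>. \<alpha> \<in> w \<Longrightarrow> f0 \<in> FI_on (V \<alpha>)"
    and P: "\<And>\<alpha> f g. P \<alpha> f \<Longrightarrow> FI_le f g \<Longrightarrow> P \<alpha> g"
  shows "\<exists>f. FI_le f0 f \<and> (\<forall>\<alpha>\<in>w. P \<alpha> f)"
proof -
  \<comment> \<open>The choice is meaningful only if such a \<open>g\<close> exists; the induction
    for \<open>Q\<close> shows that it does at every stage in \<open>w\<close>.\<close>
  define E where "E \<alpha> X = (SOME g. g \<in> FI_on (V' \<alpha>) \<and> P \<alpha> g \<and> (\<forall>f\<in>X. FI_le f g))"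
    for \<alpha> and X :: "('i, 'm, 't) FI set"
  define G where "G = wfrec (r - Id) (\<lambda>G \<alpha>. E \<alpha> (insert f0 (G ` (underS r \<alpha> \<inter> w))))"
  have wf: "wf (r - Id)" using r(1) by (simp add: well_order_on_def)
  have "G \<alpha> = E \<alpha> (insert f0 (cut G (r - Id) \<alpha> ` (underS r \<alpha> \<inter> w)))" for \<alpha>
    by (rule def_wfrec[OF _ wf]) (simp add: G_def)
  moreover have "cut G (r - Id) \<alpha> ` (underS r \<alpha> \<inter> w) = G ` (underS r \<alpha> \<inter> w)" for \<alpha>
    by (rule image_cong) (auto simp: cut_def underS_def)
  ultimately have G: "G \<alpha> = E \<alpha> (insert f0 (G ` (underS r \<alpha> \<inter> w)))" for \<alpha> by metis
  have total: "\<alpha> = \<beta> \<or> \<alpha> \<in> underS r \<beta> \<or> \<beta> \<in> underS r \<alpha>" if "\<alpha> \<in> w" "\<beta> \<in> w" for \<alpha> \<beta>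
    using r that unfolding underS_def well_order_on_def linear_order_on_def total_on_def by blast
  define Q where "Q \<alpha> \<longleftrightarrow> G \<alpha> \<in> FI_on (V' \<alpha>) \<and> P \<alpha> (G \<alpha>) \<and> FI_le f0 (G \<alpha>) \<and>
    (\<forall>\<beta>\<in>underS r \<alpha> \<inter> w. FI_le (G \<beta>) (G \<alpha>))" for \<alpha>
  have small: "|insert f0 (G ` T)| <o |UNIV :: 't set|" if "T \<subseteq> w" for T
  proof -
    have "|G ` T| <o |UNIV :: 't set|"
      using ordLeq_ordLess_trans[OF ordLeq_transitive[OF card_of_image card_of_mono1[OF that]] w] .
    then show ?thesis using small_Un[OF small_finite[of "{f0}"]] by simp
  qed
  have chain: "FI_le f g \<or> FI_le g f"
    if "T \<subseteq> w" "\<forall>\<alpha>\<in>T. Q \<alpha>" "f \<in> insert f0 (G ` T)" "g \<in> insert f0 (G ` T)" for T f g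
  proof -
    have "FI_le (G \<alpha>) (G \<beta>) \<or> FI_le (G \<beta>) (G \<alpha>)" if "\<alpha> \<in> T" "\<beta> \<in> T" for \<alpha> \<beta>
      using total[of \<alpha> \<beta>] that \<open>T \<subseteq> w\<close> \<open>\<forall>\<alpha>\<in>T. Q \<alpha>\<close> unfolding Q_def
      by (metis FI_le_refl IntI subsetD)
    moreover have "FI_le f0 (G \<alpha>)" if "\<alpha> \<in> T" for \<alpha>
      using that \<open>\<forall>\<alpha>\<in>T. Q \<alpha>\<close> unfolding Q_def by blast
    ultimately show ?thesis using that(3,4) by auto
  qed
  have Q: "\<alpha> \<in> w \<longrightarrow> Q \<alpha>" for \<alpha>
    using wf
  proof (induction \<alpha>)
    case (less \<alpha>)
    show ?case
    proof
      assume \<alpha>: "\<alpha> \<in> w"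
      let ?T = "underS r \<alpha> \<inter> w"
      have IH: "\<forall>\<beta>\<in>?T. Q \<beta>" using less by (auto simp: underS_def)
      \<comment> \<open>By \<open>V'\<close> all earlier choices live on \<open>V \<alpha>\<close>,
        hence so does an upper bound of them. Successor and limit stages are treated alike.\<close>
      have "insert f0 (G ` ?T) \<subseteq> FI_on (V \<alpha>)"
        using IH f0[OF \<alpha>] FI_on_mono[OF V'] unfolding Q_def by blast
      then obtain h where h: "h \<in> FI_on (V \<alpha>)" "\<forall>f\<in>insert f0 (G ` ?T). FI_le f h"
        using chain_upper_bound[OF small[of ?T] _ chain[of ?T]] IH by blast
      obtain g where "g \<in> FI_on (V' \<alpha>)" "FI_le h g" "P \<alpha> g" using step[OF \<alpha> h(1)] by blast
      then have "\<exists>g. g \<in> FI_on (V' \<alpha>) \<and> P \<alpha> g \<and> (\<forall>f\<in>insert f0 (G ` ?T). FI_le f g)"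
        using h(2) FI_le_trans by blast
      from someI_ex[OF this] show "Q \<alpha>"
        unfolding Q_def using G[of \<alpha>, unfolded E_def] by simp
    qed
  qed
  have "insert f0 (G ` w) \<subseteq> FI_on UNIV" by (auto simp: FI_on_def)
  then obtain f where f: "\<forall>g\<in>insert f0 (G ` w). FI_le g f"
    using chain_upper_bound[OF small[of w] _ chain[of w]] Q by blast
  then show ?thesis using Q P unfolding Q_def by (intro exI[of _ f]) blast
qed

end

section \<open>Cardinalities\<close>

lemma ex_ordIso_underS:
  assumes "|A| <o |B|"
  shows "\<exists>b\<in>B. |A| =o |underS |B| b|"
proof -
  have wo: "Well_order |B|" by (rule card_of_Well_order)
  obtain b where b: "b \<in> Field |B|" "|A| =o Restr |B| (underS |B| b)"
    using assms ordLess_iff_ordIso_Restr[OF wo card_of_Well_order] by blast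
  have "Refl |B|" using wo by (simp add: order_on_defs)
  then have "Field (Restr |B| (underS |B| b)) = underS |B| b"
    by (rule Refl_Field_Restr2) (auto simp: underS_def Field_def)
  then have "|A| =o |underS |B| b|" using card_of_cong[OF b(2)] by (simp add: Field_card_of)
  then show ?thesis using b(1) by (auto simp: Field_card_of)
qed

lemma underS_card_of_ordLess: "|underS |UNIV :: 'a set| (a :: 'a)| <o |UNIV :: 'a set|"
  by (rule card_of_underS[OF card_of_Card_order]) (simp add: Field_card_of)

lemma ex_underS_gt:
  assumes "infinite (UNIV :: 'a set)"
  shows "\<exists>b :: 'a. under |UNIV| a \<subseteq> underS |UNIV| b"
proof -
  have "\<exists>b\<in>Field |UNIV :: 'a set|. a \<noteq> b \<and> (a, b) \<in> |UNIV|"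
    using assms by (intro infinite_Card_order_limit) (simp_all add: card_of_card_order_on Field_card_of)
  then obtain b where b: "a \<noteq> b" "(a, b) \<in> |UNIV|" by blast
  have "trans |UNIV :: 'a set|" "antisym |UNIV :: 'a set|"
    using card_of_Well_order[of "UNIV :: 'a set"] by (auto simp: order_on_defs)
  then show ?thesis
    using b unfolding under_def underS_def by (intro exI[of _ b]) (blast dest: transD antisymD)
qed

lemma underS_total: "a \<notin> underS |UNIV| b \<Longrightarrow> b \<in> under |UNIV :: 'a set| (a :: 'a)"
  using card_of_Well_order[of "UNIV :: 'a set"]
  unfolding order_on_defs total_on_def refl_on_def underS_def under_def Field_card_of
  by (cases "a = b") auto

lemma UNIV_Times_ordLeq:
  assumes "infinite (UNIV :: 'c set)" "|UNIV :: 'a set| \<le>o |UNIV :: 'c set|" "|UNIV :: 'b set| \<le>o |UNIV :: 'c set|"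
  shows "|UNIV :: ('a \<times> 'b) set| \<le>o |UNIV :: 'c set|"
  using card_of_Times_ordLeq_infinite_Field[of "|UNIV :: 'c set|", OF _ assms(2,3)] assms(1)
  by (simp add: Field_card_of card_of_card_order_on)

lemma UNIV_option_ordLeq:
  assumes "infinite (UNIV :: 'a set)"
  shows "|UNIV :: 'a option set| \<le>o |UNIV :: 'a set|"
proof -
  have "|insert None (range (Some :: 'a \<Rightarrow> 'a option))| \<le>o |UNIV :: 'a set|"
    using card_of_Un_ordLeq_infinite_Field[of "|UNIV :: 'a set|" "{None}" "range (Some :: 'a \<Rightarrow> 'a option)"]
      assms card_of_image[of "Some :: 'a \<Rightarrow> 'a option" UNIV]
    by (simp add: Field_card_of card_of_card_order_on card_of_singl_ordLeq)
  moreover have "insert None (range (Some :: 'a \<Rightarrow> 'a option)) = UNIV"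
    by (auto simp: UNIV_option_conv)
  ultimately show ?thesis by metis
qed

lemma ex_inj_of_ordLeq: "|UNIV :: 'a set| \<le>o |UNIV :: 'b set| \<Longrightarrow> \<exists>f :: 'a \<Rightarrow> 'b. inj f"
  using card_of_ordLeq[of "UNIV :: 'a set" "UNIV :: 'b set"] by auto

lemma ordLess_UNIV_set: "|UNIV :: 'l set| <o |UNIV :: 'l set set|"
  using card_of_Pow[of "UNIV :: 'l set"] by simp

text \<open>This is \<open>(2^\<lambda>)^\<lambda> = 2^(\<lambda> * \<lambda>) =
  2^\<lambda>\<close>. After an injection \<open>k X\<close> of \<open>X\<close> into
  \<open>\<lambda>\<close>, the set is coded by a subset of
  \<open>\<lambda> \<times> (\<lambda> + 1)\<close> whose row at \<open>k X x\<close> codes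
  \<open>x\<close>.\<close>

lemma subsets_ordLeq_ordLeq:
  assumes inf: "infinite (UNIV :: 'l set)" and a: "|UNIV :: 'a set| \<le>o |UNIV :: 'l set set|"
  shows "|{X :: 'a set. |X| \<le>o |UNIV :: 'l set| }| \<le>o |UNIV :: 'l set set|"
proof -
  have "|UNIV :: ('l \<times> 'l option) set| \<le>o |UNIV :: 'l set|"
    by (rule UNIV_Times_ordLeq[OF inf ordLeq_refl UNIV_option_ordLeq[OF inf]]) (rule card_of_Card_order)
  then obtain p :: "'l \<times> 'l option \<Rightarrow> 'l" where p: "inj p" using ex_inj_of_ordLeq by blast
  obtain e :: "'a \<Rightarrow> 'l set" where e: "inj e" using ex_inj_of_ordLeq[OF a] by blast
  have "\<exists>k :: 'a \<Rightarrow> 'l. inj_on k X" if "|X| \<le>o |UNIV :: 'l set|" for X :: "'a set"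
    using that card_of_ordLeq[of X "UNIV :: 'l set"] by auto
  then obtain k :: "'a set \<Rightarrow> 'a \<Rightarrow> 'l" where k: "\<And>X. |X| \<le>o |UNIV :: 'l set| \<Longrightarrow> inj_on (k X) X" by metis
  \<comment> \<open>The extra point \<open>None\<close> keeps a row nonempty even when
    \<open>e x\<close> is empty, so the occupied rows can be read off.\<close>
  define e' where "e' x = insert None (Some ` e x)" for x
  have inj_e': "x = y" if "e' x = e' y" for x y
  proof -
    have "Some -` e' x = Some -` e' y" using that by simp
    then have "e x = e y" by (auto simp: e'_def vimage_def)
    then show ?thesis using e by (simp add: injD)
  qed
  define S where "S X = (\<Union>x\<in>X. {k X x} \<times> e' x)" for X
  have slice: "S X `` {k X x} = e' x" if "|X| \<le>o |UNIV :: 'l set|" "x \<in> X" for X x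
    using inj_onD[OF k[OF that(1)]] that(2) unfolding S_def by blast
  have sub: "X \<subseteq> Y" if XY: "|X| \<le>o |UNIV :: 'l set|" "|Y| \<le>o |UNIV :: 'l set|" "S X = S Y" for X Y
  proof
    fix x assume x: "x \<in> X"
    have "(k X x, None) \<in> S X" using x by (auto simp: S_def e'_def)
    then have "(k X x, None) \<in> S Y" unfolding XY(3) .
    then obtain y where y: "y \<in> Y" "k Y y = k X x" by (auto simp: S_def)
    then have "e' x = e' y" using slice[OF XY(1) x] slice[OF XY(2) y(1)] XY(3) by simp
    then show "x \<in> Y" using inj_e' y(1) by blast
  qed
  have "inj_on (\<lambda>X. p ` S X) {X. |X| \<le>o |UNIV :: 'l set| }"
  proof (rule inj_onI)
    fix X Y assume XY: "X \<in> {X. |X| \<le>o |UNIV :: 'l set| }" "Y \<in> {X. |X| \<le>o |UNIV :: 'l set| }" "p ` S X = p ` S Y"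
    then have "S X = S Y" using p by (simp add: inj_image_eq_iff)
    then show "X = Y" using sub[of X Y] sub[of Y X] XY by auto
  qed
  then show ?thesis using card_of_ordLeq by blast
qed

lemma UNIV_fun_ordLeq:
  assumes inf: "infinite (UNIV :: 'l set)" and a: "|UNIV :: 'a set| \<le>o |UNIV :: 'l set set|"
  shows "|UNIV :: ('l \<Rightarrow> 'a) set| \<le>o |UNIV :: 'l set set|"
proof -
  have inf2: "infinite (UNIV :: 'l set set)" using inf by (simp add: Finite_Set.finite_set)
  have "|UNIV :: ('l \<times> 'a) set| \<le>o |UNIV :: 'l set set|"
    by (rule UNIV_Times_ordLeq[OF inf2 ordLess_imp_ordLeq[OF ordLess_UNIV_set] a])
  note le = subsets_ordLeq_ordLeq[OF inf this]
  let ?gr = "\<lambda>F :: 'l \<Rightarrow> 'a. range (\<lambda>l. (l, F l))"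
  have "inj ?gr" by (rule injI) (auto simp: fun_eq_iff)
  moreover have "range ?gr \<subseteq> {X. |X| \<le>o |UNIV :: 'l set| }" by (auto simp: card_of_image)
  ultimately have "|UNIV :: ('l \<Rightarrow> 'a) set| \<le>o |{X :: ('l \<times> 'a) set. |X| \<le>o |UNIV :: 'l set| }|"
    using card_of_ordLeq by blast
  then show ?thesis using le ordLeq_transitive by blast
qed

text \<open>Koenig's theorem: the cofinality of \<open>2\<^bsup>\<lambda>\<^esup>\<close> exceeds \<open>\<lambda>\<close>.\<close>

lemma ordLeq_bounded_in_Pow:
  fixes V :: "'l set set"
  assumes inf: "infinite (UNIV :: 'l set)" and V: "|V| \<le>o |UNIV :: 'l set|"
  shows "\<exists>a. V \<subseteq> underS |UNIV :: 'l set set| a"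
proof (rule ccontr)
  assume *: "\<not> (\<exists>a. V \<subseteq> underS |UNIV| a)"
  have cof: "\<exists>v\<in>V. a \<in> under |UNIV| v" for a
  proof -
    have "\<not> V \<subseteq> underS |UNIV| a" using * by blast
    then obtain v where "v \<in> V" "v \<notin> underS |UNIV| a" by blast
    from this(1) underS_total[OF this(2)] show ?thesis by (rule bexI[rotated])
  qed
  have inf2: "infinite (UNIV :: 'l set set)" using inf by (simp add: Finite_Set.finite_set)
  obtain h :: "'l set \<Rightarrow> 'l" where h: "inj_on h V"
    using V card_of_ordLeq[of V "UNIV :: 'l set"] by auto
  obtain c :: "('l \<Rightarrow> 'l set) \<Rightarrow> 'l set" where c: "inj c"
    using ex_inj_of_ordLeq[OF UNIV_fun_ordLeq[OF inf ordLeq_refl[OF card_of_Card_order]]] by blast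
  \<comment> \<open>Diagonalisation: if \<open>V\<close> were cofinal, each function would have its
    code below some \<open>v\<close> in \<open>V\<close>, and so would take a value in
    \<open>B (h v)\<close> at \<open>h v\<close>.\<close>
  define B where "B l = {F l |F. \<exists>v\<in>V. h v = l \<and> c F \<in> under |UNIV| v}" for l
  have "B l \<noteq> UNIV" for l
  proof
    assume B: "B l = UNIV"
    then obtain v where v: "v \<in> V" "h v = l" unfolding B_def by blast
    \<comment> \<open>As \<open>h\<close> is injective on \<open>V\<close>, a single
      \<open>v\<close> contributes to \<open>B l\<close>, which leaves fewer than
      \<open>2^\<lambda>\<close> values.\<close>
    have "B l \<subseteq> (\<lambda>s. inv c s l) ` under |UNIV| v"
    proof
      fix x assume "x \<in> B l"
      then obtain F v' where "x = F l" "v' \<in> V" "h v' = l" "c F \<in> under |UNIV| v'" unfolding B_def by blast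
      then have "x = inv c (c F) l" "c F \<in> under |UNIV| v" using v h c by (auto dest: inj_onD)
      then show "x \<in> (\<lambda>s. inv c s l) ` under |UNIV| v" by blast
    qed
    moreover obtain b where "under |UNIV| v \<subseteq> underS |UNIV| b" using ex_underS_gt[OF inf2] by blast
    ultimately have "UNIV = (\<lambda>s. inv c s l) ` underS |UNIV| b" using B by blast
    then have "|UNIV :: 'l set set| \<le>o |underS |UNIV :: 'l set set| b|" by (metis card_of_image)
    with not_ordLess_ordLeq[OF underS_card_of_ordLess] show False by (rule notE)
  qed
  then have "\<forall>l. \<exists>x. x \<notin> B l" by blast
  then obtain H where H: "\<And>l. H l \<notin> B l" by metis
  obtain v where "v \<in> V" "c H \<in> under |UNIV| v" using cof by blast
  then show False using H[of "h v"] unfolding B_def by blast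
qed

section \<open>Counting conditions, supports and elements of the algebra\<close>

locale FI_lambda = FI_regular types for types :: "('l set \<times> 'm \<times> 't) itself" +
  assumes infinite_l: "infinite (UNIV :: 'l set)"
    and m_le_l: "|UNIV :: 'm set| \<le>o |UNIV :: 'l set|"
    and t_le_l: "|UNIV :: 't set| \<le>o |UNIV :: 'l set|"
    and l_power: "less_cexp |UNIV :: 'l set| |UNIV :: 't set| \<le>o |UNIV :: 'l set|"
begin

lemma infinite_Pow_l: "infinite (UNIV :: 'l set set)"
  using infinite_l by (simp add: Finite_Set.finite_set)

lemma graph_ordLess: "|Map.graph (Rep_FI (f :: ('l set, 'm, 't) FI))| <o |UNIV :: 't set|"
proof -
  have "Map.graph (Rep_FI f) = (\<lambda>i. (i, the (Rep_FI f i))) ` dom (Rep_FI f)"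
    by (auto simp: Map.graph_def image_iff)
  then show ?thesis using ordLeq_ordLess_trans[OF card_of_image dom_Rep_FI[of f]] by metis
qed

lemma graph_inject: "Map.graph (Rep_FI f) = Map.graph (Rep_FI g) \<Longrightarrow> f = g"
  by (metis (no_types, lifting) Rep_FI_inject ext in_graphI in_graphD option.exhaust)

text \<open>The graph of a condition on \<open>V\<close> is a subset of
  \<open>V \<times> \<mu>\<close> of size less than \<open>\<theta>\<close>, hence up to coding the
  range of a sequence in \<open>\<lambda>\<close> of length below \<open>\<theta>\<close>. By
  \<open>l_power\<close> there are at most \<open>\<lambda>\<close> of these.\<close>

lemma FI_on_ordLeq:
  fixes V :: "'l set set"
  assumes "|V| \<le>o |UNIV :: 'l set|"
  shows "|FI_on V :: ('l set, 'm, 't) FI set| \<le>o |UNIV :: 'l set|"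
proof -
  let ?Seq = "{h :: 't \<rightharpoonup> 'l. ran h \<subseteq> Field |UNIV :: 'l set| \<and> (\<exists>a\<in>Field |UNIV :: 't set|. dom h = underS |UNIV :: 't set| a)}"
  have "|V \<times> (UNIV :: 'm set)| \<le>o |UNIV :: 'l set|"
    using card_of_Times_ordLeq_infinite_Field[of "|UNIV :: 'l set|", OF _ assms m_le_l] infinite_l
    by (simp add: Field_card_of card_of_card_order_on)
  then obtain j :: "'l set \<times> 'm \<Rightarrow> 'l" where j: "inj_on j (V \<times> UNIV)"
    using card_of_ordLeq[of "V \<times> (UNIV :: 'm set)" "UNIV :: 'l set"] by auto
  have "\<exists>s\<in>?Seq. ran s = j ` Map.graph (Rep_FI f)" for f :: "('l set, 'm, 't) FI"
  proof -
    obtain a where "|Map.graph (Rep_FI f)| =o |underS |UNIV :: 't set| a|"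
      using ex_ordIso_underS[OF graph_ordLess] by blast
    then obtain g where g: "bij_betw g (underS |UNIV :: 't set| a) (Map.graph (Rep_FI f))"
      using card_of_ordIso ordIso_symmetric by metis
    define s where "s = (\<lambda>t. if t \<in> underS |UNIV :: 't set| a then Some (j (g t)) else None)"
    have "dom s = underS |UNIV :: 't set| a" by (auto simp: s_def split: if_splits)
    moreover have "ran s = j ` g ` underS |UNIV :: 't set| a" by (auto simp: s_def ran_def split: if_splits)
    ultimately show ?thesis using g by (intro bexI[of _ s]) (auto simp: bij_betw_def Field_card_of)
  qed
  then have "\<forall>f :: ('l set, 'm, 't) FI. \<exists>s. s \<in> ?Seq \<and> ran s = j ` Map.graph (Rep_FI f)" by blast
  from choice[OF this] obtain s :: "('l set, 'm, 't) FI \<Rightarrow> 't \<rightharpoonup> 'l"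
    where s: "\<forall>f. s f \<in> ?Seq \<and> ran (s f) = j ` Map.graph (Rep_FI f)" ..
  have gr: "Map.graph (Rep_FI f) \<subseteq> V \<times> UNIV" if "f \<in> FI_on V" for f :: "('l set, 'm, 't) FI"
    using that by (auto simp: FI_on_def Map.graph_def)
  have "inj_on s (FI_on V)"
  proof (rule inj_onI)
    fix f g :: "('l set, 'm, 't) FI"
    assume fg: "f \<in> FI_on V" "g \<in> FI_on V" "s f = s g"
    then have "j ` Map.graph (Rep_FI f) = j ` Map.graph (Rep_FI g)"
      using s[rule_format, of f] s[rule_format, of g] by simp
    then have "Map.graph (Rep_FI f) = Map.graph (Rep_FI g)"
      using inj_on_image_eq_iff[OF j gr[OF fg(1)] gr[OF fg(2)]] by simp
    then show "f = g" by (rule graph_inject)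
  qed
  then have "|FI_on V :: ('l set, 'm, 't) FI set| \<le>o |?Seq|"
    using s by (intro card_of_ordLeq[THEN iffD1] exI[of _ s]) auto
  then show ?thesis using l_power ordLeq_transitive unfolding less_cexp_def by blast
qed

lemma UNIV_FI_ordLeq: "|UNIV :: ('l set, 'm, 't) FI set| \<le>o |UNIV :: 'l set set|"
proof -
  have "|UNIV :: ('l set \<times> 'm) set| \<le>o |UNIV :: 'l set set|"
    by (rule UNIV_Times_ordLeq[OF infinite_Pow_l ordLeq_refl[OF card_of_Card_order]])
      (rule ordLeq_transitive[OF m_le_l ordLess_imp_ordLeq[OF ordLess_UNIV_set]])
  note le = subsets_ordLeq_ordLeq[OF infinite_l this]
  have "inj (\<lambda>f :: ('l set, 'm, 't) FI. Map.graph (Rep_FI f))" by (rule injI) (rule graph_inject)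
  moreover have "|Map.graph (Rep_FI f)| \<le>o |UNIV :: 'l set|" for f :: "('l set, 'm, 't) FI"
    by (rule ordLeq_transitive[OF ordLess_imp_ordLeq[OF graph_ordLess] t_le_l])
  ultimately have "|UNIV :: ('l set, 'm, 't) FI set| \<le>o |{X :: ('l set \<times> 'm) set. |X| \<le>o |UNIV :: 'l set| }|"
    using card_of_ordLeq by blast
  then show ?thesis using le ordLeq_transitive by blast
qed

lemma small_Union_l:
  "|I| \<le>o |UNIV :: 'l set| \<Longrightarrow> (\<And>i. i \<in> I \<Longrightarrow> |A i| \<le>o |UNIV :: 'l set| ) \<Longrightarrow> |\<Union>i\<in>I. A i| \<le>o |UNIV :: 'l set|"
  using infinite_l by (simp add: card_of_UNION_ordLeq_infinite)

lemma small_Un_l: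
  "|A| \<le>o |UNIV :: 'l set| \<Longrightarrow> |B| \<le>o |UNIV :: 'l set| \<Longrightarrow> |A \<union> B| \<le>o |UNIV :: 'l set|"
  by (rule card_of_Un_ordLeq_infinite_Field) (simp_all add: infinite_l Field_card_of card_of_card_order_on)

text \<open>Coordinates are closed off in \<open>\<theta>\<close> steps, each level having at most
  \<open>\<lambda>\<close> conditions. By regularity a condition on the union already lives on one
  level, and the next levels contain the domain of its image.\<close>

lemma ex_closed_domain:
  fixes s :: "('l set, 'm, 't) FI \<Rightarrow> ('l set, 'm, 't) FI"
  shows "\<exists>V. |V| \<le>o |UNIV :: 'l set| \<and> (\<forall>f\<in>FI_on V. s f \<in> FI_on V)"
proof -
  let ?r = "|UNIV :: 't set|"
  define N where "N V = V \<union> (\<Union>f\<in>FI_on V. dom (Rep_FI (s f)))" for V :: "'l set set"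
  have N: "|N V| \<le>o |UNIV :: 'l set|" if "|V| \<le>o |UNIV :: 'l set|" for V
    unfolding N_def
  proof (intro small_Un_l small_Union_l that FI_on_ordLeq)
    fix f show "|dom (Rep_FI (s f))| \<le>o |UNIV :: 'l set|"
      by (rule ordLeq_transitive[OF ordLess_imp_ordLeq[OF dom_Rep_FI] t_le_l])
  qed
  define W where "W = wfrec (?r - Id) (\<lambda>W i. \<Union>j\<in>underS ?r i. N (W j))"
  have r: "Well_order ?r" by (rule card_of_Well_order)
  then have wf: "wf (?r - Id)" by (simp add: well_order_on_def)
  have "W i = (\<Union>j\<in>underS ?r i. N (cut W (?r - Id) i j))" for i
    by (rule def_wfrec[OF _ wf]) (simp add: W_def)
  moreover have "(\<Union>j\<in>underS ?r i. N (cut W (?r - Id) i j)) = (\<Union>j\<in>underS ?r i. N (W j))" for i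
    by (rule SUP_cong) (auto simp: cut_def underS_def)
  ultimately have W: "W i = (\<Union>j\<in>underS ?r i. N (W j))" for i by metis
  have small: "|W i| \<le>o |UNIV :: 'l set|" for i
    using wf
  proof (induction i)
    case (less i)
    show ?case
    proof (subst W, rule small_Union_l)
      show "|underS ?r i| \<le>o |UNIV :: 'l set|"
        by (rule ordLeq_transitive[OF ordLess_imp_ordLeq[OF underS_card_of_ordLess] t_le_l])
      fix j assume "j \<in> underS ?r i"
      then show "|N (W j)| \<le>o |UNIV :: 'l set|" using less N by (simp add: underS_def)
    qed
  qed
  have "trans ?r" "antisym ?r" using r by (auto simp: order_on_defs)
  then have "underS ?r i \<subseteq> underS ?r j" if "(i, j) \<in> ?r" for i j
    using that unfolding underS_def by (blast dest: transD antisymD)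
  then have "W i \<subseteq> W j" if "(i, j) \<in> ?r" for i j
    unfolding W[of i] W[of j] using that by (intro UN_mono) auto
  then have chain: "relChain ?r W" unfolding relChain_def by blast
  define V where "V = (\<Union>i. W i)"
  have "s f \<in> FI_on V" if f: "f \<in> FI_on V" for f
  proof -
    have "dom (Rep_FI f) \<subseteq> (\<Union>i\<in>Field ?r. W i)" using f by (simp add: FI_on_def V_def Field_card_of)
    from regularCard_UNION[OF card_of_Card_order regular_t chain this dom_Rep_FI]
    obtain i where "dom (Rep_FI f) \<subseteq> W i" by blast
    then have "dom (Rep_FI (s f)) \<subseteq> N (W i)" unfolding N_def FI_on_def by blast
    moreover obtain j where "under ?r i \<subseteq> underS ?r j" using ex_underS_gt[OF infinite_t] by blast
    moreover have "i \<in> under ?r i" using r by (auto simp: under_def order_on_defs refl_on_def Field_card_of)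
    ultimately have "dom (Rep_FI (s f)) \<subseteq> W j" unfolding W[of j] by blast
    then show ?thesis unfolding FI_on_def V_def by blast
  qed
  moreover have "|V| \<le>o |UNIV :: 'l set|" unfolding V_def using t_le_l small by (rule small_Union_l)
  ultimately show ?thesis by blast
qed

text \<open>A Skolem hull argument: a set closed under the choice of extensions below
  \<open>- a\<close> supports \<open>a\<close>, since a witness on \<open>V\<close> itself is
  compatible with the full condition \<open>f\<close>.\<close>

lemma ex_small_supp:
  fixes a :: "('l set, 'm, 't) B1"
  shows "\<exists>V. |V| \<le>o |UNIV :: 'l set| \<and> supp V a"
proof -
  define s where "s f = (if \<exists>g. FI_le f g \<and> xgen g \<le> - a then SOME g. FI_le f g \<and> xgen g \<le> - a else f)"
    for f :: "('l set, 'm, 't) FI"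
  obtain V where V: "|V| \<le>o |UNIV :: 'l set|" "\<And>f. f \<in> FI_on V \<Longrightarrow> s f \<in> FI_on V"
    using ex_closed_domain[of s] by blast
  have "supp V a"
    unfolding supp_iff_no_restricted_witness
  proof (intro allI impI notI)
    fix f g
    assume f: "xgen f \<le> a" and g: "FI_le (FI_restrict V f) g" "xgen g \<le> - a"
    let ?h = "s (FI_restrict V f)"
    have "\<exists>g. FI_le (FI_restrict V f) g \<and> xgen g \<le> - a" using g by blast
    then have h: "FI_le (FI_restrict V f) ?h \<and> xgen ?h \<le> - a"
      unfolding s_def using someI_ex[of "\<lambda>g. FI_le (FI_restrict V f) g \<and> xgen g \<le> - a"] by simp
    then have "\<not> incompatible f ?h" using FI_restrict_compatible[OF V(2)[OF FI_restrict_on]] by blast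
    then show False using incompatible_of_le_compl[OF f] h by blast
  qed
  then show ?thesis using V(1) by blast
qed

text \<open>An element is recovered from the at most \<open>\<lambda>\<close> conditions on its
  support that lie below it. Thus \<open>2^\<lambda>\<close> stages can decide every
  element.\<close>

lemma UNIV_B1_ordLeq: "|UNIV :: ('l set, 'm, 't) B1 set| \<le>o |UNIV :: 'l set set|"
proof -
  obtain V :: "('l set, 'm, 't) B1 \<Rightarrow> 'l set set" where V: "\<And>a. |V a| \<le>o |UNIV :: 'l set|" "\<And>a. supp (V a) a"
    using ex_small_supp by metis
  define c where "c a = {f \<in> FI_on (V a). xgen f \<le> a}" for a
  have le: "a \<le> b" if "c a = c b" for a b
  proof (rule xgen_le_cong)
    fix f assume "xgen f \<le> a"
    then have "FI_restrict (V a) f \<in> c a" using suppD[OF V(2)] FI_restrict_on by (simp add: c_def)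
    then have "FI_restrict (V a) f \<in> c b" by (simp only: that)
    then have "xgen (FI_restrict (V a) f) \<le> b" by (simp add: c_def)
    then show "xgen f \<le> b" using xgen_mono[OF FI_restrict_le] order_trans by blast
  qed
  have "inj c" by (rule injI) (metis le order_antisym)
  moreover have "|c a| \<le>o |UNIV :: 'l set|" for a
    by (rule ordLeq_transitive[OF card_of_mono1 FI_on_ordLeq[OF V(1)]]) (auto simp: c_def)
  ultimately have "|UNIV :: ('l set, 'm, 't) B1 set| \<le>o |{X :: ('l set, 'm, 't) FI set. |X| \<le>o |UNIV :: 'l set| }|"
    using card_of_ordLeq by blast
  then show ?thesis using subsets_ordLeq_ordLeq[OF infinite_l UNIV_FI_ordLeq] ordLeq_transitive by blast
qed

end

section \<open>Permuting coordinates\<close>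

lemma le_Sup_meets:
  fixes y :: "'b::{boolean_algebra, complete_lattice}"
  assumes "y \<le> Sup X" "y \<noteq> bot"
  shows "\<exists>x\<in>X. inf y x \<noteq> bot"
proof (rule ccontr)
  assume "\<not> ?thesis"
  then have "x \<le> - y" if "x \<in> X" for x using that by (metis inf_commute inf_shunt)
  then have "Sup X \<le> - y" by (rule Sup_least)
  then show False using not_le_and_le_compl[OF assms(2) order_refl] assms(1) order_trans by blast
qed

context FI_algebra
begin

definition FI_perm :: "('i \<Rightarrow> 'i) \<Rightarrow> ('i, 'm, 't) FI \<Rightarrow> ('i, 'm, 't) FI" where
  "FI_perm \<pi> f = Abs_FI (\<lambda>i. Rep_FI f (inv \<pi> i))"

text \<open>The automorphism induced by a permutation of the coordinates, given on all elements
  through the dense set of generators.\<close>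

definition B1_perm :: "('i \<Rightarrow> 'i) \<Rightarrow> ('i, 'm, 't) B1 \<Rightarrow> ('i, 'm, 't) B1" where
  "B1_perm \<pi> a = Sup {xgen (FI_perm \<pi> f) |f. xgen f \<le> a}"

context
  fixes \<pi> :: "'i \<Rightarrow> 'i"
  assumes bij: "bij \<pi>"
begin

lemma dom_FI_perm_aux: "dom (\<lambda>i. Rep_FI f (inv \<pi> i)) = \<pi> ` dom (Rep_FI f)"
  for f :: "('i, 'm, 't) FI"
proof -
  have *: "i \<in> \<pi> ` D \<longleftrightarrow> inv \<pi> i \<in> D" for i D
    using inv_f_f[OF bij_is_inj[OF bij]] surj_f_inv_f[OF bij_is_surj[OF bij]]
    by (auto intro: rev_image_eqI)
  show ?thesis by (rule set_eqI) (unfold *, simp add: domIff)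
qed

lemma Rep_FI_perm: "Rep_FI (FI_perm \<pi> f) = (\<lambda>i. Rep_FI f (inv \<pi> i))"
proof -
  have "|\<pi> ` dom (Rep_FI f)| <o |UNIV :: 't set|"
    by (rule ordLeq_ordLess_trans[OF card_of_image dom_Rep_FI])
  then show ?thesis unfolding FI_perm_def by (simp add: Abs_FI_inverse dom_FI_perm_aux)
qed

lemma FI_perm_apply: "Rep_FI (FI_perm \<pi> f) (\<pi> i) = Rep_FI f i"
  using bij by (simp add: Rep_FI_perm bij_is_inj)

lemma dom_FI_perm: "dom (Rep_FI (FI_perm \<pi> f)) = \<pi> ` dom (Rep_FI f)"
  by (simp add: Rep_FI_perm dom_FI_perm_aux)

lemma FI_le_perm_iff: "FI_le (FI_perm \<pi> f) (FI_perm \<pi> g) \<longleftrightarrow> FI_le f g"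
  unfolding FI_le_def map_le_def dom_FI_perm by (simp add: FI_perm_apply)

lemma incompatible_perm_iff: "incompatible (FI_perm \<pi> f) (FI_perm \<pi> g) \<longleftrightarrow> incompatible f g"
proof -
  have "\<pi> ` A \<inter> \<pi> ` B = \<pi> ` (A \<inter> B)" for A B
    using bij by (simp add: bij_is_inj image_Int)
  then show ?thesis unfolding incompatible_def dom_FI_perm by (simp add: FI_perm_apply)
qed

text \<open>For the converse, an extension \<open>g\<close> of \<open>f\<close> below
  \<open>- a\<close> would have an image meeting the image of some \<open>h\<close> below
  \<open>a\<close>; then \<open>g\<close> and \<open>h\<close> would be compatible.\<close>

lemma xgen_perm_le_iff: "xgen (FI_perm \<pi> f) \<le> B1_perm \<pi> a \<longleftrightarrow> xgen f \<le> a"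
proof
  assume "xgen f \<le> a"
  then show "xgen (FI_perm \<pi> f) \<le> B1_perm \<pi> a"
    unfolding B1_perm_def by (intro Sup_upper) blast
next
  assume le: "xgen (FI_perm \<pi> f) \<le> B1_perm \<pi> a"
  show "xgen f \<le> a"
  proof (rule ccontr)
    assume "\<not> xgen f \<le> a"
    then obtain g where g: "FI_le f g" "xgen g \<le> - a" using not_xgen_le by blast
    have "xgen (FI_perm \<pi> g) \<le> Sup {xgen (FI_perm \<pi> f) |f. xgen f \<le> a}"
      using order_trans[OF xgen_mono le] g(1) FI_le_perm_iff unfolding B1_perm_def by blast
    from le_Sup_meets[OF this xgen_neq_bot]
    obtain h where h: "xgen h \<le> a" "inf (xgen (FI_perm \<pi> g)) (xgen (FI_perm \<pi> h)) \<noteq> bot" by blast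
    then have "\<not> incompatible g h" using xgen_inf_neq_bot_iff incompatible_perm_iff by blast
    then show False using incompatible_of_le_compl[OF h(1) g(2)] incompatible_sym by blast
  qed
qed

lemma FI_perm_on: "f \<in> FI_on V \<Longrightarrow> FI_perm \<pi> f \<in> FI_on (\<pi> ` V)"
  unfolding FI_on_def mem_Collect_eq dom_FI_perm by (rule image_mono)

text \<open>Permuting does not change the restriction of a condition to fixed coordinates, and this
  restriction settles whether it lies below \<open>a\<close>.\<close>

lemma supp_perm_invariant:
  assumes "supp V a" and fixed: "\<And>v. v \<in> V \<Longrightarrow> \<pi> v = v"
  shows "xgen (FI_perm \<pi> f) \<le> a \<longleftrightarrow> xgen f \<le> a"
proof -
  have inv: "inv \<pi> v = v" if "v \<in> V" for v
    using inv_f_f[OF bij_is_inj[OF bij], of v] fixed[OF that] by simp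
  have "Rep_FI (FI_restrict V (FI_perm \<pi> f)) = Rep_FI (FI_restrict V f)"
    by (rule ext) (simp add: Rep_FI_restrict Rep_FI_perm restrict_map_def inv)
  then have "FI_restrict V (FI_perm \<pi> f) = FI_restrict V f" by (simp add: Rep_FI_inject)
  then show ?thesis
    using suppD[OF assms(1), of f] suppD[OF assms(1), of "FI_perm \<pi> f"]
      order_trans[OF xgen_mono[OF FI_restrict_le[of V f]]]
      order_trans[OF xgen_mono[OF FI_restrict_le[of V "FI_perm \<pi> f"]]] by metis
qed

end

lemma FI_perm_inv:
  assumes "bij \<pi>"
  shows "FI_perm (inv \<pi>) (FI_perm \<pi> f) = f"
proof -
  have "Rep_FI (FI_perm (inv \<pi>) (FI_perm \<pi> f)) = Rep_FI f"
    using assms bij_imp_bij_inv[OF assms]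
    by (intro ext) (simp add: Rep_FI_perm inv_inv_eq bij_is_inj)
  then show ?thesis by (simp add: Rep_FI_inject)
qed

end

lemma ordLeq_Diff:
  assumes "infinite A" "|V| <o |A|"
  shows "|A| \<le>o |A - V|"
proof (rule ccontr)
  assume "\<not> |A| \<le>o |A - V|"
  then have "|A - V| <o |A|" by (simp add: not_ordLeq_iff_ordLess[OF card_of_Well_order card_of_Well_order])
  then have "|(A - V) \<union> V| <o |A|" using assms by (intro card_of_Un_ordLess_infinite)
  moreover have "|A| \<le>o |(A - V) \<union> V|" by (rule card_of_mono1) blast
  ultimately show False using not_ordLess_ordLeq by (metis (no_types))
qed

text \<open>Both complements left over by \<open>p\<close> and the identity on \<open>V\<close> have
  full cardinality, so any bijection between them completes the map.\<close>

lemma ex_bij_extending: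
  fixes p :: "'a \<Rightarrow> 'a"
  assumes inf: "infinite (UNIV :: 'a set)" and A: "|A| <o |UNIV :: 'a set|" and V: "|V| <o |UNIV :: 'a set|"
    and p: "inj_on p A" and disj: "A \<inter> V = {}" "p ` A \<inter> V = {}"
  shows "\<exists>\<pi>. bij \<pi> \<and> (\<forall>v\<in>V. \<pi> v = v) \<and> (\<forall>x\<in>A. \<pi> x = p x)"
proof -
  have compl: "|- X| =o |UNIV :: 'a set|" if "|X| <o |UNIV :: 'a set|" for X :: "'a set"
    using ordLeq_Diff[OF inf that] card_of_mono1[of "- X" UNIV]
    by (simp add: ordIso_iff_ordLeq Compl_eq_Diff_UNIV)
  have pA: "|p ` A| <o |UNIV :: 'a set|" by (rule ordLeq_ordLess_trans[OF card_of_image A])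
  have "|- (V \<union> A)| =o |- (V \<union> p ` A)|"
    using compl[OF card_of_Un_ordLess_infinite[OF inf V A]]
      compl[OF card_of_Un_ordLess_infinite[OF inf V pA]] ordIso_symmetric ordIso_transitive by metis
  then obtain q where q: "bij_betw q (- (V \<union> A)) (- (V \<union> p ` A))" using card_of_ordIso by blast
  define \<pi> where "\<pi> x = (if x \<in> V then x else if x \<in> A then p x else q x)" for x
  have VV: "bij_betw \<pi> V V" by (subst bij_betw_cong[of V \<pi> id]) (auto simp: \<pi>_def)
  have AA: "bij_betw \<pi> A (p ` A)"
    using p disj by (subst bij_betw_cong[of A \<pi> p]) (auto simp: \<pi>_def bij_betw_def)
  have VA: "bij_betw \<pi> (V \<union> A) (V \<union> p ` A)"
    using disj by (intro bij_betw_combine[OF VV AA]) auto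
  have "bij_betw \<pi> (- (V \<union> A)) (- (V \<union> p ` A))"
    using q by (subst bij_betw_cong[of _ \<pi> q]) (auto simp: \<pi>_def)
  from bij_betw_combine[OF VA this Compl_disjoint] have "bij \<pi>" by (simp only: Compl_partition)
  moreover have "\<forall>v\<in>V. \<pi> v = v" "\<forall>x\<in>A. \<pi> x = p x" using disj by (auto simp: \<pi>_def)
  ultimately show ?thesis by blast
qed

lemma underS_card_of_subset: "underS |A| a \<subseteq> A"
  using Field_card_of[of A] by (auto simp: underS_def Field_def)

lemma underS_linear: "underS |A| a \<subseteq> underS |A| b \<or> underS |A| b \<subseteq> underS |A| a"
proof (cases "a \<in> A \<and> b \<in> A")
  case True
  have *: "trans |A|" "antisym |A|" "total_on (Field |A| ) |A|"
    using card_of_Well_order[of A] by (auto simp: order_on_defs)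
  have "underS |A| x \<subseteq> underS |A| y" if "(x, y) \<in> |A|" for x y
    using that *(1,2) unfolding underS_def by (blast dest: transD antisymD)
  moreover have "a = b \<or> (a, b) \<in> |A| \<or> (b, a) \<in> |A|"
    using *(3) True unfolding total_on_def Field_card_of by blast
  ultimately show ?thesis by auto
next
  case False
  then have "underS |A| a = {} \<or> underS |A| b = {}"
    using Field_card_of[of A] by (auto simp: underS_def Field_def)
  then show ?thesis by blast
qed

section \<open>The Key Property over arbitrary sets of fewer than \<open>2^\<lambda>\<close>
  coordinates\<close>

context FI_lambda
begin

lemma key_supp:
  fixes b :: "'l set \<Rightarrow> ('l set, 'm, 't) B1"
  assumes sup: "seq_supported V b" and cont: "continuous_seq sigma b" and u: "u \<in> small_subsets sigma UNIV"
  shows "supp V (b u)"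
proof -
  have fin: "supp V (b v)" if "finite v" for v
    using sup that unfolding seq_supported_def is_support_def
    by (intro supported_imp_supp) (meson supported_def subset_trans)
  show ?thesis
  proof (cases "finite u")
    case False
    then have "b u = Inf (b ` {v. v \<subseteq> u \<and> finite v})" using cont u unfolding continuous_seq_def by blast
    then show ?thesis using fin by (auto intro: supp_Inf)
  qed (rule fin)
qed

text \<open>If \<open>2\<^bsup>\<lambda>\<^esup>\<close> is singular, a set of fewer than \<open>2\<^bsup>\<lambda>\<^esup>\<close> coordinates may be cofinal. A permutation of the
  coordinates that fixes the support of \<open>b\<close> moves it below some \<open>a\<close>.\<close>

lemma key_property_extend:
  fixes b :: "'l set \<Rightarrow> ('l set, 'm, 't) B1"
  assumes V: "|V| \<le>o |UNIV :: 'l set|" and sup: "seq_supported V b" and cont: "continuous_seq sigma b"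
    and Om: "Om \<subseteq> small_subsets sigma UNIV"
    and key: "\<And>a. V \<subseteq> underS |UNIV :: 'l set set| a \<Longrightarrow>
      \<exists>b'. (\<forall>u\<in>small_subsets sigma UNIV. Inf (b' ` u) \<le> b u) \<and>
        (\<forall>f\<in>FI_on (underS |UNIV :: 'l set set| a). \<forall>u\<in>Om. xgen f \<le> b u \<longrightarrow>
          (\<exists>f'. FI_le f f' \<and> xgen f' \<le> Inf (b' ` u)))"
    and V': "V \<subseteq> V'" "|V'| <o |UNIV :: 'l set set|"
  shows "\<exists>b'. (\<forall>u\<in>small_subsets sigma UNIV. Inf (b' ` u) \<le> b u) \<and>
        (\<forall>f\<in>FI_on V'. \<forall>u\<in>Om. xgen f \<le> b u \<longrightarrow> (\<exists>f'. FI_le f f' \<and> xgen f' \<le> Inf (b' ` u)))"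
proof (cases "|V'| \<le>o |UNIV :: 'l set|")
  case True
  then obtain a where a: "V' \<subseteq> underS |UNIV :: 'l set set| a" using ordLeq_bounded_in_Pow[OF infinite_l] by blast
  then show ?thesis using key[of a] V'(1) FI_on_mono[OF a] by (meson subset_iff subset_trans)
next
  case False
  let ?r = "|UNIV :: 'l set set|"
  have lV': "|UNIV :: 'l set| <o |V'|"
    using False by (simp add: not_ordLeq_iff_ordLess[OF card_of_Well_order card_of_Well_order])
  \<comment> \<open>One segment is to contain \<open>V\<close> and to be at least as large as
    \<open>V'\<close>. Since its size exceeds \<open>\<lambda>\<close>, it has room for a copy of
    \<open>V' - V\<close> outside \<open>V\<close>.\<close>
  obtain a0 where a0: "V \<subseteq> underS ?r a0" using ordLeq_bounded_in_Pow[OF infinite_l V] by blast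
  obtain a1 where a1: "|V'| =o |underS ?r a1|" using ex_ordIso_underS[OF V'(2)] by blast
  obtain a where a: "underS ?r a0 \<subseteq> underS ?r a" "underS ?r a1 \<subseteq> underS ?r a"
    using underS_linear[of UNIV a0 a1] by blast
  have Va: "V \<subseteq> underS ?r a" using a0 a(1) by blast
  have le: "|V'| \<le>o |underS ?r a|" by (rule ordIso_ordLeq_trans[OF a1 card_of_mono1[OF a(2)]])
  then have la: "|UNIV :: 'l set| <o |underS ?r a|" by (rule ordLess_ordLeq_trans[OF lV'])
  have "infinite (underS ?r a)"
    using card_of_ordLeq_infinite[OF ordLess_imp_ordLeq[OF la] infinite_l] .
  then have "|underS ?r a| \<le>o |underS ?r a - V|" by (rule ordLeq_Diff[OF _ ordLeq_ordLess_trans[OF V la]])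
  then have "|V' - V| \<le>o |underS ?r a - V|"
    by (rule ordLeq_transitive[OF card_of_mono1[OF Diff_subset] ordLeq_transitive[OF le]])
  then obtain p where p: "inj_on p (V' - V)" "p ` (V' - V) \<subseteq> underS ?r a - V"
    using card_of_ordLeq[of "V' - V" "underS ?r a - V"] by auto
  have "\<exists>\<pi>. bij \<pi> \<and> (\<forall>v\<in>V. \<pi> v = v) \<and> (\<forall>x\<in>V' - V. \<pi> x = p x)"
  proof (rule ex_bij_extending[OF infinite_Pow_l _ _ p(1)])
    show "|V' - V| <o ?r" by (rule ordLeq_ordLess_trans[OF card_of_mono1[OF Diff_subset] V'(2)])
    show "|V| <o ?r" by (rule ordLeq_ordLess_trans[OF V ordLess_UNIV_set])
    show "p ` (V' - V) \<inter> V = {}" using p(2) by blast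
  qed blast
  then obtain \<pi> where "bij \<pi> \<and> (\<forall>v\<in>V. \<pi> v = v) \<and> (\<forall>x\<in>V' - V. \<pi> x = p x)" ..
  then have \<pi>: "bij \<pi>" "\<And>v. v \<in> V \<Longrightarrow> \<pi> v = v" "\<And>x. x \<in> V' - V \<Longrightarrow> \<pi> x = p x"
    by simp_all
  have \<pi>V': "\<pi> ` V' \<subseteq> underS ?r a"
  proof
    fix y assume "y \<in> \<pi> ` V'"
    then obtain x where x: "x \<in> V'" "y = \<pi> x" by blast
    show "y \<in> underS ?r a"
    proof (cases "x \<in> V")
      case True
      then show ?thesis using \<pi>(2) Va x(2) by auto
    next
      case False
      then have "y = p x" using \<pi>(3) x by blast
      then show ?thesis using p(2) x(1) False by blast
    qed
  qed
  obtain b2 where b2: "\<And>u. u \<in> small_subsets sigma UNIV \<Longrightarrow> Inf (b2 ` u) \<le> b u"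
    "\<And>f u. f \<in> FI_on (underS ?r a) \<Longrightarrow> u \<in> Om \<Longrightarrow> xgen f \<le> b u \<Longrightarrow> \<exists>f'. FI_le f f' \<and> xgen f' \<le> Inf (b2 ` u)"
    using key[OF Va] by blast
  have bi: "bij (inv \<pi>)" by (rule bij_imp_bij_inv[OF \<pi>(1)])
  \<comment> \<open>The refinement found below \<open>a\<close> is pulled back along the
    permutation; \<open>b\<close> itself is unaffected, as its support is fixed.\<close>
  define b' where "b' i = B1_perm (inv \<pi>) (b2 i)" for i
  have b'i: "xgen f \<le> b' i \<longleftrightarrow> xgen (FI_perm \<pi> f) \<le> b2 i" for f i
    using xgen_perm_le_iff[OF bi, of "FI_perm \<pi> f" "b2 i"] by (simp add: b'_def FI_perm_inv[OF \<pi>(1)])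
  have b': "xgen f \<le> Inf (b' ` u) \<longleftrightarrow> xgen (FI_perm \<pi> f) \<le> Inf (b2 ` u)" for f u
    by (simp add: le_Inf_iff b'i)
  have bu: "xgen (FI_perm \<pi> f) \<le> b u \<longleftrightarrow> xgen f \<le> b u" if "u \<in> small_subsets sigma UNIV" for f u
    by (rule supp_perm_invariant[OF \<pi>(1) key_supp[OF sup cont that] \<pi>(2)])
  show ?thesis
  proof (intro exI[of _ b'] conjI ballI impI)
    fix u assume u: "u \<in> small_subsets sigma (UNIV :: 'l set)"
    show "Inf (b' ` u) \<le> b u"
    proof (rule xgen_le_cong)
      fix f assume "xgen f \<le> Inf (b' ` u)"
      then have "xgen (FI_perm \<pi> f) \<le> b u" using b' order_trans[OF _ b2(1)[OF u]] by blast
      then show "xgen f \<le> b u" using bu[OF u] by blast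
    qed
  next
    fix f u assume f: "f \<in> FI_on V'" and u: "u \<in> Om" and "xgen f \<le> b u"
    then have "xgen (FI_perm \<pi> f) \<le> b u" using bu Om by blast
    moreover have "FI_perm \<pi> f \<in> FI_on (underS ?r a)"
      using FI_perm_on[OF \<pi>(1) f] FI_on_mono[OF \<pi>V'] by blast
    ultimately obtain g where g: "FI_le (FI_perm \<pi> f) g" "xgen g \<le> Inf (b2 ` u)" using b2(2) u by blast
    have eq: "FI_perm \<pi> (FI_perm (inv \<pi>) g) = g"
      using FI_perm_inv[OF bi, of g] inv_inv_eq[OF \<pi>(1)] by simp
    have "FI_le (FI_perm \<pi> f) (FI_perm \<pi> (FI_perm (inv \<pi>) g))" using g(1) eq by simp
    then have "FI_le f (FI_perm (inv \<pi>) g)" by (simp only: FI_le_perm_iff[OF \<pi>(1)])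
    moreover have "xgen (FI_perm (inv \<pi>) g) \<le> Inf (b' ` u)" using b' eq g(2) by simp
    ultimately show "\<exists>f'. FI_le f f' \<and> xgen f' \<le> Inf (b' ` u)" by blast
  qed
qed

end

section \<open>Normal ultrafilters\<close>

lemma ordLess_Union_finite:
  assumes "Cinfinite sigma" "finite I" "\<And>i. i \<in> I \<Longrightarrow> |A i| <o sigma"
  shows "|\<Union>i\<in>I. A i| <o sigma"
  using assms(2,3)
proof (induction I)
  case empty
  then show ?case using assms(1) by (simp add: Cinfinite_gt_empty)
next
  case (insert i I)
  then show ?case using assms(1) by (simp add: card_of_Un_ordLess_infinite_Field cinfinite_def)
qed

text \<open>Recursion on proper subsets of finite sets: \<open>F v\<close> covers \<open>v\<close>
  together with the finitely many earlier values, whose union is still small.\<close>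

lemma ex_monotone_cover:
  fixes sigma :: "'s rel" and Om :: "'l set set"
  assumes sigma: "Cinfinite sigma" and Om: "unbounded_in sigma UNIV Om"
  shows "\<exists>F. (\<forall>v. finite v \<longrightarrow> F v \<in> Om \<and> v \<subseteq> F v) \<and> (\<forall>v w. finite w \<longrightarrow> v \<subseteq> w \<longrightarrow> F v \<subseteq> F w)"
proof -
  obtain G :: "'l set \<Rightarrow> 'l set" where G: "\<And>u. |u| <o sigma \<Longrightarrow> G u \<in> Om \<and> u \<subseteq> G u"
    using Om unfolding unbounded_in_def small_subsets_def by simp metis
  have Om_small: "|u| <o sigma" if "u \<in> Om" for u
    using that Om unfolding unbounded_in_def small_subsets_def by blast
  have small_fin: "|v| <o sigma" if "finite v" for v :: "'l set"
    using sigma that by (intro Cfinite_ordLess_Cinfinite) (simp_all add: cfinite_def Field_card_of card_of_card_order_on)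
  define F where "F = wfrec finite_psubset (\<lambda>F v. G (v \<union> \<Union>(F ` {x. x \<subset> v})))"
  have F: "F v = G (v \<union> \<Union>(F ` {x. x \<subset> v}))" if "finite v" for v
  proof -
    have "F v = G (v \<union> \<Union>(cut F finite_psubset v ` {x. x \<subset> v}))"
      by (rule def_wfrec[OF _ wf_finite_psubset]) (simp add: F_def)
    moreover have "cut F finite_psubset v ` {x. x \<subset> v} = F ` {x. x \<subset> v}"
      by (rule image_cong) (auto simp: cut_def finite_psubset_def that)
    ultimately show ?thesis by simp
  qed
  have "finite v \<longrightarrow> F v \<in> Om \<and> v \<union> \<Union>(F ` {x. x \<subset> v}) \<subseteq> F v" for v
  proof (induction v rule: wf_induct_rule[OF wf_finite_psubset])
    case (1 v)
    show ?case
    proof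
      assume fin: "finite v"
      have "|F x| <o sigma" if "x \<in> {x. x \<subset> v}" for x
        using that 1[of x] fin finite_subset Om_small by (auto simp: finite_psubset_def)
      then have "|\<Union>(F ` {x. x \<subset> v})| <o sigma"
        using fin sigma by (intro ordLess_Union_finite) (auto intro: finite_subset[of _ "Pow v"])
      then have "|v \<union> \<Union>(F ` {x. x \<subset> v})| <o sigma"
        using sigma small_fin[OF fin] by (intro card_of_Un_ordLess_infinite_Field) (auto simp: cinfinite_def)
      from G[OF this] show "F v \<in> Om \<and> v \<union> \<Union>(F ` {x. x \<subset> v}) \<subseteq> F v"
        using F[OF fin] by simp
    qed
  qed
  then show ?thesis by (intro exI[of _ F]) (metis Un_subset_iff Sup_le_iff imageI mem_Collect_eq order_refl psubsetI)
qed

lemma finite_subset_underS: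
  assumes "infinite A" "finite v" "v \<subseteq> A"
  shows "\<exists>a\<in>A. v \<subseteq> underS |A| a"
  using assms(2,3)
proof (induction v)
  case empty
  then show ?case using assms(1) by (metis finite.emptyI ex_in_conv empty_subsetI)
next
  case (insert x v)
  then obtain a where a: "a \<in> A" "v \<subseteq> underS |A| a" by blast
  have *: "trans |A|" "antisym |A|"
    using card_of_Well_order[of A] by (auto simp: order_on_defs)
  have "\<exists>b\<in>Field |A|. x \<noteq> b \<and> (x, b) \<in> |A|"
    using assms(1) insert by (intro infinite_Card_order_limit) (simp_all add: card_of_card_order_on Field_card_of)
  then obtain b where b: "b \<in> A" "x \<in> underS |A| b" by (auto simp: underS_def Field_card_of)
  show ?case using underS_linear[of A a b] a b by blast
qed

text \<open>A club is closed only under unions of chains. Induction on the cardinality of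
  \<open>A\<close> writes the directed union as a chain of unions over initial segments of
  \<open>A\<close>, each of smaller cardinality; a finite subset of an infinite \<open>A\<close>
  lies in one of them.\<close>

lemma directed_Union_in_club:
  fixes sigma :: "'s rel" and Om :: "'l set set"
  assumes club: "club_in sigma UNIV Om"
    and F: "\<And>v. finite v \<Longrightarrow> F v \<in> Om" "\<And>v w. finite w \<Longrightarrow> v \<subseteq> w \<Longrightarrow> F v \<subseteq> F w"
    and A: "|A| <o sigma"
  shows "(\<Union>v\<in>{v. finite v \<and> v \<subseteq> A}. F v) \<in> Om"
proof -
  define T where "T A = (\<Union>v\<in>{v. finite v \<and> v \<subseteq> A}. F v)" for A
  have T_mono: "T X \<subseteq> T Y" if "X \<subseteq> Y" for X Y using that by (auto simp: T_def)
  have "T A \<in> Om"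
    using A
  proof (induction A rule: wf_induct_rule[OF wf_inv_image[OF wf_ordLess, of card_of]])
    case (1 A)
    show ?case
    proof (cases "finite A")
      case True
      then have "T A = F A" using F(2) by (auto simp: T_def)
      then show ?thesis using F(1)[OF True] by simp
    next
      case False
      let ?C = "(\<lambda>a. T (underS |A| a)) ` A"
      have "T (underS |A| a) \<in> Om" if "a \<in> A" for a
      proof (rule 1(1))
        show "(underS |A| a, A) \<in> inv_image ordLess card_of"
          using card_of_underS[OF card_of_Card_order, of a A] that by (simp add: Field_card_of)
        show "|underS |A| a| <o sigma"
          by (rule ordLeq_ordLess_trans[OF card_of_mono1[OF underS_card_of_subset] 1(2)])
      qed
      then have "?C \<subseteq> Om" by (rule image_subsetI)
      moreover have "T (underS |A| a) \<subseteq> T (underS |A| b) \<or> T (underS |A| b) \<subseteq> T (underS |A| a)" for a b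
        by (rule disj_forward[OF underS_linear T_mono T_mono])
      then have "chain_subset ?C" by (simp add: chain_subset_def)
      moreover have "|?C| <o sigma" by (rule ordLeq_ordLess_trans[OF card_of_image 1(2)])
      moreover have "?C \<noteq> {}" using False by auto
      ultimately have "\<Union>?C \<in> Om" using club by (simp add: club_in_def)
      moreover have "\<Union>?C = T A"
      proof
        show "\<Union>?C \<subseteq> T A" using T_mono[OF underS_card_of_subset] by (rule UN_least)
        show "T A \<subseteq> \<Union>?C"
        proof
          fix x assume "x \<in> T A"
          then obtain v where v: "finite v" "v \<subseteq> A" "x \<in> F v" by (auto simp: T_def)
          then obtain a where "a \<in> A" "v \<subseteq> underS |A| a" using finite_subset_underS[OF False] by blast
          then show "x \<in> \<Union>?C" using v by (auto simp: T_def)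
        qed
      qed
      ultimately show ?thesis by simp
    qed
  qed
  then show ?thesis by (simp add: T_def)
qed

section \<open>Statements true for almost all small sets\<close>

locale normal_ultrafilter =
  fixes sigma :: "'s rel" and U :: "'k set set set"
  assumes sigma: "Cinfinite sigma" "natLeq <o sigma"
    and complete: "complete_ultrafilter_on sigma (small_subsets sigma UNIV) U"
    and fine: "fine_on sigma UNIV U"
    and normal: "normal_on sigma UNIV U"
begin

definition often :: "('k set \<Rightarrow> bool) \<Rightarrow> bool" where
  "often P \<longleftrightarrow> {w \<in> small_subsets sigma UNIV. P w} \<in> U"

lemma often_mono:
  assumes "often P" "\<And>w. |w| <o sigma \<Longrightarrow> P w \<Longrightarrow> Q w"
  shows "often Q"
proof -
  have "{w \<in> small_subsets sigma UNIV. P w} \<subseteq> {w \<in> small_subsets sigma UNIV. Q w}"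
    using assms(2) by (auto simp: small_subsets_def)
  then show ?thesis using assms(1) complete unfolding often_def complete_ultrafilter_on_def by blast
qed

lemma often_or_not: "often P \<or> often (\<lambda>w. \<not> P w)"
proof -
  have "small_subsets sigma UNIV - {w \<in> small_subsets sigma UNIV. P w} = {w \<in> small_subsets sigma UNIV. \<not> P w}"
    by blast
  moreover have "{w \<in> small_subsets sigma UNIV. P w} \<subseteq> small_subsets sigma UNIV" by blast
  ultimately show ?thesis
    using complete unfolding often_def complete_ultrafilter_on_def by metis
qed

lemma often_True: "often (\<lambda>w. True)"
  using complete unfolding often_def complete_ultrafilter_on_def by simp

lemma often_ball:
  assumes "|I| <o sigma" "\<And>i. i \<in> I \<Longrightarrow> often (P i)"
  shows "often (\<lambda>w. \<forall>i\<in>I. P i w)"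
proof (cases "I = {}")
  case False
  let ?C = "(\<lambda>i. {w \<in> small_subsets sigma UNIV. P i w}) ` I"
  have "|?C| <o sigma" by (rule ordLeq_ordLess_trans[OF card_of_image assms(1)])
  moreover have "?C \<subseteq> U" using assms(2) unfolding often_def by blast
  ultimately have "\<Inter>?C \<in> U" using False complete unfolding complete_ultrafilter_on_def by blast
  moreover have "\<Inter>?C = {w \<in> small_subsets sigma UNIV. \<forall>i\<in>I. P i w}" using False by blast
  ultimately show ?thesis unfolding often_def by simp
qed (simp add: often_True)

lemma finite_ordLess_sigma: "finite A \<Longrightarrow> |A| <o sigma"
  using sigma(1) by (intro Cfinite_ordLess_Cinfinite) (simp_all add: cfinite_def Field_card_of card_of_card_order_on)

lemma often_conj:
  assumes "often P" "often Q"
  shows "often (\<lambda>w. P w \<and> Q w)"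
proof -
  have "often (\<lambda>w. \<forall>R\<in>{P, Q}. R w)"
    using assms by (intro often_ball finite_ordLess_sigma) auto
  then show ?thesis by simp
qed

lemma often_ex: "often P \<Longrightarrow> \<exists>w. |w| <o sigma \<and> P w"
proof (rule ccontr)
  assume P: "often P" and "\<not> ?thesis"
  then have "{w \<in> small_subsets sigma UNIV. P w} = {}" by (auto simp: small_subsets_def)
  then have "{} \<in> U" using P unfolding often_def by (simp only:)
  then show False using complete unfolding complete_ultrafilter_on_def by blast
qed

lemma often_mem: "often (\<lambda>w. x \<in> w)"
  using fine unfolding often_def fine_on_def by simp

lemma often_subset: "|X| <o sigma \<Longrightarrow> often (\<lambda>w. X \<subseteq> w)"
  using often_ball[of X "\<lambda>x w. x \<in> w"] often_mem by (simp add: subset_iff Ball_def)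

lemma often_regressive: "often (\<lambda>w. f w \<in> w) \<Longrightarrow> \<exists>x. often (\<lambda>w. f w = x)"
  using normal unfolding often_def normal_on_def by blast

text \<open>Uncountability of \<open>\<sigma>\<close> allows a countable intersection: if every
  value were avoided almost always, some \<open>w\<close> would avoid them all.\<close>

lemma often_const_nat: "\<exists>n. often (\<lambda>w. (f w :: nat) = n)"
proof (rule ccontr)
  assume "\<not> ?thesis"
  then have *: "often (\<lambda>w. f w \<noteq> n)" for n using often_or_not by blast
  have "|UNIV :: nat set| <o sigma" by (rule ordIso_ordLess_trans[OF card_of_nat sigma(2)])
  from often_ex[OF often_ball[OF this *]] show False by blast
qed

text \<open>Normality fixes one chosen element of \<open>g w\<close>; removing it leaves a set with
  one element fewer.\<close>

lemma often_finite_card_regressive: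
  "often (\<lambda>w. finite (g w) \<and> g w \<subseteq> w \<and> card (g w) = n) \<Longrightarrow> \<exists>v. finite v \<and> often (\<lambda>w. g w = v)"
proof (induction n arbitrary: g)
  case 0
  then have "often (\<lambda>w. g w = {})" by (rule often_mono) auto
  then show ?case by blast
next
  case (Suc n)
  define h where "h w = (SOME x. x \<in> g w)" for w
  have h: "h w \<in> g w" if "card (g w) = Suc n" for w
    unfolding h_def some_in_eq using that by auto
  have "often (\<lambda>w. h w \<in> w)" by (rule often_mono[OF Suc.prems]) (use h in blast)
  then obtain x where x: "often (\<lambda>w. h w = x)" using often_regressive by blast
  have "often (\<lambda>w. finite (g w - {h w}) \<and> g w - {h w} \<subseteq> w \<and> card (g w - {h w}) = n)"
    by (rule often_mono[OF Suc.prems]) (use h in \<open>auto simp: card_Diff_singleton\<close>)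
  from Suc.IH[OF this] obtain v where v: "finite v" "often (\<lambda>w. g w - {h w} = v)" by blast
  have "often (\<lambda>w. g w = insert x v)"
    by (rule often_mono[OF often_conj[OF often_conj[OF x v(2)] Suc.prems]]) (use h in blast)
  then show ?case using v(1) by blast
qed

lemma often_finite_regressive:
  assumes "often (\<lambda>w. finite (g w) \<and> g w \<subseteq> w)"
  shows "\<exists>v. finite v \<and> often (\<lambda>w. g w = v)"
proof -
  obtain n where "often (\<lambda>w. card (g w) = n)" using often_const_nat[of "\<lambda>w. card (g w)"] by blast
  from often_conj[OF assms this] show ?thesis
    by (intro often_finite_card_regressive[of g n]) (rule often_mono, auto)
qed

text \<open>Normality for finite sets, phrased for the trace of \<open>w\<close> on the copy of
  \<open>\<lambda>\<close> given by \<open>e\<close>. The set \<open>v\<close> is recovered from its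
  image because \<open>e\<close> is injective.\<close>

lemma often_finite_vimage_regressive:
  fixes e :: "'l \<Rightarrow> 'k"
  assumes "inj e" "often (\<lambda>w. \<exists>v. finite v \<and> v \<subseteq> e -` w \<and> P v w)"
  shows "\<exists>v. finite v \<and> often (\<lambda>w. P v w)"
proof -
  define g where "g w = (SOME v. finite v \<and> v \<subseteq> e -` w \<and> P v w)" for w
  have g: "often (\<lambda>w. finite (g w) \<and> g w \<subseteq> e -` w \<and> P (g w) w)"
    by (rule often_mono[OF assms(2)]) (unfold g_def, rule someI_ex)
  then have "often (\<lambda>w. finite (e ` g w) \<and> e ` g w \<subseteq> w)" by (rule often_mono) auto
  from often_finite_regressive[OF this] obtain x where x: "often (\<lambda>w. e ` g w = x)" by blast
  have "often (\<lambda>w. P (e -` x) w \<and> finite (e -` x))"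
    by (rule often_mono[OF often_conj[OF g x]]) (use assms(1) in \<open>auto simp: inj_vimage_image_eq\<close>)
  then show ?thesis using often_ex often_mono by blast
qed

text \<open>Almost every \<open>w\<close> is closed under a monotone cover \<open>F\<close>:
  otherwise a single finite \<open>v\<close> would fail almost always, against fineness. The trace
  of a closed \<open>w\<close> is a directed union of values of \<open>F\<close>.\<close>

lemma often_club:
  fixes e :: "'l \<Rightarrow> 'k"
  assumes e: "inj e" and club: "club_in sigma UNIV Om"
  shows "often (\<lambda>w. e -` w \<in> Om)"
proof -
  obtain F where F: "\<And>v. finite v \<Longrightarrow> F v \<in> Om" "\<And>v. finite v \<Longrightarrow> v \<subseteq> F v"
    "\<And>v w. finite w \<Longrightarrow> v \<subseteq> w \<Longrightarrow> F v \<subseteq> F w"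
    using ex_monotone_cover[OF sigma(1)] club unfolding club_in_def by metis
  have Om: "|u| <o sigma" if "u \<in> Om" for u
    using that club unfolding club_in_def unbounded_in_def small_subsets_def by blast
  have "\<not> often (\<lambda>w. \<exists>v. finite v \<and> v \<subseteq> e -` w \<and> \<not> e ` F v \<subseteq> w)"
  proof
    assume "often (\<lambda>w. \<exists>v. finite v \<and> v \<subseteq> e -` w \<and> \<not> e ` F v \<subseteq> w)"
    from often_finite_vimage_regressive[OF e this]
    obtain v where v: "finite v" "often (\<lambda>w. \<not> e ` F v \<subseteq> w)" by blast
    have "often (\<lambda>w. e ` F v \<subseteq> w)"
      by (rule often_subset[OF ordLeq_ordLess_trans[OF card_of_image Om[OF F(1)[OF v(1)]]]])
    then show False using often_ex[OF often_conj[OF v(2)]] by blast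
  qed
  then have "often (\<lambda>w. \<not> (\<exists>v. finite v \<and> v \<subseteq> e -` w \<and> \<not> e ` F v \<subseteq> w))" using often_or_not by blast
  then show ?thesis
  proof (rule often_mono)
    fix w :: "'k set"
    assume w: "|w| <o sigma" "\<not> (\<exists>v. finite v \<and> v \<subseteq> e -` w \<and> \<not> e ` F v \<subseteq> w)"
    have "|e -` w| \<le>o |w|"
      using card_of_ordLeq[of "e -` w" w] inj_on_subset[OF e] by (metis image_vimage_subset subset_UNIV)
    then have "|e -` w| <o sigma" using w(1) by (rule ordLeq_ordLess_trans)
    from directed_Union_in_club[OF club F(1,3) this]
    have "(\<Union>v\<in>{v. finite v \<and> v \<subseteq> e -` w}. F v) \<in> Om" .
    moreover have "(\<Union>v\<in>{v. finite v \<and> v \<subseteq> e -` w}. F v) = e -` w"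
    proof
      show "(\<Union>v\<in>{v. finite v \<and> v \<subseteq> e -` w}. F v) \<subseteq> e -` w" using w(2) by blast
      show "e -` w \<subseteq> (\<Union>v\<in>{v. finite v \<and> v \<subseteq> e -` w}. F v)"
      proof
        fix i assume "i \<in> e -` w"
        then show "i \<in> (\<Union>v\<in>{v. finite v \<and> v \<subseteq> e -` w}. F v)"
          using F(2)[of "{i}"] by (intro UN_I[of "{i}"]) auto
      qed
    qed
    ultimately show "e -` w \<in> Om" by simp
  qed
qed

end

text \<open>The ultrafilter given on subsets of \<open>'u\<close> is pulled back along an injection
  of \<open>'k\<close> into \<open>'u\<close>.\<close>

lemma supercompact_imp_normal_ultrafilter:
  fixes sigma :: "'s rel"
  assumes sc: "supercompact TYPE('u) sigma" and sigma: "Cinfinite sigma" "natLeq <o sigma"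
    and universe: "|UNIV :: 'k set| \<le>o |UNIV :: 'u set|" and le: "sigma \<le>o |UNIV :: 'k set|"
  shows "\<exists>U :: 'k set set set. normal_ultrafilter sigma U"
proof -
  obtain \<phi> :: "'k \<Rightarrow> 'u" where \<phi>: "inj \<phi>" using ex_inj_of_ordLeq[OF universe] by blast
  define K where "K = range \<phi>"
  have "|UNIV :: 'k set| =o |K|"
    using \<phi> card_of_ordIsoI[of \<phi> UNIV K] by (simp add: K_def bij_betw_def)
  then have "sigma \<le>o |K|" using le ordLeq_ordIso_trans by blast
  then obtain W where W: "complete_ultrafilter_on sigma (small_subsets sigma K) W"
    "fine_on sigma K W" "normal_on sigma K W"
    using sc unfolding supercompact_def by blast
  let ?S = "small_subsets sigma (UNIV :: 'k set)"
  let ?SK = "small_subsets sigma K"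
  let ?\<psi> = "\<lambda>w. \<phi> ` w"
  have inj\<psi>: "inj ?\<psi>" using \<phi> by (auto intro!: injI simp: inj_image_eq_iff)
  have \<psi>_set: "?\<psi> ` {w \<in> ?S. P (?\<psi> w)} = {u \<in> ?SK. P u}" for P
  proof
    show "?\<psi> ` {w \<in> ?S. P (?\<psi> w)} \<subseteq> {u \<in> ?SK. P u}"
      using ordLeq_ordLess_trans[OF card_of_image] unfolding small_subsets_def K_def by blast
    show "{u \<in> ?SK. P u} \<subseteq> ?\<psi> ` {w \<in> ?S. P (?\<psi> w)}"
    proof
      fix u assume u: "u \<in> {u \<in> ?SK. P u}"
      then have "u = ?\<psi> (\<phi> -` u)" unfolding small_subsets_def K_def by auto
      moreover have "|\<phi> -` u| \<le>o |u|"
        using card_of_ordLeq[of "\<phi> -` u" u] inj_on_subset[OF \<phi>] by (metis image_vimage_subset subset_UNIV)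
      then have "|\<phi> -` u| <o sigma" using u ordLeq_ordLess_trans unfolding small_subsets_def by blast
      ultimately show "u \<in> ?\<psi> ` {w \<in> ?S. P (?\<psi> w)}"
        using u unfolding small_subsets_def by (intro image_eqI[of _ _ "\<phi> -` u"]) auto
    qed
  qed
  have \<psi>S: "?\<psi> ` ?S = ?SK" using \<psi>_set[of "\<lambda>_. True"] by simp
  define U where "U = {X. X \<subseteq> ?S \<and> ?\<psi> ` X \<in> W}"
  have "complete_ultrafilter_on sigma ?S U"
    unfolding complete_ultrafilter_on_def
  proof (intro conjI ballI allI impI)
    show "U \<subseteq> Pow ?S" "?S \<in> U" "{} \<notin> U"
      using W(1) \<psi>S unfolding U_def complete_ultrafilter_on_def by auto
  next
    fix X Y assume "X \<in> U" "X \<subseteq> Y \<and> Y \<subseteq> ?S"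
    then have Y: "?\<psi> ` X \<in> W" "?\<psi> ` X \<subseteq> ?\<psi> ` Y" "?\<psi> ` Y \<subseteq> ?SK" "Y \<subseteq> ?S"
      using \<psi>S image_mono[of X Y ?\<psi>] image_mono[of Y ?S ?\<psi>] by (simp_all add: U_def)
    then have "?\<psi> ` Y \<in> W" using W(1) by (meson complete_ultrafilter_on_def)
    then show "Y \<in> U" using Y(4) by (simp add: U_def)
  next
    fix X assume X: "X \<subseteq> ?S"
    then have "?\<psi> ` X \<subseteq> ?SK" using \<psi>S by blast
    then have "?\<psi> ` X \<in> W \<or> ?SK - ?\<psi> ` X \<in> W" using W(1) by (simp add: complete_ultrafilter_on_def)
    moreover have "?SK - ?\<psi> ` X = ?\<psi> ` (?S - X)" using \<psi>S image_set_diff[OF inj\<psi>] by simp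
    ultimately show "X \<in> U \<or> ?S - X \<in> U" using X unfolding U_def by auto
  next
    fix C assume C: "C \<subseteq> U \<and> C \<noteq> {} \<and> |C| <o sigma"
    have "(`) ?\<psi> ` C \<subseteq> W" using C unfolding U_def by blast
    moreover have "|(`) ?\<psi> ` C| <o sigma" using C ordLeq_ordLess_trans[OF card_of_image] by blast
    ultimately have "\<Inter>((`) ?\<psi> ` C) \<in> W" using C W(1) by (simp add: complete_ultrafilter_on_def)
    moreover obtain X0 where "X0 \<in> C" using C by blast
    then have "?\<psi> ` (\<Inter>X\<in>C. X) = (\<Inter>X\<in>C. ?\<psi> ` X)" by (intro image_INT[OF inj\<psi>]) auto
    then have "\<Inter>((`) ?\<psi> ` C) = ?\<psi> ` \<Inter>C" by simp
    moreover have "\<Inter>C \<subseteq> ?S" using C unfolding U_def by blast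
    ultimately show "\<Inter>C \<in> U" unfolding U_def by simp
  qed
  moreover have "fine_on sigma UNIV U"
    unfolding fine_on_def
  proof
    fix x :: 'k
    have "{w \<in> ?S. x \<in> w} = {w \<in> ?S. \<phi> x \<in> ?\<psi> w}" using \<phi> by (simp add: inj_image_mem_iff)
    then have "?\<psi> ` {w \<in> ?S. x \<in> w} = {u \<in> ?SK. \<phi> x \<in> u}" using \<psi>_set[of "\<lambda>u. \<phi> x \<in> u"] by simp
    then show "{w \<in> ?S. x \<in> w} \<in> U" using W(2) unfolding fine_on_def U_def K_def by auto
  qed
  moreover have "normal_on sigma UNIV U"
    unfolding normal_on_def
  proof (intro allI impI)
    fix f assume f: "{w \<in> ?S. f w \<in> w} \<in> U"
    \<comment> \<open>Conjugating by the injection turns a regressive function on the small subsets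
      of \<open>'k\<close> into one on those of \<open>K\<close>.\<close>
    define g where "g u = \<phi> (f (\<phi> -` u))" for u
    have g: "g (?\<psi> w) = \<phi> (f w)" for w using \<phi> by (simp add: g_def inj_vimage_image_eq)
    have "?\<psi> ` {w \<in> ?S. f w \<in> w} = {u \<in> ?SK. g u \<in> u}"
      using \<psi>_set[of "\<lambda>u. g u \<in> u"] \<phi> by (simp add: g inj_image_mem_iff)
    then have "{u \<in> ?SK. g u \<in> u} \<in> W" using f unfolding U_def by auto
    then obtain x where x: "{u \<in> ?SK. g u = \<phi> x} \<in> W"
      using W(3) unfolding normal_on_def K_def by blast
    have "?\<psi> ` {w \<in> ?S. f w = x} = {u \<in> ?SK. g u = \<phi> x}"
      using \<psi>_set[of "\<lambda>u. g u = \<phi> x"] \<phi> by (simp add: g inj_eq)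
    then show "\<exists>x\<in>UNIV. {w \<in> ?S. f w = x} \<in> U"
      using x by (intro bexI[of _ x]) (auto simp: U_def)
  qed
  ultimately have "normal_ultrafilter sigma U" using sigma by unfold_locales auto
  then show ?thesis by blast
qed

section \<open>Construction of the optimal ultrafilter\<close>

locale optimal_setup =
  FI_lambda types + normal_ultrafilter sigma U
  for types :: "('l set \<times> 'm \<times> 't) itself" and sigma :: "'s rel" and U :: "'l set set set set" +
  assumes sigma_le_t: "sigma \<le>o |UNIV :: 't set|"
begin

lemma finite_in_small: "finite v \<Longrightarrow> v \<in> small_subsets sigma UNIV"
  by (simp add: small_subsets_def finite_ordLess_sigma)

text \<open>Monotonicity extends the continuity equation to finite \<open>u\<close>, which is itself
  one of the finite subsets.\<close>

lemma continuous_seq_eq_Inf: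
  fixes b :: "'l set \<Rightarrow> ('l set, 'm, 't) B1"
  assumes b: "continuous_seq sigma b" and u: "u \<in> small_subsets sigma UNIV"
  shows "b u = Inf (b ` {v. v \<subseteq> u \<and> finite v})"
proof (cases "finite u")
  case True
  have "b u \<le> b v" if "v \<subseteq> u" "finite v" for v
    using b u finite_in_small[OF that(2)] that(1) unfolding continuous_seq_def by blast
  then have "b u \<le> Inf (b ` {v. v \<subseteq> u \<and> finite v})" by (intro Inf_greatest) blast
  moreover have "Inf (b ` {v. v \<subseteq> u \<and> finite v}) \<le> b u" using True by (intro Inf_lower) blast
  ultimately show ?thesis by (rule order_antisym)
next
  case False
  then show ?thesis using b u unfolding continuous_seq_def by blast
qed

text \<open>The Key Property in the form used at a stage: initial segments of
  \<open>2^\<lambda>\<close> are replaced by arbitrary sets of fewer than \<open>2^\<lambda>\<close>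
  coordinates.\<close>

definition key_witness ::
    "('l set \<Rightarrow> ('l set, 'm, 't) B1) \<Rightarrow> 'l set set \<Rightarrow> 'l set set \<Rightarrow> bool" where
  "key_witness b V Om \<longleftrightarrow> |V| \<le>o |UNIV :: 'l set| \<and> seq_supported V b \<and> club_in sigma UNIV Om \<and>
    (\<forall>V'. V \<subseteq> V' \<longrightarrow> |V'| <o |UNIV :: 'l set set| \<longrightarrow>
      (\<exists>b'. (\<forall>u\<in>small_subsets sigma UNIV. Inf (b' ` u) \<le> b u) \<and>
        (\<forall>f\<in>FI_on V'. \<forall>u\<in>Om. xgen f \<le> b u \<longrightarrow> (\<exists>f'. FI_le f f' \<and> xgen f' \<le> Inf (b' ` u)))))"

lemma key_property_imp_continuous: "key_property sigma b \<Longrightarrow> continuous_seq sigma b"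
  by (simp add: key_property_def)

lemma ex_key_witness:
  fixes b :: "'l set \<Rightarrow> ('l set, 'm, 't) B1"
  assumes "key_property sigma b"
  shows "\<exists>V Om. key_witness b V Om"
proof -
  \<comment> \<open>Uncountability of \<open>\<sigma>\<close> selects the club clause of the Key
    Property.\<close>
  have "\<not> sigma =o natLeq" using sigma(2) not_ordLess_ordIso ordIso_symmetric by blast
  then obtain V Om where V: "|V| \<le>o |UNIV :: 'l set|" "seq_supported V b" "club_in sigma UNIV Om"
    and key: "\<forall>a. V \<subseteq> underS |UNIV :: 'l set set| a \<longrightarrow>
           (\<exists>b' :: 'l \<Rightarrow> ('l set, 'm, 't) B1.
              (\<forall>i. b' i \<noteq> bot) \<and>
              (\<forall>u\<in>small_subsets sigma UNIV. Inf (b' ` u) \<le> b u \<and> Inf (b' ` u) \<noteq> bot) \<and>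
              (\<forall>f\<in>FI_on (underS |UNIV :: 'l set set| a). \<forall>u\<in>Om. xgen f \<le> b u \<longrightarrow>
                 (\<exists>f'. FI_le f f' \<and> xgen f' \<le> Inf (b' ` u))))"
    using assms unfolding key_property_def by (auto simp only: if_False)
  have Om: "Om \<subseteq> small_subsets sigma UNIV" using V(3) by (simp add: club_in_def unbounded_in_def)
  have key': "\<exists>b'. (\<forall>u\<in>small_subsets sigma UNIV. Inf (b' ` u) \<le> b u) \<and>
        (\<forall>f\<in>FI_on (underS |UNIV :: 'l set set| a). \<forall>u\<in>Om. xgen f \<le> b u \<longrightarrow>
          (\<exists>f'. FI_le f f' \<and> xgen f' \<le> Inf (b' ` u)))"
    if "V \<subseteq> underS |UNIV :: 'l set set| a" for a
  proof -
    from key[THEN spec, THEN mp, OF that] obtain b' :: "'l \<Rightarrow> ('l set, 'm, 't) B1"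
      where "\<forall>u\<in>small_subsets sigma UNIV. Inf (b' ` u) \<le> b u \<and> Inf (b' ` u) \<noteq> bot"
        and *: "\<forall>f\<in>FI_on (underS |UNIV :: 'l set set| a). \<forall>u\<in>Om. xgen f \<le> b u \<longrightarrow>
                 (\<exists>f'. FI_le f f' \<and> xgen f' \<le> Inf (b' ` u))"
      by (elim exE conjE)
    then have "\<forall>u\<in>small_subsets sigma UNIV. Inf (b' ` u) \<le> b u" by simp
    with * show ?thesis by (intro exI[of _ b'] conjI)
  qed
  have "key_witness b V Om"
    unfolding key_witness_def
    by (intro conjI V allI impI
        key_property_extend[OF V(1,2) key_property_imp_continuous[OF assms] Om key'])
  then show ?thesis by blast
qed

text \<open>The set \<open>W\<close> of new coordinates depends neither on the condition \<open>f\<close> nor on \<open>u\<close>: one \<open>W\<close> has to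
  serve all the sets \<open>w\<close> of stages simultaneously.\<close>

lemma ex_stage:
  fixes b :: "'l set \<Rightarrow> ('l set, 'm, 't) B1"
  assumes V: "|V| <o |UNIV :: 'l set set|" and b: "continuous_seq sigma b" and kw: "key_witness b Vb Om"
  shows "\<exists>W b'. |W| \<le>o |UNIV :: 'l set| \<and> (\<forall>u\<in>small_subsets sigma UNIV. Inf (b' ` u) \<le> b u) \<and>
    (\<forall>f\<in>FI_on V. \<forall>u\<in>Om. \<exists>g\<in>FI_on (V \<union> W). FI_le f g \<and> decides (xgen g) a \<and>
      ((\<exists>v. finite v \<and> v \<subseteq> u \<and> xgen g \<le> - b v) \<or> xgen g \<le> Inf (b' ` u)))"
proof -
  have Vb: "|Vb| \<le>o |UNIV :: 'l set|" "seq_supported Vb b"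
    and Om: "Om \<subseteq> small_subsets sigma UNIV"
    using kw by (simp_all add: key_witness_def club_in_def unbounded_in_def)
  obtain Wa where Wa: "|Wa| \<le>o |UNIV :: 'l set|" "supp Wa a" using ex_small_supp by blast
  define V1 where "V1 = V \<union> (Wa \<union> Vb)"
  have "|Wa \<union> Vb| \<le>o |UNIV :: 'l set|" by (rule small_Un_l[OF Wa(1) Vb(1)])
  then have V1: "|V1| <o |UNIV :: 'l set set|"
    unfolding V1_def
    by (intro card_of_Un_ordLess_infinite infinite_Pow_l V ordLeq_ordLess_trans[OF _ ordLess_UNIV_set])
  have "Vb \<subseteq> V1" by (auto simp: V1_def)
  then obtain b' where b': "\<forall>u\<in>small_subsets sigma UNIV. Inf (b' ` u) \<le> b u"
    "\<forall>f\<in>FI_on V1. \<forall>u\<in>Om. xgen f \<le> b u \<longrightarrow> (\<exists>f'. FI_le f f' \<and> xgen f' \<le> Inf (b' ` u))"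
    using kw V1 unfolding key_witness_def by meson
  have "\<forall>i. \<exists>X. |X| \<le>o |UNIV :: 'l set| \<and> supp X (b' i)" using ex_small_supp by blast
  from choice[OF this] obtain X where X: "\<forall>i. |X i| \<le>o |UNIV :: 'l set| \<and> supp (X i) (b' i)" ..
  \<comment> \<open>The supports of all \<open>b' i\<close> are collected at once; there are
    \<open>\<lambda>\<close> of them, so the union has size at most
    \<open>\<lambda>\<close>.\<close>
  define W2 where "W2 = (\<Union>i. X i)"
  have W2: "|W2| \<le>o |UNIV :: 'l set|"
    unfolding W2_def using X by (intro small_Union_l ordLeq_refl card_of_Card_order) simp
  define W where "W = (Wa \<union> Vb) \<union> W2"
  have W: "|W| \<le>o |UNIV :: 'l set|"
    unfolding W_def by (intro small_Un_l Wa(1) Vb(1) W2)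
  have VW: "V \<union> W = V1 \<union> W2" by (auto simp: W_def V1_def)
  have sa: "supp V1 a" by (rule supp_mono[OF Wa(2)]) (auto simp: V1_def)
  have sb: "supp V1 (b u)" if "u \<in> small_subsets sigma UNIV" for u
    by (rule supp_mono[OF key_supp[OF Vb(2) b that]]) (auto simp: V1_def)
  have sb': "supp (V \<union> W) (Inf (b' ` u))" for u
  proof (rule supp_Inf)
    fix c assume "c \<in> b' ` u"
    then obtain i where i: "c = b' i" by blast
    have "supp (X i) (b' i)" using X by simp
    moreover have "X i \<subseteq> V \<union> W" by (auto simp: W_def W2_def)
    ultimately show "supp (V \<union> W) c" unfolding i by (rule supp_mono)
  qed
  have V1W: "FI_on V1 \<subseteq> FI_on (V \<union> W)" unfolding VW by (rule FI_on_mono) blast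
  have step: "\<exists>g\<in>FI_on (V \<union> W). FI_le f g \<and> decides (xgen g) a \<and>
      ((\<exists>v. finite v \<and> v \<subseteq> u \<and> xgen g \<le> - b v) \<or> xgen g \<le> Inf (b' ` u))"
    if f: "f \<in> FI_on V" and u: "u \<in> Om" for f u
  proof -
    have us: "u \<in> small_subsets sigma UNIV" using u Om by blast
    have "f \<in> FI_on V1" using f FI_on_mono[of V V1] by (auto simp: V1_def)
    from supp_decides[OF sa this] obtain g1
      where g1: "g1 \<in> FI_on V1" "FI_le f g1" "decides (xgen g1) a" by blast
    have dec: "decides (xgen g) a" if "FI_le g1 g" for g
      by (rule decides_anti[OF xgen_mono[OF that] g1(3)])
    from supp_decides[OF sb[OF us] g1(1)] obtain g2
      where g2: "g2 \<in> FI_on V1" "FI_le g1 g2" "decides (xgen g2) (b u)" by blast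
    show ?thesis
    \<comment> \<open>Below \<open>b u\<close> the Key Property leads into the meet of the
      \<open>b' i\<close>. Otherwise continuity yields a finite \<open>v\<close> with
      \<open>g2\<close> not below \<open>b v\<close>, and some extension enters
      \<open>- b v\<close>.\<close>
    proof (cases "xgen g2 \<le> b u")
      case True
      then obtain f' where f': "FI_le g2 f'" "xgen f' \<le> Inf (b' ` u)" using b'(2) g2(1) u by blast
      \<comment> \<open>The extension \<open>f'\<close> may use any coordinates; cutting it back to
        a support of the meet keeps it below the meet.\<close>
      define g where "g = FI_restrict (V \<union> W) f'"
      have "FI_le g2 g" unfolding g_def using g2(1) V1W f'(1) by (intro le_FI_restrict) blast
      then have "FI_le g1 g" by (rule FI_le_trans[OF g2(2)])
      moreover have "xgen g \<le> Inf (b' ` u)" unfolding g_def by (rule suppD[OF sb' f'(2)])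
      moreover have "g \<in> FI_on (V \<union> W)" unfolding g_def by (rule FI_restrict_on)
      ultimately show ?thesis using dec FI_le_trans[OF g1(2)] by blast
    next
      case False
      then have "\<not> xgen g2 \<le> Inf (b ` {v. v \<subseteq> u \<and> finite v})"
        using continuous_seq_eq_Inf[OF b us] by simp
      then obtain v where v: "v \<subseteq> u" "finite v" "\<not> xgen g2 \<le> b v" by (auto simp: le_Inf_iff)
      obtain h where h: "FI_le g2 h" "xgen h \<le> - b v" using not_xgen_le[OF v(3)] by blast
      define g where "g = FI_restrict V1 h"
      have "FI_le g2 g" unfolding g_def by (rule le_FI_restrict[OF g2(1) h(1)])
      then have "FI_le g1 g" by (rule FI_le_trans[OF g2(2)])
      moreover have "xgen g \<le> - b v"
        unfolding g_def by (rule suppD[OF supp_compl[OF sb[OF finite_in_small[OF v(2)]]] h(2)])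
      moreover have "g \<in> FI_on (V \<union> W)" unfolding g_def using FI_restrict_on V1W by blast
      ultimately show ?thesis using dec FI_le_trans[OF g1(2)] v(1,2) by blast
    qed
  qed
  show ?thesis
    by (rule exI[of _ W], rule exI[of _ b'], intro conjI ballI) (use W b'(1) step in simp_all)
qed

text \<open>The uniform bound \<open>\<lambda>\<close> replaces regularity of
  \<open>2^\<lambda>\<close>: the union is no larger than the maximum of \<open>\<lambda>\<close>
  and the size of \<open>I\<close>.\<close>

lemma small_Union_Pow_l:
  assumes "|I| <o |UNIV :: 'l set set|" "\<And>i. i \<in> I \<Longrightarrow> |A i| \<le>o |UNIV :: 'l set|"
  shows "|\<Union>i\<in>I. A i| <o |UNIV :: 'l set set|"
proof (cases "|I| \<le>o |UNIV :: 'l set|")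
  case True
  then show ?thesis using assms(2) by (intro ordLeq_ordLess_trans[OF small_Union_l ordLess_UNIV_set])
next
  case False
  then have "|UNIV :: 'l set| \<le>o |I|"
    using ordLeq_total[OF card_of_Well_order card_of_Well_order] by blast
  moreover from this have "infinite I" using infinite_l by (rule card_of_ordLeq_infinite)
  ultimately have "|\<Union>i\<in>I. A i| \<le>o |I|"
    using assms(2) by (intro card_of_UNION_ordLeq_infinite ballI)
      (auto intro: ordLeq_transitive ordLeq_refl card_of_Card_order)
  then show ?thesis using assms(1) by (rule ordLeq_ordLess_trans)
qed

text \<open>A finite set is coded by the constant condition on the singletons of its elements, and
  such conditions were counted in \<open>FI_on_ordLeq\<close>.\<close>

lemma ex_inj_on_finite: "\<exists>enc :: 'l set \<Rightarrow> 'l. inj_on enc {v. finite v}"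
proof -
  obtain m :: 'm where True by blast
  define h where "h v = (Abs_FI (\<lambda>i. if i \<in> (\<lambda>x. {x}) ` v then Some m else None) :: ('l set, 'm, 't) FI)" for v
  have dom: "dom (Rep_FI (h v)) = (\<lambda>x. {x}) ` v" if "finite v" for v
  proof -
    have d: "dom (\<lambda>i. if i \<in> (\<lambda>x. {x}) ` v then Some m else None) = (\<lambda>x. {x}) ` v"
      by (auto simp: dom_def)
    have "|(\<lambda>x. {x}) ` v| <o |UNIV :: 't set|" using that by (intro small_finite) simp
    then show ?thesis unfolding h_def by (subst Abs_FI_inverse) (simp_all only: mem_Collect_eq d)
  qed
  have "inj_on h {v. finite v}"
  proof (rule inj_onI)
    fix v w assume "v \<in> {v. finite v}" "w \<in> {v. finite v}" "h v = h w"
    then have "(\<lambda>x. {x}) ` v = (\<lambda>x. {x}) ` w" using dom by (metis mem_Collect_eq)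
    then show "v = w" by (simp add: inj_image_eq_iff)
  qed
  moreover have "h ` {v. finite v} \<subseteq> FI_on (range (\<lambda>x. {x}))"
  proof (rule image_subsetI)
    fix v :: "'l set" assume "v \<in> {v. finite v}"
    then have "dom (Rep_FI (h v)) = (\<lambda>x. {x}) ` v" by (intro dom) simp
    then show "h v \<in> FI_on (range (\<lambda>x. {x}))" unfolding FI_on_def by blast
  qed
  ultimately have "|{v :: 'l set. finite v}| \<le>o |FI_on (range (\<lambda>x :: 'l. {x})) :: ('l set, 'm, 't) FI set|"
    using card_of_ordLeq by blast
  then have "|{v :: 'l set. finite v}| \<le>o |UNIV :: 'l set|"
    by (rule ordLeq_transitive[OF _ FI_on_ordLeq[OF card_of_image]])
  then show ?thesis using card_of_ordLeq[of "{v :: 'l set. finite v}" "UNIV :: 'l set"] by auto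
qed

text \<open>By continuity only the values at the \<open>\<lambda>\<close> finite sets matter, which
  leaves \<open>(2^\<lambda>)^\<lambda> = 2^\<lambda>\<close> sequences. Hence
  \<open>B \<alpha>\<close> is asked to agree with \<open>b\<close> at finite sets only.\<close>

lemma ex_enumeration_key:
  "\<exists>B :: 'l set \<Rightarrow> 'l set \<Rightarrow> ('l set, 'm, 't) B1. \<forall>b. key_property sigma b \<longrightarrow>
    (\<exists>\<alpha>. key_property sigma (B \<alpha>) \<and> (\<forall>v. finite v \<longrightarrow> B \<alpha> v = b v))"
proof -
  obtain enc :: "'l set \<Rightarrow> 'l" where enc: "inj_on enc {v. finite v}" using ex_inj_on_finite by blast
  obtain code :: "('l \<Rightarrow> ('l set, 'm, 't) B1) \<Rightarrow> 'l set" where code: "inj code"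
    using ex_inj_of_ordLeq[OF UNIV_fun_ordLeq[OF infinite_l UNIV_B1_ordLeq]] by blast
  define R where "R \<alpha> b \<longleftrightarrow> key_property sigma b \<and> (\<forall>v. finite v \<longrightarrow> b v = inv code \<alpha> (enc v))" for \<alpha> b
  \<comment> \<open>An index coding no sequence with the Key Property receives an arbitrary value,
    so later uses are guarded by \<open>key_property\<close>.\<close>
  define B where "B \<alpha> = (SOME b. R \<alpha> b)" for \<alpha>
  have "\<exists>\<alpha>. key_property sigma (B \<alpha>) \<and> (\<forall>v. finite v \<longrightarrow> B \<alpha> v = b v)" if b: "key_property sigma b" for b
  proof
    define c where "c l = b (inv_into {v. finite v} enc l)" for l
    have c: "inv code (code c) (enc v) = b v" if "finite v" for v
      using inv_into_f_f[OF enc, of v] that inv_f_f[OF code, of c] by (simp add: c_def)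
    then have "R (code c) b" using b by (simp add: R_def)
    then have "R (code c) (B (code c))" unfolding B_def by (rule someI[of "R (code c)"])
    then show "key_property sigma (B (code c)) \<and> (\<forall>v. finite v \<longrightarrow> B (code c) v = b v)"
      using c by (simp add: R_def)
  qed
  then show ?thesis by blast
qed

text \<open>Clubs, new coordinates and refinements are chosen here as functions of \<open>a\<close>,
  \<open>b\<close> and \<open>V\<close> only, before any \<open>w\<close> or condition is
  considered. Without the Key Property a stage merely decides \<open>a\<close>.\<close>

lemma ex_stage_choice:
  obtains Om :: "('l set \<Rightarrow> ('l set, 'm, 't) B1) \<Rightarrow> 'l set set"
    and W :: "('l set, 'm, 't) B1 \<Rightarrow> ('l set \<Rightarrow> ('l set, 'm, 't) B1) \<Rightarrow> 'l set set \<Rightarrow> 'l set set"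
    and r :: "('l set, 'm, 't) B1 \<Rightarrow> ('l set \<Rightarrow> ('l set, 'm, 't) B1) \<Rightarrow> 'l set set \<Rightarrow> 'l \<Rightarrow> ('l set, 'm, 't) B1"
  where "\<And>b. key_property sigma b \<Longrightarrow> club_in sigma UNIV (Om b)"
    and "\<And>a b V. |V| <o |UNIV :: 'l set set| \<Longrightarrow> |W a b V| \<le>o |UNIV :: 'l set|"
    and "\<And>a b V u. |V| <o |UNIV :: 'l set set| \<Longrightarrow> key_property sigma b \<Longrightarrow>
      u \<in> small_subsets sigma UNIV \<Longrightarrow> Inf (r a b V ` u) \<le> b u"
    and "\<And>a b V f u. |V| <o |UNIV :: 'l set set| \<Longrightarrow> f \<in> FI_on V \<Longrightarrow>
      \<exists>g\<in>FI_on (V \<union> W a b V). FI_le f g \<and> decides (xgen g) a \<and>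
        (key_property sigma b \<longrightarrow> u \<in> Om b \<longrightarrow>
          (\<exists>v. finite v \<and> v \<subseteq> u \<and> xgen g \<le> - b v) \<or> xgen g \<le> Inf (r a b V ` u))"
proof -
  define Om :: "('l set \<Rightarrow> ('l set, 'm, 't) B1) \<Rightarrow> 'l set set"
    where "Om b = (SOME Om. \<exists>V. key_witness b V Om)" for b
  have Om: "\<exists>V. key_witness b V (Om b)" if "key_property sigma b" for b
    unfolding Om_def by (rule someI_ex) (use ex_key_witness[OF that] in blast)
  define Q where "Q a b V W b' \<longleftrightarrow> |W| \<le>o |UNIV :: 'l set| \<and>
      (key_property sigma b \<longrightarrow> (\<forall>u\<in>small_subsets sigma UNIV. Inf (b' ` u) \<le> b u)) \<and>
      (\<forall>f\<in>FI_on V. \<forall>u. \<exists>g\<in>FI_on (V \<union> W). FI_le f g \<and> decides (xgen g) a \<and>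
        (key_property sigma b \<longrightarrow> u \<in> Om b \<longrightarrow>
          (\<exists>v. finite v \<and> v \<subseteq> u \<and> xgen g \<le> - b v) \<or> xgen g \<le> Inf (b' ` u)))"
    for a b V W and b' :: "'l \<Rightarrow> ('l set, 'm, 't) B1"
  have decide: "\<exists>W. |W| \<le>o |UNIV :: 'l set| \<and> (\<forall>f\<in>FI_on V. \<exists>g\<in>FI_on (V \<union> W). FI_le f g \<and> decides (xgen g) a)"
    for a :: "('l set, 'm, 't) B1" and V
  proof -
    obtain W where W: "|W| \<le>o |UNIV :: 'l set|" "supp W a" using ex_small_supp by blast
    have "supp (V \<union> W) a" by (rule supp_mono[OF W(2)]) simp
    then have "\<exists>g\<in>FI_on (V \<union> W). FI_le f g \<and> decides (xgen g) a" if "f \<in> FI_on V" for f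
      using FI_on_mono[of V "V \<union> W"] that by (intro supp_decides) auto
    then show ?thesis using W(1) by blast
  qed
  have exQ: "\<exists>W b'. |V| <o |UNIV :: 'l set set| \<longrightarrow> Q a b V W b'" for a b V
  proof (cases "|V| <o |UNIV :: 'l set set|")
    case V: True
    show ?thesis
    proof (cases "key_property sigma b")
      case True
      obtain Vb where "key_witness b Vb (Om b)" using Om[OF True] by blast
      from ex_stage[OF V key_property_imp_continuous[OF True] this, of a] obtain W b' where
        W: "|W| \<le>o |UNIV :: 'l set|" "\<forall>u\<in>small_subsets sigma UNIV. Inf (b' ` u) \<le> b u"
          "\<forall>f\<in>FI_on V. \<forall>u\<in>Om b. \<exists>g\<in>FI_on (V \<union> W). FI_le f g \<and> decides (xgen g) a \<and>
            ((\<exists>v. finite v \<and> v \<subseteq> u \<and> xgen g \<le> - b v) \<or> xgen g \<le> Inf (b' ` u))"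
        by (elim exE conjE)
      have "unbounded_in sigma UNIV (Om b)"
        using \<open>key_witness b Vb (Om b)\<close> by (simp add: key_witness_def club_in_def)
      then have "\<forall>u\<in>small_subsets sigma UNIV. \<exists>v\<in>Om b. u \<subseteq> v" by (simp add: unbounded_in_def)
      from bspec[OF this finite_in_small[of "{}"]] have ne: "\<exists>u. u \<in> Om b" by auto
      have "\<exists>g\<in>FI_on (V \<union> W). FI_le f g \<and> decides (xgen g) a \<and>
            (u \<in> Om b \<longrightarrow> (\<exists>v. finite v \<and> v \<subseteq> u \<and> xgen g \<le> - b v) \<or> xgen g \<le> Inf (b' ` u))"
        if f: "f \<in> FI_on V" for f u
      proof (cases "u \<in> Om b")
        case True
        show ?thesis using W(3)[THEN bspec, OF f, THEN bspec, OF True] by blast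
      next
        case False
        \<comment> \<open>Outside the club only the decision of \<open>a\<close> is wanted, and any
          member of the club provides it.\<close>
        obtain u' where "u' \<in> Om b" using ne by blast
        then show ?thesis using W(3)[THEN bspec, OF f, THEN bspec, of u'] False by blast
      qed
      then have "Q a b V W b'" using W(1,2) by (simp add: Q_def True)
      then show ?thesis by blast
    next
      case False
      obtain W where "|W| \<le>o |UNIV :: 'l set|" "\<forall>f\<in>FI_on V. \<exists>g\<in>FI_on (V \<union> W). FI_le f g \<and> decides (xgen g) a"
        using decide by blast
      then have "Q a b V W undefined" by (simp add: Q_def False)
      then show ?thesis by blast
    qed
  qed simp
  define W where "W a b V = (SOME W. \<exists>b'. |V| <o |UNIV :: 'l set set| \<longrightarrow> Q a b V W b')" for a b V
  have WQ: "\<exists>b'. |V| <o |UNIV :: 'l set set| \<longrightarrow> Q a b V (W a b V) b'" for a b V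
    unfolding W_def by (rule someI_ex) (rule exQ)
  define r where "r a b V = (SOME b'. |V| <o |UNIV :: 'l set set| \<longrightarrow> Q a b V (W a b V) b')" for a b V
  have rQ: "Q a b V (W a b V) (r a b V)" if "|V| <o |UNIV :: 'l set set|" for a b V
    using someI_ex[OF WQ, of V a b] that unfolding r_def by blast
  show thesis
  proof (rule that[of Om W r])
    show "club_in sigma UNIV (Om b)" if "key_property sigma b" for b
      using Om[OF that] unfolding key_witness_def by blast
  qed (use rQ in \<open>simp_all add: Q_def\<close>)
qed

text \<open>The common core of both claims: \<open>G\<close> has a small common support and nonzero
  infima of fewer than \<open>\<sigma>\<close> members.\<close>

lemma ex_optimal:
  fixes G :: "('l set, 'm, 't) B1 set"
  assumes V0: "|V0| <o |UNIV :: 'l set set|" "\<And>a. a \<in> G \<Longrightarrow> supp V0 a"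
    and G: "\<And>C. C \<subseteq> G \<Longrightarrow> |C| <o sigma \<Longrightarrow> Inf C \<noteq> bot"
  shows "\<exists>D. optimal sigma D \<and> G \<subseteq> D"
proof -
  let ?r = "|UNIV :: 'l set set|"
  have wo: "Well_order ?r" by (rule card_of_Well_order)
  then have wf: "wf (?r - Id)" by (simp add: well_order_on_def)
  obtain av :: "'l set \<Rightarrow> ('l set, 'm, 't) B1" where av: "surj av"
    using ex_inj_of_ordLeq[OF UNIV_B1_ordLeq] inj_imp_surj_inv by blast
  obtain B :: "'l set \<Rightarrow> 'l set \<Rightarrow> ('l set, 'm, 't) B1" where B: "\<And>b. key_property sigma b \<Longrightarrow>
    \<exists>\<alpha>. key_property sigma (B \<alpha>) \<and> (\<forall>v. finite v \<longrightarrow> B \<alpha> v = b v)"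
    using ex_enumeration_key by blast
  obtain Om :: "('l set \<Rightarrow> ('l set, 'm, 't) B1) \<Rightarrow> 'l set set"
    and W :: "('l set, 'm, 't) B1 \<Rightarrow> ('l set \<Rightarrow> ('l set, 'm, 't) B1) \<Rightarrow> 'l set set \<Rightarrow> 'l set set"
    and r :: "('l set, 'm, 't) B1 \<Rightarrow> ('l set \<Rightarrow> ('l set, 'm, 't) B1) \<Rightarrow> 'l set set \<Rightarrow> 'l \<Rightarrow> ('l set, 'm, 't) B1"
    where Om: "\<And>b. key_property sigma b \<Longrightarrow> club_in sigma UNIV (Om b)"
    and W: "\<And>a b V. |V| <o ?r \<Longrightarrow> |W a b V| \<le>o |UNIV :: 'l set|"
    and r: "\<And>a b V u. |V| <o ?r \<Longrightarrow> key_property sigma b \<Longrightarrow>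
      u \<in> small_subsets sigma UNIV \<Longrightarrow> Inf (r a b V ` u) \<le> b u"
    and stage: "\<And>a b V f u. |V| <o ?r \<Longrightarrow> f \<in> FI_on V \<Longrightarrow>
      \<exists>g\<in>FI_on (V \<union> W a b V). FI_le f g \<and> decides (xgen g) a \<and>
        (key_property sigma b \<longrightarrow> u \<in> Om b \<longrightarrow>
          (\<exists>v. finite v \<and> v \<subseteq> u \<and> xgen g \<le> - b v) \<or> xgen g \<le> Inf (r a b V ` u))"
    by (rule ex_stage_choice) (rule that)
  \<comment> \<open>\<open>V \<alpha>\<close> includes the coordinates of all stages below
    \<open>\<alpha>\<close>, whether or not they belong to a given \<open>w\<close>; hence it is the
    same for every \<open>w\<close>.\<close>
  define V where "V = wfrec (?r - Id) (\<lambda>V \<alpha>. V0 \<union> (\<Union>\<beta>\<in>underS ?r \<alpha>. W (av \<beta>) (B \<beta>) (V \<beta>)))"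
  define W' where "W' \<alpha> = W (av \<alpha>) (B \<alpha>) (V \<alpha>)" for \<alpha>
  have V: "V \<alpha> = V0 \<union> (\<Union>\<beta>\<in>underS ?r \<alpha>. W' \<beta>)" for \<alpha>
  proof -
    have "V \<alpha> = V0 \<union> (\<Union>\<beta>\<in>underS ?r \<alpha>. W (av \<beta>) (B \<beta>) (cut V (?r - Id) \<alpha> \<beta>))"
      by (rule def_wfrec[OF _ wf]) (simp add: V_def)
    moreover have "(\<Union>\<beta>\<in>underS ?r \<alpha>. W (av \<beta>) (B \<beta>) (cut V (?r - Id) \<alpha> \<beta>)) = (\<Union>\<beta>\<in>underS ?r \<alpha>. W' \<beta>)"
      by (rule SUP_cong) (auto simp: cut_def underS_def W'_def)
    ultimately show ?thesis by (simp only:)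
  qed
  have Vsmall: "|V \<alpha>| <o ?r" for \<alpha>
    using wf
  proof (induction \<alpha>)
    case (less \<alpha>)
    have "|W' \<beta>| \<le>o |UNIV :: 'l set|" if "\<beta> \<in> underS ?r \<alpha>" for \<beta>
      unfolding W'_def by (rule W[OF less]) (use that in \<open>simp add: underS_def\<close>)
    then have "|\<Union>\<beta>\<in>underS ?r \<alpha>. W' \<beta>| <o ?r" by (intro small_Union_Pow_l underS_card_of_ordLess)
    then show ?case unfolding V[of \<alpha>] by (intro card_of_Un_ordLess_infinite infinite_Pow_l V0(1))
  qed
  have "trans ?r" "antisym ?r" using wo by (auto simp: order_on_defs)
  then have V_step: "V \<alpha> \<union> W' \<alpha> \<subseteq> V \<beta>" if "\<alpha> \<in> underS ?r \<beta>" for \<alpha> \<beta>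
  proof -
    have "underS ?r \<alpha> \<subseteq> underS ?r \<beta>"
      using that \<open>trans ?r\<close> \<open>antisym ?r\<close> unfolding underS_def by (blast dest: transD antisymD)
    then show ?thesis unfolding V[of \<alpha>] V[of \<beta>] using that by blast
  qed
  \<comment> \<open>The singletons form the copy of \<open>\<lambda>\<close> inside
    \<open>2^\<lambda>\<close> on which the trace of \<open>w\<close> is taken.\<close>
  define e where "e i = {i}" for i :: 'l
  have e: "inj e" by (simp add: e_def inj_def)
  define P where "P w \<alpha> g \<longleftrightarrow> decides (xgen g) (av \<alpha>) \<and>
        (key_property sigma (B \<alpha>) \<longrightarrow> e -` w \<in> Om (B \<alpha>) \<longrightarrow>
          (\<exists>v. finite v \<and> v \<subseteq> e -` w \<and> xgen g \<le> - B \<alpha> v) \<or>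
            xgen g \<le> Inf (r (av \<alpha>) (B \<alpha>) (V \<alpha>) ` (e -` w)))" for w \<alpha> g
  have P_mono: "P w \<alpha> g" if "P w \<alpha> f" "FI_le f g" for w \<alpha> f g
    using that(1) decides_anti[OF xgen_mono[OF that(2)]] order_trans[OF xgen_mono[OF that(2)]]
    unfolding P_def by meson
  have "\<exists>f. (\<forall>\<alpha>\<in>w. av \<alpha> \<in> G \<longrightarrow> xgen f \<le> av \<alpha>) \<and> (\<forall>\<alpha>\<in>w. P w \<alpha> f)" if w: "|w| <o sigma" for w
  proof -
    have "|G \<inter> av ` w| <o sigma"
      using ordLeq_ordLess_trans[OF ordLeq_transitive[OF card_of_mono1[OF Int_lower2] card_of_image] w] .
    then have "Inf (G \<inter> av ` w) \<noteq> bot" by (intro G) auto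
    moreover have "supp V0 (Inf (G \<inter> av ` w))" by (rule supp_Inf) (use V0(2) in blast)
    \<comment> \<open>The start below the listed members of \<open>G\<close> is taken on
      \<open>V0\<close>, which every level contains.\<close>
    ultimately obtain f0 where f0: "f0 \<in> FI_on V0" "xgen f0 \<le> Inf (G \<inter> av ` w)" using supp_dense by blast
    \<comment> \<open>Only the stages in \<open>w\<close> are met. There are fewer than
      \<open>\<sigma> \<le> \<theta>\<close> of them, so the conditions built have upper
      bounds.\<close>
    have "\<exists>f. FI_le f0 f \<and> (\<forall>\<alpha>\<in>w. P w \<alpha> f)"
    proof (rule meet_dense_sets[of w ?r V "\<lambda>\<alpha>. V \<alpha> \<union> W' \<alpha>"])
      show "|w| <o |UNIV :: 't set|" by (rule ordLess_ordLeq_trans[OF w sigma_le_t])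
      show "w \<subseteq> Field ?r" by (simp add: Field_card_of)
      show "\<exists>g\<in>FI_on (V \<alpha> \<union> W' \<alpha>). FI_le f g \<and> P w \<alpha> g" if "f \<in> FI_on (V \<alpha>)" for \<alpha> f
        unfolding P_def W'_def by (rule stage[OF Vsmall that])
      show "f0 \<in> FI_on (V \<alpha>)" for \<alpha> using f0(1) FI_on_mono[of V0 "V \<alpha>"] V[of \<alpha>] by blast
    qed (use wo V_step P_mono in blast)+
    then obtain f where f: "FI_le f0 f" "\<forall>\<alpha>\<in>w. P w \<alpha> f" by blast
    have "xgen f \<le> av \<alpha>" if "\<alpha> \<in> w" "av \<alpha> \<in> G" for \<alpha>
    proof -
      have "Inf (G \<inter> av ` w) \<le> av \<alpha>" using that by (intro Inf_lower) blast
      then show ?thesis using xgen_mono[OF f(1)] f0(2) by (meson order_trans)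
    qed
    then show ?thesis using f(2) by blast
  qed
  then have "\<forall>w. \<exists>f. |w| <o sigma \<longrightarrow> (\<forall>\<alpha>\<in>w. av \<alpha> \<in> G \<longrightarrow> xgen f \<le> av \<alpha>) \<and> (\<forall>\<alpha>\<in>w. P w \<alpha> f)"
    by blast
  from choice[OF this] obtain F where F: "\<And>w \<alpha>. |w| <o sigma \<Longrightarrow> \<alpha> \<in> w \<Longrightarrow> av \<alpha> \<in> G \<Longrightarrow> xgen (F w) \<le> av \<alpha>"
    "\<And>w \<alpha>. |w| <o sigma \<Longrightarrow> \<alpha> \<in> w \<Longrightarrow> P w \<alpha> (F w)" by blast
  define D where "D = {a. often (\<lambda>w. xgen (F w) \<le> a)}"
  have av_surj: "\<exists>\<alpha>. a = av \<alpha>" for a using av by (rule surjD)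
  have D_Inf: "Inf C \<in> D" if "C \<subseteq> D" "|C| <o sigma" for C
  proof -
    have "often (\<lambda>w. \<forall>c\<in>C. xgen (F w) \<le> c)"
      using that by (intro often_ball) (auto simp: D_def)
    then show ?thesis by (simp add: D_def le_Inf_iff)
  qed
  have D_bot: "bot \<notin> D"
  proof
    assume "bot \<in> D"
    then have "often (\<lambda>w. xgen (F w) \<le> bot)" by (simp add: D_def)
    from often_ex[OF this] show False by (simp add: bot_unique)
  qed
  have D_up: "b \<in> D" if "a \<in> D" "a \<le> b" for a b
    using that often_mono[of "\<lambda>w. xgen (F w) \<le> a" "\<lambda>w. xgen (F w) \<le> b"] unfolding D_def
    by (auto intro: order_trans)
  have D_inf: "inf a b \<in> D" if "a \<in> D" "b \<in> D" for a b
    using that often_conj by (simp add: D_def)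
  have D_top: "top \<in> D" using often_True by (simp add: D_def)
  have D_ultra: "a \<in> D \<or> - a \<in> D" for a
  proof -
    obtain \<alpha> where \<alpha>: "a = av \<alpha>" using av_surj by blast
    \<comment> \<open>By fineness almost every \<open>w\<close> contains the stage
      \<open>\<alpha>\<close> that decides \<open>a\<close>.\<close>
    have *: "often (\<lambda>w. decides (xgen (F w)) a)"
      by (rule often_mono[OF often_mem[of \<alpha>]]) (use F(2) \<alpha> in \<open>simp add: P_def\<close>)
    have "often (\<lambda>w. xgen (F w) \<le> - a)" if "often (\<lambda>w. \<not> xgen (F w) \<le> a)"
      by (rule often_mono[OF often_conj[OF * that]]) (auto simp: decides_def)
    then show ?thesis using often_or_not[of "\<lambda>w. xgen (F w) \<le> a"] by (auto simp: D_def)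
  qed
  have D_filter: "ba_filter D" unfolding ba_filter_def using D_top D_bot D_up D_inf by blast
  have D_complete: "complete_filter sigma D" unfolding complete_filter_def using D_filter D_Inf by blast
  have "G \<subseteq> D"
  proof
    fix a assume a: "a \<in> G"
    obtain \<alpha> where \<alpha>: "a = av \<alpha>" using av_surj by blast
    have "often (\<lambda>w. xgen (F w) \<le> a)"
      by (rule often_mono[OF often_mem[of \<alpha>]]) (use F(1) \<alpha> a in simp)
    then show "a \<in> D" by (simp add: D_def)
  qed
  moreover have "\<exists>b'. multiplicative_refinement sigma D b b'"
    if bD: "\<And>u. u \<in> small_subsets sigma UNIV \<Longrightarrow> b u \<in> D" and key: "key_property sigma b" for b
  proof -
    obtain \<alpha> where \<alpha>: "key_property sigma (B \<alpha>)" "\<And>v. finite v \<Longrightarrow> B \<alpha> v = b v" using B[OF key] by blast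
    \<comment> \<open>The refinement belongs to stage \<open>\<alpha>\<close> itself and is
      therefore common to all \<open>w\<close>.\<close>
    define b' where "b' = r (av \<alpha>) (B \<alpha>) (V \<alpha>)"
    have Bb: "B \<alpha> u = b u" if "u \<in> small_subsets sigma UNIV" for u
    proof -
      have "B \<alpha> ` {v. v \<subseteq> u \<and> finite v} = b ` {v. v \<subseteq> u \<and> finite v}"
        using \<alpha>(2) by (intro image_cong) auto
      then show ?thesis
        using continuous_seq_eq_Inf[OF key_property_imp_continuous[OF \<alpha>(1)] that]
          continuous_seq_eq_Inf[OF key_property_imp_continuous[OF key] that] by simp
    qed
    let ?A = "\<lambda>w. \<exists>v. finite v \<and> v \<subseteq> e -` w \<and> xgen (F w) \<le> - b v"
    have "\<not> often ?A"
    proof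
      assume "often ?A"
      from often_finite_vimage_regressive[OF e this] obtain v
        where v: "finite v" "often (\<lambda>w. xgen (F w) \<le> - b v)" by blast
      then have "- b v \<in> D" by (simp add: D_def)
      then have "inf (b v) (- b v) \<in> D" using bD[OF finite_in_small[OF v(1)]] D_inf by blast
      then show False using D_bot by simp
    qed
    then have notA: "often (\<lambda>w. \<not> ?A w)" using often_or_not by blast
    have b'D: "b' i \<in> D" for i
    proof -
      \<comment> \<open>For such \<open>w\<close> stage \<open>\<alpha>\<close> was carried out, its
        trace lies in the club, and the first alternative fails. So \<open>F w\<close> entered the
        meet over a trace containing \<open>i\<close>.\<close>
      have "often (\<lambda>w. (\<not> ?A w \<and> e -` w \<in> Om (B \<alpha>)) \<and> (\<alpha> \<in> w \<and> e i \<in> w))"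
        by (intro often_conj notA often_club[OF e Om[OF \<alpha>(1)]] often_mem)
      then have "often (\<lambda>w. xgen (F w) \<le> b' i)"
      proof (rule often_mono)
        fix w :: "'l set set"
        assume w: "|w| <o sigma" and *: "(\<not> ?A w \<and> e -` w \<in> Om (B \<alpha>)) \<and> (\<alpha> \<in> w \<and> e i \<in> w)"
        have "P w \<alpha> (F w)" using F(2)[OF w] * by blast
        moreover have "\<not> (\<exists>v. finite v \<and> v \<subseteq> e -` w \<and> xgen (F w) \<le> - B \<alpha> v)"
          using * \<alpha>(2) by (metis (no_types, lifting))
        ultimately have "xgen (F w) \<le> Inf (b' ` (e -` w))" using * \<alpha>(1) unfolding P_def b'_def by blast
        moreover have "Inf (b' ` (e -` w)) \<le> b' i" using * by (intro Inf_lower) simp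
        ultimately show "xgen (F w) \<le> b' i" by (rule order_trans)
      qed
      then show ?thesis by (simp add: D_def)
    qed
    have "multiplicative_refinement sigma D b (\<lambda>u. Inf (b' ` u))"
      unfolding multiplicative_refinement_def
    proof (intro conjI ballI)
      fix u assume u: "u \<in> small_subsets sigma (UNIV :: 'l set)"
      then have "|b' ` u| <o sigma"
        using ordLeq_ordLess_trans[OF card_of_image] by (simp add: small_subsets_def)
      then show "Inf (b' ` u) \<in> D" using b'D by (intro D_Inf) auto
      show "Inf (b' ` u) \<le> b u" using r[OF Vsmall \<alpha>(1) u] Bb[OF u] by (simp add: b'_def)
    next
      fix u v :: "'l set"
      show "inf (Inf (b' ` u)) (Inf (b' ` v)) = Inf (b' ` (u \<union> v))"
        by (simp add: image_Un Inf_union_distrib)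
    qed
    then show ?thesis by blast
  qed
  ultimately show ?thesis
    unfolding optimal_def ba_ultrafilter_def
    using D_filter D_ultra D_complete by (intro exI[of _ D]) simp
qed

end

text \<open>The type \<open>'u\<close> must have at least \<open>2^\<lambda>\<close> elements
  because the normal ultrafilter is needed on the small subsets of \<open>2^\<lambda>\<close>. Both
  claims come from \<open>ex_optimal\<close>, the first with \<open>G\<close> empty.\<close>

theorem theorem5p9:
  fixes lam :: "'l rel" and mu :: "'m rel" and theta :: "'t rel" and sigma :: "'s rel"
  assumes lam: "lam = |UNIV :: 'l set|"
    and mu: "mu = |UNIV :: 'm set|"
    and theta: "theta = |UNIV :: 't set|"
    and suit: "suitable lam mu theta sigma"
    and uncountable: "natLeq <o sigma"
    and universe: "|UNIV :: 'l set set| \<le>o |UNIV :: 'u set|"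
    and supercompact: "supercompact TYPE('u) sigma"
  shows "(\<exists>D :: ('l set, 'm, 't) B1 set. optimal sigma D) \<and>
    (\<forall>(D0 :: ('l set, 'm, 't) B1 set) G.
       complete_filter sigma D0 \<and> generates_filter sigma G D0 \<and>
       ( |G| <o |UNIV :: 'l set set| \<or>
         (\<exists>V :: 'l set set. |V| <o |UNIV :: 'l set set| \<and> (\<forall>a\<in>G. supported V a))) \<longrightarrow>
       (\<exists>D. optimal sigma D \<and> D0 \<subseteq> D))"
proof -
  have s: "Cinfinite |UNIV :: 'l set|" "Cinfinite |UNIV :: 'm set|" "Cinfinite |UNIV :: 't set|" "Cinfinite sigma"
    "sigma \<le>o |UNIV :: 't set|" "|UNIV :: 't set| \<le>o |UNIV :: 'm set|" "|UNIV :: 'm set| <o |UNIV :: 'l set|"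
    "regularCard |UNIV :: 't set|" "|UNIV :: 'l set| =o less_cexp |UNIV :: 'l set| |UNIV :: 't set|"
    using suit unfolding suitable_def lam mu theta by blast+
  have ml: "|UNIV :: 'm set| \<le>o |UNIV :: 'l set|" by (rule ordLess_imp_ordLeq[OF s(7)])
  have tl: "|UNIV :: 't set| \<le>o |UNIV :: 'l set|" by (rule ordLeq_transitive[OF s(6) ml])
  have "sigma \<le>o |UNIV :: 'l set set|"
    by (rule ordLeq_transitive[OF ordLeq_transitive[OF s(5) tl] ordLess_imp_ordLeq[OF ordLess_UNIV_set]])
  from supercompact_imp_normal_ultrafilter[OF supercompact s(4) uncountable universe this]
  obtain U :: "'l set set set set" where U: "normal_ultrafilter sigma U" by blast
  have inf: "infinite (UNIV :: 'l set)" "infinite (UNIV :: 'm set)" "infinite (UNIV :: 't set)"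
    using s(1,2,3) by (simp_all add: cinfinite_def Field_card_of)
  have l_power: "less_cexp |UNIV :: 'l set| |UNIV :: 't set| \<le>o |UNIV :: 'l set|"
    by (rule ordIso_imp_ordLeq[OF ordIso_symmetric[OF s(9)]])
  interpret normal_ultrafilter sigma U by (rule U)
  interpret optimal_setup "TYPE('l set \<times> 'm \<times> 't)" sigma U
    by unfold_locales (fact inf s(8) ml tl l_power s(5))+
  show ?thesis
  proof (intro conjI allI impI)
    have "\<exists>D :: ('l set, 'm, 't) B1 set. optimal sigma D \<and> {} \<subseteq> D"
    proof (rule ex_optimal[of "{}"])
      show "|{} :: 'l set set| <o |UNIV :: 'l set set|"
        by (rule ordLeq_ordLess_trans[OF card_of_empty ordLess_UNIV_set])
      fix C :: "('l set, 'm, 't) B1 set" assume "C \<subseteq> {}"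
      then have "Inf C = top" by simp
      then show "Inf C \<noteq> bot"
        using xgen_neq_bot top_greatest bot_unique by metis
    qed simp
    then show "\<exists>D :: ('l set, 'm, 't) B1 set. optimal sigma D" by blast
  next
    fix D0 G :: "('l set, 'm, 't) B1 set"
    assume *: "complete_filter sigma D0 \<and> generates_filter sigma G D0 \<and>
       ( |G| <o |UNIV :: 'l set set| \<or>
         (\<exists>V :: 'l set set. |V| <o |UNIV :: 'l set set| \<and> (\<forall>a\<in>G. supported V a)))"
    then have GD0: "G \<subseteq> D0" by (simp add: generates_filter_def)
    \<comment> \<open>Fewer than \<open>2^\<lambda>\<close> generators have a small common support,
      since each has one of size at most \<open>\<lambda>\<close>. In the other case the support is
      given.\<close>
    have "\<exists>V0 :: 'l set set. |V0| <o |UNIV :: 'l set set| \<and> (\<forall>a\<in>G. supp V0 a)"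
    proof (cases "|G| <o |UNIV :: 'l set set|")
      case True
      have "\<forall>a :: ('l set, 'm, 't) B1. \<exists>V. |V| \<le>o |UNIV :: 'l set| \<and> supp V a" using ex_small_supp by blast
      from choice[OF this] obtain V where V: "\<forall>a. |V a| \<le>o |UNIV :: 'l set| \<and> supp (V a) a" ..
      have "|\<Union>a\<in>G. V a| <o |UNIV :: 'l set set|" using V by (intro small_Union_Pow_l[OF True]) simp
      moreover have "supp (\<Union>a\<in>G. V a) a" if "a \<in> G" for a
      proof (rule supp_mono)
        show "supp (V a) a" using V by simp
      qed (use that in blast)
      ultimately show ?thesis by blast
    next
      case False
      then obtain V where "|V| <o |UNIV :: 'l set set|" "\<forall>a\<in>G. supported V a" using * by (elim conjE disjE exE) simp_all
      then show ?thesis by (intro exI[of _ V]) (simp add: supported_imp_supp)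
    qed
    then obtain V0 :: "'l set set" where V0: "|V0| <o |UNIV :: 'l set set|" "\<And>a. a \<in> G \<Longrightarrow> supp V0 a" by blast
    \<comment> \<open>The infima stay in the complete filter \<open>D0\<close>, so they are
      nonzero.\<close>
    have "Inf C \<noteq> bot" if "C \<subseteq> G" "|C| <o sigma" for C
    proof -
      have "Inf C \<in> D0" using * that GD0 by (simp add: complete_filter_def)
      then show ?thesis using * by (auto simp: complete_filter_def ba_filter_def)
    qed
    from ex_optimal[OF V0 this] obtain D where D: "optimal sigma D" "G \<subseteq> D" by blast
    then have "complete_filter sigma D" by (simp add: optimal_def)
    \<comment> \<open>\<open>D0\<close> is least among the complete filters containing
      \<open>G\<close>, and \<open>D\<close> is one of them.\<close>
    then have "D0 \<subseteq> D" using * D(2) by (simp add: generates_filter_def)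
    then show "\<exists>D. optimal sigma D \<and> D0 \<subseteq> D" using D(1) by blast
  qed
qed

end
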